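(* Let $p$ be a prime and let $G$ be a finite non-cyclic $p$-group. Then $G$ has a cyclic subgroup of index $p$ if and only if $$\mathsf{d}(G)+1=\mathsf{D}_o(G)=\mathsf{L}(G)=\frac{|G|}{p}+p-1.$$
   Context: A sequence over a finite group $G$ is a finite unordered multiset of elements of $G$ (an element of the free abelian monoid $\mathcal{F}(G)$ on $G$), of length $|S|$ counted with multiplicity. For $S=g_1\cdot g_2\cdots g_\ell$, $\pi(S)=\{\prod_{i=1}^{\ell} g_{\sigma(i)} : \sigma\in\mathfrak{S}_\ell\}$, and $\Pi(S)=\bigcup_{T\mid S,\ |T|\ge1}\pi(T)$, the union over nonempty subsequences (sub-multisets) $T$ of $S$. The small Davenport constant is $\mathsf{d}(G)=\sup\{|S| : S\in\mathcal{F}(G),\ 1\notin\Pi(S)\}$. An ordered sequence over $G$ is a finite tuple $S^*=(g_1,\dots,g_\ell)$ of elements of $G$; $\Pi(S^* )$ is the set of products $g_{i_1}g_{i_2}\cdots g_{i_k}$ with $k\ge 1$ and $1\le i_1<\dots<i_k\le\ell$. The ordered Davenport constant $\mathsf{D}_o(G)$ is the least $k\in\mathbb{N}$ such that every ordered sequence $S^*$ over $G$ of length $|S^*|\ge k$ satisfies $1\in\Pi(S^* )$. For a finite $p$-group $G$, the Loewy length $\mathsf{L}(G)$ is the nilpotency index of the Jacobson radical $J$ of the group algebra $\mathbb{F}_p[G]$, i.e. the least $n\ge1$ with $J^n=0$. *)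

theory Defs
  imports
    "HOL-Algebra.Elementary_Groups"
    "HOL-Algebra.Ideal_Product"
    "HOL-Number_Theory.Residues"
    "HOL-Combinatorics.Multiset_Permutations"
    "HOL-Library.Sublist"
    "HOL-Library.Extended_Nat"
begin

section \<open>Davenport constants\<close>

definition list_product :: "('a, 'b) monoid_scheme \<Rightarrow> 'a list \<Rightarrow> 'a" where
  "list_product G xs = foldr (\<lambda>x y. x \<otimes>\<^bsub>G\<^esub> y) xs \<one>\<^bsub>G\<^esub>"

definition perm_products :: "('a, 'b) monoid_scheme \<Rightarrow> 'a multiset \<Rightarrow> 'a set" where
  "perm_products G S = list_product G ` permutations_of_multiset S"

definition subseq_products :: "('a, 'b) monoid_scheme \<Rightarrow> 'a multiset \<Rightarrow> 'a set" where
  "subseq_products G S = (\<Union>T \<in> {T. T \<subseteq># S \<and> size T \<ge> 1}. perm_products G T)"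

text \<open>The constants below take values in \<open>enat\<close>, where \<open>SUP\<close> is a genuine supremum, and
  \<open>INF\<close> over a set of natural numbers is its least element (\<open>\<infinity>\<close> if the set is empty).\<close>

definition small_davenport :: "('a, 'b) monoid_scheme \<Rightarrow> enat" where
  "small_davenport G =
     (SUP S \<in> {S. set_mset S \<subseteq> carrier G \<and> \<one>\<^bsub>G\<^esub> \<notin> subseq_products G S}. enat (size S))"

definition ordered_products :: "('a, 'b) monoid_scheme \<Rightarrow> 'a list \<Rightarrow> 'a set" where
  "ordered_products G xs = list_product G ` {ys. subseq ys xs \<and> length ys \<ge> 1}"

definition ordered_davenport :: "('a, 'b) monoid_scheme \<Rightarrow> enat" where
  "ordered_davenport G =
     (INF k \<in> {k::nat. \<forall>xs. set xs \<subseteq> carrier G \<and> length xs \<ge> k \<longrightarrow>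
                           \<one>\<^bsub>G\<^esub> \<in> ordered_products G xs}. enat k)"


section \<open>Group algebras and the Jacobson radical\<close>

text \<open>The group algebra \<open>R[G]\<close> of a finite group \<open>G\<close>: the element \<open>\<Sum>g. a g \<cdot> g\<close> is the function
  \<open>a\<close> from \<open>carrier G\<close> to \<open>carrier R\<close>, extended by \<open>undefined\<close> outside \<open>carrier G\<close>.  No
  finite-support condition is imposed, so the definition is only meant for finite \<open>G\<close>.\<close>

definition group_algebra ::
    "('r, 'm) ring_scheme \<Rightarrow> ('a, 'b) monoid_scheme \<Rightarrow> ('a \<Rightarrow> 'r) ring" where
  "group_algebra R G =
     \<lparr>carrier = carrier G \<rightarrow>\<^sub>E carrier R,
      monoid.mult = \<lambda>a b. \<lambda>g\<in>carrier G.
        \<Oplus>\<^bsub>R\<^esub>h\<in>carrier G. a h \<otimes>\<^bsub>R\<^esub> b (inv\<^bsub>G\<^esub> h \<otimes>\<^bsub>G\<^esub> g),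
      one = \<lambda>g\<in>carrier G. if g = \<one>\<^bsub>G\<^esub> then \<one>\<^bsub>R\<^esub> else \<zero>\<^bsub>R\<^esub>,
      zero = \<lambda>g\<in>carrier G. \<zero>\<^bsub>R\<^esub>,
      add = \<lambda>a b. \<lambda>g\<in>carrier G. a g \<oplus>\<^bsub>R\<^esub> b g\<rparr>"

definition left_ideal :: "'a set \<Rightarrow> ('a, 'm) ring_scheme \<Rightarrow> bool" where
  "left_ideal I R \<longleftrightarrow> additive_subgroup I R \<and> (\<forall>x\<in>carrier R. \<forall>a\<in>I. x \<otimes>\<^bsub>R\<^esub> a \<in> I)"

definition maximal_left_ideal :: "'a set \<Rightarrow> ('a, 'm) ring_scheme \<Rightarrow> bool" where
  "maximal_left_ideal I R \<longleftrightarrow> left_ideal I R \<and> I \<noteq> carrier R \<and>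
     (\<forall>J. left_ideal J R \<and> I \<subseteq> J \<longrightarrow> J = I \<or> J = carrier R)"

definition jacobson_radical :: "('a, 'm) ring_scheme \<Rightarrow> 'a set" where
  "jacobson_radical R = carrier R \<inter> \<Inter>{I. maximal_left_ideal I R}"

text \<open>\<open>ideals_set A\<close> multiplies ideals by \<open>ideal_prod\<close>, so the power below is the usual power of
  an ideal (all finite sums of \<open>n\<close>-fold products).\<close>

definition loewy_length :: "nat \<Rightarrow> ('a, 'b) monoid_scheme \<Rightarrow> enat" where
  "loewy_length p G =
     (let A = group_algebra (residue_ring (int p)) G
      in INF n \<in> {n::nat. n \<ge> 1 \<and> jacobson_radical A [^]\<^bsub>ideals_set A\<^esub> n = {\<zero>\<^bsub>A\<^esub>}}. enat n)"

end

theory Submission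
  imports Defs "HOL-Algebra.Group_Action" "HOL-Algebra.Sylow"
begin

text \<open>
  Let \<open>I\<close> be the augmentation ideal of \<open>F\<^sub>p[G]\<close>. Expanding \<open>(g\<^sub>1 - 1) \<cdots> (g\<^sub>l - 1)\<close>, the
  coefficient of the identity is \<open>\<plusminus>1\<close> unless some nonempty ordered subproduct of the \<open>g\<^sub>i\<close> is the
  identity. Hence \<open>I\<^sup>m = 0\<close> forces \<open>D\<^sub>o(G) \<le> m\<close>, while enumerating an unordered sequence in any way
  shows \<open>d(G) + 1 \<le> D\<^sub>o(G)\<close>. If \<open>I\<close> is nilpotent, it is the Jacobson radical, being of
  codimension one and contained in every maximal left ideal; this gives
  \<open>d(G) + 1 \<le> D\<^sub>o(G) \<le> L(G)\<close>.

  All upper bounds on the nilpotency index come from one weight count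
  (\<open>ideal_power_right_factor\<close>). Suppose \<open>I\<close> is generated as a left ideal by \<open>x = a - 1\<close>,
  \<open>y = b - 1\<close>, \<open>z = c - 1\<close>, where \<open>a\<close> generates a normal subgroup, and let \<open>x\<close> have weight \<open>s\<close>.
  If \<open>b\<close> and \<open>c\<close> commute up to powers of \<open>a\<close>, products of elements of \<open>I\<close> can be sorted into monomials
  \<open>y\<^sup>i z\<^sup>j\<close> modulo terms \<open>w x\<close>, and long sorted monomials contain a power \<open>y\<^sup>p\<close> or \<open>z\<^sup>p\<close>, which is
  itself of the form \<open>w x\<close>.
  This yields \<open>I\<^sup>m \<subseteq> I\<^sup>m\<^sup>-\<^sup>s x\<close> for a small \<open>m\<close>, and then \<open>x\<^sup>q = 0\<close> makes \<open>I\<close> nilpotent.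

  If \<open>a\<close> generates a subgroup of order \<open>q = |G| / p\<close> and \<open>b\<close> lies outside it, the count with \<open>s = 1\<close>
  and without \<open>z\<close> gives \<open>I\<close> nilpotency index at most \<open>q + p - 1\<close>
  (\<open>augI_nilpotent_cyclic_index_p\<close>). The sequence consisting of \<open>q - 1\<close> copies of \<open>a\<close> and \<open>p - 1\<close>
  copies of \<open>b\<close> has no product-one subsequence (\<open>small_davenport_lower_bound\<close>), so the whole chain
  of inequalities collapses to \<open>q + p - 1\<close>.

  Conversely, if a noncyclic \<open>G\<close> has no cyclic subgroup of index \<open>p\<close>, then already
  \<open>d(G) + 1 \<le> |G| / p\<close> (\<open>davenport_no_cyclic_index_p\<close>). Let \<open>N\<close> be the intersection of two maximal
  subgroups, so that \<open>G / N\<close> is elementary abelian of order \<open>p\<^sup>2\<close>. If \<open>N\<close> is cyclic, generated by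
  \<open>a\<close>, then the quotient by the subgroup generated by \<open>a\<^sup>p\<close> has order \<open>p\<^sup>3\<close> and exponent \<open>p\<close>, and the
  weight count bounds its ordered Davenport constant by \<open>p\<^sup>2\<close>. If \<open>N\<close> is not cyclic, then \<open>N\<close> in turn
  has an elementary abelian quotient of order \<open>p\<^sup>2\<close>, and bounds for the two layers are multiplied.
\<close>

section \<open>Powers of an ideal\<close>

context ring
begin

abbreviation ideal_power :: "'a set \<Rightarrow> nat \<Rightarrow> 'a set" where
  "ideal_power I k \<equiv> I [^]\<^bsub>ideals_set R\<^esub> k"

lemma one_ideals_set [simp]: "\<one>\<^bsub>ideals_set R\<^esub> = carrier R"
  and mult_ideals_set [simp]: "I \<otimes>\<^bsub>ideals_set R\<^esub> J = I \<cdot> J"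
  by (simp_all add: ideals_set_def)

lemma ideal_power_Suc: "ideal_power I (Suc k) = ideal_power I k \<cdot> I"
  by simp

lemma ideal_power_ideal: "ideal I R \<Longrightarrow> ideal (ideal_power I k) R"
  by (induction k) (simp_all add: oneideal ideal_prod_is_ideal)

lemma ideal_power_closed: "ideal I R \<Longrightarrow> a \<in> ideal_power I k \<Longrightarrow> a \<in> carrier R"
  by (rule ideal.Icarr[OF ideal_power_ideal])

lemma one_ideal_prod: 
  assumes "ideal I R" shows "carrier R \<cdot> I = I"
proof
  show "carrier R \<cdot> I \<subseteq> I"
    using ideal_prod_inter[OF oneideal assms] by blast
  show "I \<subseteq> carrier R \<cdot> I"
    by (metis assms ideal.Icarr ideal_prod.prod l_one one_closed subsetI)
qed

lemma ideal_power_Suc2: "ideal I R \<Longrightarrow> ideal_power I (Suc k) = I \<cdot> ideal_power I k"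
proof (induction k)
  case 0
  then show ?case by (simp add: ideal_power_Suc one_ideal_prod ideal_prod_one)
next
  case (Suc k)
  then show ?case
    using ideal_prod_assoc[OF \<open>ideal I R\<close> ideal_power_ideal[OF \<open>ideal I R\<close>] \<open>ideal I R\<close>]
    by (metis ideal_power_Suc)
qed

lemma ideal_power_add:
  assumes "ideal I R"
  shows "ideal_power I (m + n) = ideal_power I m \<cdot> ideal_power I n"
proof (induction n)
  case 0
  then show ?case by (simp add: ideal_prod_one ideal_power_ideal assms)
next
  case (Suc n)
  then show ?case
    by (simp add: ideal_power_Suc ideal_prod_assoc ideal_power_ideal assms)
qed

lemma ideal_power_mult:
  assumes "ideal I R" "a \<in> ideal_power I m" "b \<in> ideal_power I n" "k \<le> m + n"
  shows "a \<otimes> b \<in> ideal_power I k"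
proof -
  have "a \<otimes> b \<in> ideal_power I (k + (m + n - k))"
    using assms by (simp add: ideal_power_add[OF assms(1)] ideal_prod.prod)
  then show ?thesis
    using ideal_prod_inter[OF ideal_power_ideal[OF assms(1)] ideal_power_ideal[OF assms(1)]]
    by (metis IntD1 assms(1) ideal_power_add subsetD)
qed

lemma ideal_power_antimono:
  assumes "ideal I R" "a \<in> ideal_power I n" "m \<le> n"
  shows "a \<in> ideal_power I m"
  using ideal_power_mult[OF assms(1), of \<one> 0 a n m] assms ideal_power_closed by simp

lemma ideal_power_nat_pow:
  assumes "ideal I R" "a \<in> I"
  shows "a [^] k \<in> ideal_power I k"
proof (induction k)
  case (Suc k)
  then show ?case using assms ideal_power_Suc ideal_prod.prod by (metis nat_pow_Suc)
qed simp

lemma ideal_power_1: "ideal I R \<Longrightarrow> ideal_power I 1 = I"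
  by (simp add: ideal_power_Suc one_ideal_prod)

lemma right_factor_ideal_power:
  assumes I: "ideal I R" and x: "x \<in> carrier R"
    and m: "\<And>w. w \<in> ideal_power I m \<Longrightarrow> \<exists>v\<in>ideal_power I n. w = v \<otimes> x"
    and w: "w \<in> ideal_power I (t + m)"
  shows "\<exists>v\<in>ideal_power I (t + n). w = v \<otimes> x"
  using w
proof (induction t arbitrary: w)
  case 0
  then show ?case using m by simp
next
  case (Suc t)
  then have "w \<in> I \<cdot> ideal_power I (t + m)"
    using ideal_power_Suc2[OF I] by simp
  then show ?case
  proof (induction rule: ideal_prod.induct)
    case (prod i j)
    then obtain v where v: "v \<in> ideal_power I (t + n)" "j = v \<otimes> x"
      using Suc.IH by blast
    have "i \<otimes> v \<in> ideal_power I (Suc t + n)"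
      using ideal_power_Suc2[OF I] prod v ideal_prod.prod by (metis add_Suc)
    moreover have "i \<otimes> j = (i \<otimes> v) \<otimes> x"
      using v prod x I ideal_power_closed ideal.Icarr by (metis m_assoc)
    ultimately show ?case by blast
  next
    case (sum a b)
    then obtain u v where "u \<in> ideal_power I (Suc t + n)" "v \<in> ideal_power I (Suc t + n)"
      "a = u \<otimes> x" "b = v \<otimes> x"
      by blast
    then show ?case
      using additive_subgroup.a_closed[OF ideal.axioms(1)[OF ideal_power_ideal[OF I]]]
        l_distr x ideal_power_closed[OF I] by metis
  qed
qed

text \<open>
  Iterating \<open>I\<^sup>m \<subseteq> I\<^sup>m\<^sup>-\<^sup>s x\<close>: every \<open>s\<close> further factors from \<open>I\<close> produce one further factor \<open>x\<close> on
  the right, until \<open>x\<^sup>q = 0\<close> is reached.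
\<close>

lemma ideal_power_eq_zero:
  assumes I: "ideal I R" and x: "x \<in> carrier R" and "s \<le> m"
    and m: "\<And>w. w \<in> ideal_power I m \<Longrightarrow> \<exists>v\<in>ideal_power I (m - s). w = v \<otimes> x"
    and q: "x [^] q = \<zero>" "q \<ge> 1"
  shows "ideal_power I (m + s * (q - 1)) = {\<zero>}"
proof -
  have *: "\<exists>v\<in>ideal_power I (m - s). w = v \<otimes> x [^] Suc k"
    if "w \<in> ideal_power I (m + s * k)" for k w
    using that
  proof (induction k arbitrary: w)
    case 0
    then show ?case using m x by simp
  next
    case (Suc k)
    have "w \<in> ideal_power I (s + (m + s * k))"
      using Suc.prems by (simp add: algebra_simps)
    from right_factor_ideal_power[OF I nat_pow_closed[OF x] Suc.IH this]
    obtain v where v: "v \<in> ideal_power I m" "w = v \<otimes> x [^] Suc k"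
      using \<open>s \<le> m\<close> by auto
    from m[OF v(1)] obtain u where u: "u \<in> ideal_power I (m - s)" "v = u \<otimes> x" by blast
    have "w = u \<otimes> x [^] Suc (Suc k)"
      unfolding v(2) u(2) nat_pow_Suc2[OF x, of "Suc k"]
      using ideal_power_closed[OF I u(1)] x nat_pow_closed m_assoc by blast
    then show ?case using u by blast
  qed
  have "w = \<zero>" if "w \<in> ideal_power I (m + s * (q - 1))" for w
    using *[OF that] q ideal_power_closed[OF I] by auto
  moreover have "\<zero> \<in> ideal_power I (m + s * (q - 1))"
    by (simp add: I additive_subgroup.zero_closed ideal.axioms(1) ideal_power_ideal)
  ultimately show ?thesis by blast
qed

end

text \<open>
  Sorted expressions of weight \<open>k\<close>: left combinations of monomials \<open>y\<^sup>i z\<^sup>j\<close> of degree \<open>k\<close>, plus a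
  term \<open>v x\<close>. As \<open>x\<close> carries weight \<open>s\<close>, the cofactor \<open>v\<close> has to lie in \<open>I\<^sup>k\<^sup>-\<^sup>s\<close>.
\<close>

inductive_set ordered_span :: "('a, 'm) ring_scheme \<Rightarrow> 'a set \<Rightarrow> nat \<Rightarrow> 'a \<Rightarrow> 'a \<Rightarrow> 'a \<Rightarrow> nat \<Rightarrow> 'a set"
  for R (structure) and I s x y z k where
    tail: "v \<in> I [^]\<^bsub>ideals_set R\<^esub> (k - s) \<Longrightarrow> v \<otimes> x \<in> ordered_span R I s x y z k"
  | monom: "c \<in> carrier R \<Longrightarrow> i + j = k \<Longrightarrow> c \<otimes> (y [^] i \<otimes> z [^] j) \<in> ordered_span R I s x y z k"
  | add: "a \<in> ordered_span R I s x y z k \<Longrightarrow> b \<in> ordered_span R I s x y z k \<Longrightarrow>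
      a \<oplus> b \<in> ordered_span R I s x y z k"

lemma (in ring) right_factor_pow:
  assumes I: "ideal I R" and x: "x \<in> carrier R"
    and xI: "\<And>i. i \<in> I \<Longrightarrow> \<exists>j\<in>I. x \<otimes> i = j \<otimes> x" and y: "y \<in> I"
  shows "\<exists>v\<in>ideal_power I n. x \<otimes> y [^] (n::nat) = v \<otimes> x"
proof (induction n)
  case 0
  then show ?case using x by (intro bexI[of _ \<one>]) simp_all
next
  case (Suc n)
  then obtain v where v: "v \<in> ideal_power I n" "x \<otimes> y [^] n = v \<otimes> x" by blast
  obtain j where j: "j \<in> I" "x \<otimes> y = j \<otimes> x" using xI y by blast
  have c: "v \<in> carrier R" "j \<in> carrier R" "y \<in> carrier R"
    using v j y I ideal_power_closed ideal.Icarr by metis+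
  have "x \<otimes> y [^] Suc n = (x \<otimes> y [^] n) \<otimes> y"
    using x c by (simp add: m_assoc)
  also have "\<dots> = v \<otimes> (x \<otimes> y)"
    unfolding v(2) using x c by (simp add: m_assoc)
  also have "\<dots> = (v \<otimes> j) \<otimes> x"
    unfolding j(2) using x c by (simp add: m_assoc)
  finally show ?case
    using v j ideal_power_Suc ideal_prod.prod by metis
qed

text \<open>
  The weight count. A product of \<open>k\<close> elements of \<open>I\<close> becomes a sorted expression of weight \<open>k\<close>: a
  factor \<open>x\<close> moves to the right end because it normalizes \<open>I\<close>, and exchanging \<open>z\<close> with \<open>y\<close> creates
  an error term in \<open>I\<^sup>2\<^sup>-\<^sup>s x\<close>, which again has weight 2. A monomial \<open>y\<^sup>i z\<^sup>j\<close> of degree \<open>d + e - 1\<close>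
  contains \<open>y\<^sup>d\<close> or \<open>z\<^sup>e\<close>, hence a factor \<open>x\<close>, which can be moved to the right end. Where a
  subtraction of exponents is truncated, the claimed membership is in \<open>I\<^sup>0\<close>, the whole ring.
\<close>

lemma (in ring) ideal_power_right_factor:
  assumes I: "ideal I R" and xyz: "x \<in> I" "y \<in> I" "z \<in> I" and s: "1 \<le> s" "s \<le> 2"
    and gen: "\<And>i. i \<in> I \<Longrightarrow> \<exists>a\<in>carrier R. \<exists>b\<in>carrier R. \<exists>c\<in>carrier R.
                i = a \<otimes> x \<oplus> b \<otimes> y \<oplus> c \<otimes> z"
    and xI: "\<And>i. i \<in> I \<Longrightarrow> \<exists>j\<in>I. x \<otimes> i = j \<otimes> x"
    and comm: "\<exists>u\<in>ideal_power I (2 - s). z \<otimes> y = y \<otimes> z \<oplus> u \<otimes> x"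
    and yd: "\<exists>v\<in>ideal_power I (d - s). y [^] (d::nat) = v \<otimes> x"
    and ze: "\<exists>v\<in>ideal_power I (e - s). z [^] (e::nat) = v \<otimes> x"
    and w: "w \<in> ideal_power I (d + e - 1)"
  shows "\<exists>v\<in>ideal_power I (d + e - 1 - s). w = v \<otimes> x"
proof -
  have x: "x \<in> carrier R" and y: "y \<in> carrier R" and z: "z \<in> carrier R"
    using I xyz ideal.Icarr by metis+
  note closed = ideal_power_closed[OF I]
  have xpow: "\<exists>v\<in>ideal_power I n. x \<otimes> t [^] n = v \<otimes> x" if "t \<in> I" for t and n :: nat
    using xI that by (intro right_factor_pow[OF I x]) blast+
  have zy: "\<exists>v\<in>ideal_power I (i + 1 - s). z \<otimes> y [^] i = y [^] i \<otimes> z \<oplus> v \<otimes> x" for i :: nat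
  proof (induction i)
    case 0
    show ?case
      using z x I by (intro bexI[of _ "\<zero>"])
        (simp_all add: additive_subgroup.zero_closed ideal.axioms(1) ideal_power_ideal)
  next
    case (Suc i)
    then obtain v where v: "v \<in> ideal_power I (i + 1 - s)"
      "z \<otimes> y [^] i = y [^] i \<otimes> z \<oplus> v \<otimes> x" by blast
    obtain u where u: "u \<in> ideal_power I (2 - s)" "z \<otimes> y = y \<otimes> z \<oplus> u \<otimes> x"
      using comm by blast
    obtain t where t: "t \<in> ideal_power I i" "x \<otimes> y [^] i = t \<otimes> x"
      using xpow[OF xyz(2)] by blast
    have c: "u \<in> carrier R" "v \<in> carrier R" "t \<in> carrier R"
      using u v t closed by auto
    have "z \<otimes> y [^] Suc i = (z \<otimes> y) \<otimes> y [^] i"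
      unfolding nat_pow_Suc2[OF y] using y z by (simp add: m_assoc)
    also have "\<dots> = y \<otimes> (z \<otimes> y [^] i) \<oplus> u \<otimes> (x \<otimes> y [^] i)"
      unfolding u(2) using x y z c by (simp add: l_distr m_assoc)
    also have "\<dots> = y \<otimes> y [^] i \<otimes> z \<oplus> (y \<otimes> v \<oplus> u \<otimes> t) \<otimes> x"
      unfolding v(2) t(2) using x y z c by (simp add: l_distr r_distr m_assoc a_assoc)
    also have "y \<otimes> y [^] i = y [^] Suc i"
      by (simp only: nat_pow_Suc2[OF y])
    finally have "z \<otimes> y [^] Suc i = y [^] Suc i \<otimes> z \<oplus> (y \<otimes> v \<oplus> u \<otimes> t) \<otimes> x" .
    moreover have "y \<otimes> v \<in> ideal_power I (Suc i + 1 - s)"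
      using s v xyz(2) ideal_power_1[OF I] by (intro ideal_power_mult[OF I, of y 1 v "i + 1 - s"]) auto
    moreover have "u \<otimes> t \<in> ideal_power I (Suc i + 1 - s)"
      using s u t by (intro ideal_power_mult[OF I, of u "2 - s" t i]) auto
    ultimately show ?case
      using additive_subgroup.a_closed[OF ideal.axioms(1)[OF ideal_power_ideal[OF I]]] by blast
  qed
  let ?N = "ordered_span R I s x y z"
  have N_closed: "w \<in> carrier R" if "w \<in> ?N k" for w k
    using that by induction (use closed x y z in auto)
  have step: "i \<otimes> w \<in> ?N (Suc k)" if i: "i \<in> I" and w: "w \<in> ?N k" for i w k
    using w
  proof induction
    case (tail v)
    have "i \<otimes> v \<in> ideal_power I (Suc k - s)"
      using i ideal_power_1[OF I] tail by (intro ideal_power_mult[OF I, of i 1 v "k - s"]) auto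
    then have "(i \<otimes> v) \<otimes> x \<in> ?N (Suc k)" by (rule ordered_span.tail)
    then show ?case using closed[OF tail] x ideal.Icarr[OF I i] by (simp add: m_assoc)
  next
    case (monom r l j)
    have "i \<otimes> r \<in> I" using i monom I by (simp add: ideal.I_r_closed)
    then obtain a b c where abc: "a \<in> carrier R" "b \<in> carrier R" "c \<in> carrier R"
      "i \<otimes> r = a \<otimes> x \<oplus> b \<otimes> y \<oplus> c \<otimes> z"
      using gen by blast
    obtain u where u: "u \<in> ideal_power I l" "x \<otimes> y [^] l = u \<otimes> x" using xpow[OF xyz(2)] by blast
    obtain v where v: "v \<in> ideal_power I j" "x \<otimes> z [^] j = v \<otimes> x" using xpow[OF xyz(3)] by blast
    obtain t where t: "t \<in> ideal_power I (l + 1 - s)" "z \<otimes> y [^] l = y [^] l \<otimes> z \<oplus> t \<otimes> x"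
      using zy by blast
    have cl: "u \<in> carrier R" "v \<in> carrier R" "t \<in> carrier R" "i \<in> carrier R"
      using u v t i closed ideal.Icarr[OF I] by auto
    have "i \<otimes> (r \<otimes> (y [^] l \<otimes> z [^] j)) = (i \<otimes> r) \<otimes> (y [^] l \<otimes> z [^] j)"
      using cl monom y z by (simp add: m_assoc)
    also have "\<dots> = a \<otimes> (x \<otimes> y [^] l) \<otimes> z [^] j \<oplus> b \<otimes> (y \<otimes> y [^] l \<otimes> z [^] j)
        \<oplus> c \<otimes> (z \<otimes> y [^] l) \<otimes> z [^] j"
      unfolding abc(4) using abc x y z by (simp add: l_distr m_assoc)
    also have "a \<otimes> (x \<otimes> y [^] l) \<otimes> z [^] j = a \<otimes> u \<otimes> (x \<otimes> z [^] j)"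
      unfolding u(2) using abc x y z cl by (simp add: m_assoc)
    also have "\<dots> = (a \<otimes> (u \<otimes> v)) \<otimes> x"
      unfolding v(2) using abc x y z cl by (simp add: m_assoc)
    also have "c \<otimes> (z \<otimes> y [^] l) \<otimes> z [^] j
        = c \<otimes> (y [^] l \<otimes> (z \<otimes> z [^] j)) \<oplus> c \<otimes> (t \<otimes> (x \<otimes> z [^] j))"
      unfolding t(2) using abc x y z cl by (simp add: l_distr r_distr m_assoc)
    also have "c \<otimes> (t \<otimes> (x \<otimes> z [^] j)) = (c \<otimes> (t \<otimes> v)) \<otimes> x"
      unfolding v(2) using abc x y z cl by (simp add: m_assoc)
    also have "y \<otimes> y [^] l = y [^] Suc l" by (simp only: nat_pow_Suc2[OF y])
    also have "z \<otimes> z [^] j = z [^] Suc j" by (simp only: nat_pow_Suc2[OF z])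
    finally have eq: "i \<otimes> (r \<otimes> (y [^] l \<otimes> z [^] j))
        = (a \<otimes> (u \<otimes> v)) \<otimes> x \<oplus> b \<otimes> (y [^] Suc l \<otimes> z [^] j)
          \<oplus> (c \<otimes> (y [^] l \<otimes> z [^] Suc j) \<oplus> (c \<otimes> (t \<otimes> v)) \<otimes> x)" .
    have "u \<otimes> v \<in> ideal_power I (Suc k - s)"
      using s monom by (intro ideal_power_mult[OF I u(1) v(1)]) auto
    then have 1: "(a \<otimes> (u \<otimes> v)) \<otimes> x \<in> ?N (Suc k)"
      using abc ideal.I_l_closed[OF ideal_power_ideal[OF I]] by (intro ordered_span.tail)
    have "t \<otimes> v \<in> ideal_power I (Suc k - s)"
      using s monom by (intro ideal_power_mult[OF I t(1) v(1)]) auto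
    then have 2: "(c \<otimes> (t \<otimes> v)) \<otimes> x \<in> ?N (Suc k)"
      using abc ideal.I_l_closed[OF ideal_power_ideal[OF I]] by (intro ordered_span.tail)
    show ?case
      unfolding eq using abc monom by (intro ordered_span.add 1 2 ordered_span.monom) auto
  next
    case (add a b)
    then show ?case
      using ordered_span.add r_distr N_closed ideal.Icarr[OF I i] by metis
  qed
  have span: "w \<in> ?N k" if "w \<in> ideal_power I k" for w k
    using that
  proof (induction k arbitrary: w)
    case 0
    then show ?case
      using ordered_span.monom[of w R 0 0 0 y z I s x] by simp
  next
    case (Suc k)
    then have "w \<in> I \<cdot> ideal_power I k" using ideal_power_Suc2[OF I] by simp
    then show ?case
      by (induction rule: ideal_prod.induct) (use step Suc.IH in blast, simp add: ordered_span.add)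
  qed
  have "w \<in> ?N (d + e - 1)" using span w .
  then show ?thesis
  proof induction
    case (tail v)
    then show ?case by blast
  next
    case (monom c i j)
    consider "d \<le> i" | "e \<le> j" using monom by linarith
    then show ?case
    proof cases
      case 1
      obtain v where v: "v \<in> ideal_power I (d - s)" "y [^] d = v \<otimes> x" using yd by blast
      obtain u where u: "u \<in> ideal_power I j" "x \<otimes> z [^] j = u \<otimes> x" using xpow[OF xyz(3)] by blast
      have cl: "u \<in> carrier R" "v \<in> carrier R" using u v closed by auto
      have "y [^] i = y [^] (i - d) \<otimes> y [^] d" using 1 y by (simp add: nat_pow_mult)
      then have "c \<otimes> (y [^] i \<otimes> z [^] j) = c \<otimes> (y [^] (i - d) \<otimes> v \<otimes> (x \<otimes> z [^] j))"
        using cl monom x y z by (simp add: v(2) m_assoc)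
      also have "\<dots> = (c \<otimes> (y [^] (i - d) \<otimes> (v \<otimes> u))) \<otimes> x"
        unfolding u(2) using cl monom x y z by (simp add: m_assoc)
      finally have eq: "c \<otimes> (y [^] i \<otimes> z [^] j) = (c \<otimes> (y [^] (i - d) \<otimes> (v \<otimes> u))) \<otimes> x" .
      have "y [^] (i - d) \<otimes> (v \<otimes> u) \<in> ideal_power I (d + e - 1 - s)"
        using monom 1 by (intro ideal_power_mult[OF I ideal_power_nat_pow[OF I xyz(2)]
          ideal_power_mult[OF I v(1) u(1) order_refl]]) auto
      then show ?thesis
        using eq monom ideal.I_l_closed[OF ideal_power_ideal[OF I]] by blast
    next
      case 2
      obtain v where v: "v \<in> ideal_power I (e - s)" "z [^] e = v \<otimes> x" using ze by blast
      have cl: "v \<in> carrier R" using v closed by auto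
      have "z [^] j = z [^] (j - e) \<otimes> z [^] e" using 2 z by (simp add: nat_pow_mult)
      then have eq: "c \<otimes> (y [^] i \<otimes> z [^] j) = (c \<otimes> (y [^] i \<otimes> (z [^] (j - e) \<otimes> v))) \<otimes> x"
        using cl monom x y z by (simp add: v(2) m_assoc)
      have "y [^] i \<otimes> (z [^] (j - e) \<otimes> v) \<in> ideal_power I (d + e - 1 - s)"
        using monom 2 by (intro ideal_power_mult[OF I ideal_power_nat_pow[OF I xyz(2)]
          ideal_power_mult[OF I ideal_power_nat_pow[OF I xyz(3)] v(1) order_refl]]) auto
      then show ?thesis
        using eq monom ideal.I_l_closed[OF ideal_power_ideal[OF I]] by blast
    qed
  next
    case (add a b)
    then obtain u v where "u \<in> ideal_power I (d + e - 1 - s)" "v \<in> ideal_power I (d + e - 1 - s)"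
      "a = u \<otimes> x" "b = v \<otimes> x" by blast
    then show ?case
      using additive_subgroup.a_closed[OF ideal.axioms(1)[OF ideal_power_ideal[OF I]]]
        l_distr x closed by metis
  qed
qed

section \<open>The group algebra of a finite group over a prime field\<close>

locale modular_group_algebra = group +
  fixes p :: nat
  assumes prime_p: "prime p"
    and finite_G: "finite (carrier G)"
begin

abbreviation A where "A \<equiv> group_algebra (residue_ring (int p)) G"

sublocale res: residues "int p" "residue_ring (int p)"
  using prime_p prime_gt_1_nat by unfold_locales auto

lemma p_gt_1: "p > 1"
  using prime_p prime_gt_1_nat by blast

definition convolve :: "('a \<Rightarrow> int) \<Rightarrow> ('a \<Rightarrow> int) \<Rightarrow> 'a \<Rightarrow> int" where
  "convolve a b g = (\<Sum>h\<in>carrier G. a h * b (inv h \<otimes> g))"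

text \<open>
  Elements of the group algebra are treated as integer-valued functions whose values are reduced
  only at the end, so that the ring laws become identities between integer sums.
\<close>

definition mod_p :: "('a \<Rightarrow> int) \<Rightarrow> 'a \<Rightarrow> int" where
  "mod_p f = (\<lambda>g\<in>carrier G. f g mod int p)"

lemma carrier_A: "carrier A = carrier G \<rightarrow>\<^sub>E {0..int p - 1}"
  by (simp add: group_algebra_def residue_ring_def)

lemma mult_A: "x \<otimes>\<^bsub>A\<^esub> y = mod_p (convolve x y)"
proof -
  have "(\<Oplus>\<^bsub>residue_ring (int p)\<^esub>h\<in>carrier G. x h \<otimes>\<^bsub>residue_ring (int p)\<^esub> y (inv h \<otimes> g))
      = convolve x y g mod int p" for g
    unfolding convolve_def using res.sum_cong[OF finite_G] by (simp add: res.res_mult_eq)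
  then show ?thesis
    by (simp add: group_algebra_def mod_p_def)
qed

lemma one_A: "\<one>\<^bsub>A\<^esub> = mod_p (\<lambda>g. of_bool (g = \<one>))"
  using p_gt_1 by (auto simp: group_algebra_def residue_ring_def mod_p_def)

lemma zero_A: "\<zero>\<^bsub>A\<^esub> = mod_p (\<lambda>_. 0)"
  by (auto simp: group_algebra_def residue_ring_def mod_p_def)

lemma add_A: "x \<oplus>\<^bsub>A\<^esub> y = mod_p (\<lambda>g. x g + y g)"
  by (auto simp: group_algebra_def residue_ring_def mod_p_def)

lemma mod_p_closed [simp]: "mod_p f \<in> carrier A"
  using p_gt_1 by (auto simp: carrier_A mod_p_def)

lemma mod_p_apply: "g \<in> carrier G \<Longrightarrow> mod_p f g = f g mod int p"
  by (simp add: mod_p_def)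

lemma mod_p_id [simp]: "x \<in> carrier A \<Longrightarrow> mod_p x = x"
  using p_gt_1 by (intro ext) (auto simp: carrier_A mod_p_def PiE_iff restrict_def extensional_def)

lemma mod_p_cong: "(\<And>g. g \<in> carrier G \<Longrightarrow> f g mod int p = f' g mod int p) \<Longrightarrow> mod_p f = mod_p f'"
  by (auto simp: mod_p_def)

lemma convolve_mod_p: "mod_p (convolve (mod_p x) (mod_p y)) = mod_p (convolve x y)"
proof (rule mod_p_cong)
  fix g assume g: "g \<in> carrier G"
  have "(\<Sum>h\<in>carrier G. mod_p x h * mod_p y (inv h \<otimes> g)) mod int p
      = (\<Sum>h\<in>carrier G. (mod_p x h * mod_p y (inv h \<otimes> g)) mod int p) mod int p"
    by (simp add: mod_sum_eq)
  also have "\<dots> = (\<Sum>h\<in>carrier G. (x h * y (inv h \<otimes> g)) mod int p) mod int p"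
    using g by (simp add: mod_p_apply mod_mult_eq cong: sum.cong)
  also have "\<dots> = (\<Sum>h\<in>carrier G. x h * y (inv h \<otimes> g)) mod int p"
    by (simp add: mod_sum_eq)
  finally show "convolve (mod_p x) (mod_p y) g mod int p = convolve x y g mod int p"
    by (simp add: convolve_def)
qed

lemma mult_mod_p: "mod_p x \<otimes>\<^bsub>A\<^esub> mod_p y = mod_p (convolve x y)"
  by (simp add: mult_A convolve_mod_p)

lemma add_mod_p: "mod_p x \<oplus>\<^bsub>A\<^esub> mod_p y = mod_p (\<lambda>g. x g + y g)"
  unfolding add_A by (rule mod_p_cong) (simp add: mod_p_apply mod_add_eq)

lemma sum_translate:
  assumes "k \<in> carrier G"
  shows "(\<Sum>h\<in>carrier G. f (k \<otimes> h)) = (\<Sum>h\<in>carrier G. f h)"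
  by (rule sum.reindex_bij_witness[where i = "\<lambda>h. inv k \<otimes> h" and j = "\<lambda>h. k \<otimes> h"])
     (use assms in \<open>auto simp: m_assoc [symmetric]\<close>)

lemma convolve_assoc:
  assumes "g \<in> carrier G"
  shows "convolve (convolve x y) z g = convolve x (convolve y z) g"
proof -
  have "convolve (convolve x y) z g
      = (\<Sum>k\<in>carrier G. x k * (\<Sum>h\<in>carrier G. y (inv k \<otimes> h) * z (inv h \<otimes> g)))"
    unfolding convolve_def sum_distrib_right sum_distrib_left
    by (subst sum.swap) (simp add: mult.assoc)
  also have "\<dots> = (\<Sum>k\<in>carrier G. x k * (\<Sum>h\<in>carrier G. y h * z (inv h \<otimes> (inv k \<otimes> g))))"
  proof (rule sum.cong[OF refl])
    fix k assume k: "k \<in> carrier G"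
    have "(\<Sum>h\<in>carrier G. y (inv k \<otimes> h) * z (inv h \<otimes> g))
        = (\<Sum>h\<in>carrier G. y h * z (inv h \<otimes> (inv k \<otimes> g)))"
      using sum_translate[of k "\<lambda>h. y (inv k \<otimes> h) * z (inv h \<otimes> g)"] k assms
      by (simp add: m_assoc[symmetric] inv_mult_group cong: sum.cong)
    then show "x k * (\<Sum>h\<in>carrier G. y (inv k \<otimes> h) * z (inv h \<otimes> g))
        = x k * (\<Sum>h\<in>carrier G. y h * z (inv h \<otimes> (inv k \<otimes> g)))"
      by simp
  qed
  finally show ?thesis
    by (simp add: convolve_def)
qed

lemma convolve_delta_left:
  assumes "k \<in> carrier G" "g \<in> carrier G"
  shows "convolve (\<lambda>g. of_bool (g = k)) x g = x (inv k \<otimes> g)"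
proof -
  have "convolve (\<lambda>g. of_bool (g = k)) x g = (\<Sum>h\<in>carrier G. if h = k then x (inv k \<otimes> g) else 0)"
    unfolding convolve_def by (rule sum.cong) auto
  then show ?thesis using assms finite_G by simp
qed

lemma convolve_delta_right:
  assumes "k \<in> carrier G" "g \<in> carrier G"
  shows "convolve x (\<lambda>g. of_bool (g = k)) g = x (g \<otimes> inv k)"
proof -
  have "inv h \<otimes> g = k \<longleftrightarrow> h = g \<otimes> inv k" if "h \<in> carrier G" for h
    using that assms by (metis inv_closed inv_solve_left inv_solve_right)
  then have "convolve x (\<lambda>g. of_bool (g = k)) g
      = (\<Sum>h\<in>carrier G. if h = g \<otimes> inv k then x (g \<otimes> inv k) else 0)"
    unfolding convolve_def using assms by (intro sum.cong) auto
  then show ?thesis using assms finite_G by simp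
qed

lemma ring_A: "ring A"
proof (rule ringI)
  show "abelian_group A"
  proof (rule abelian_groupI)
    fix x y z assume *: "x \<in> carrier A" "y \<in> carrier A" "z \<in> carrier A"
    show "x \<oplus>\<^bsub>A\<^esub> y \<oplus>\<^bsub>A\<^esub> z = x \<oplus>\<^bsub>A\<^esub> (y \<oplus>\<^bsub>A\<^esub> z)"
      using * by (metis (no_types, lifting) mod_p_id add_mod_p add.assoc mod_p_cong)
    show "x \<oplus>\<^bsub>A\<^esub> y = y \<oplus>\<^bsub>A\<^esub> x"
      by (simp add: add_A add.commute)
    show "\<zero>\<^bsub>A\<^esub> \<oplus>\<^bsub>A\<^esub> x = x"
      using * by (metis (no_types, lifting) mod_p_id add_mod_p zero_A add_0 mod_p_cong)
    have "mod_p (\<lambda>g. - x g) \<oplus>\<^bsub>A\<^esub> mod_p x = \<zero>\<^bsub>A\<^esub>"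
      unfolding add_mod_p zero_A by (rule mod_p_cong) simp
    then show "\<exists>y\<in>carrier A. y \<oplus>\<^bsub>A\<^esub> x = \<zero>\<^bsub>A\<^esub>"
      using * by (auto intro!: bexI[of _ "mod_p (\<lambda>g. - x g)"])
  qed (simp_all add: add_A zero_A)
  show "monoid A"
  proof (rule monoidI)
    fix x y z assume *: "x \<in> carrier A" "y \<in> carrier A" "z \<in> carrier A"
    have "mod_p x \<otimes>\<^bsub>A\<^esub> mod_p y \<otimes>\<^bsub>A\<^esub> mod_p z = mod_p x \<otimes>\<^bsub>A\<^esub> (mod_p y \<otimes>\<^bsub>A\<^esub> mod_p z)"
      unfolding mult_mod_p by (rule mod_p_cong) (simp add: convolve_assoc)
    then show "x \<otimes>\<^bsub>A\<^esub> y \<otimes>\<^bsub>A\<^esub> z = x \<otimes>\<^bsub>A\<^esub> (y \<otimes>\<^bsub>A\<^esub> z)"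
      using * by simp
    have "\<one>\<^bsub>A\<^esub> \<otimes>\<^bsub>A\<^esub> mod_p x = mod_p x"
      unfolding one_A mult_mod_p by (rule mod_p_cong) (simp add: convolve_delta_left)
    then show "\<one>\<^bsub>A\<^esub> \<otimes>\<^bsub>A\<^esub> x = x" using * by simp
    have "mod_p x \<otimes>\<^bsub>A\<^esub> \<one>\<^bsub>A\<^esub> = mod_p x"
      unfolding one_A mult_mod_p by (rule mod_p_cong) (simp add: convolve_delta_right)
    then show "x \<otimes>\<^bsub>A\<^esub> \<one>\<^bsub>A\<^esub> = x" using * by simp
  qed (simp_all add: mult_A one_A)
  fix x y z assume *: "x \<in> carrier A" "y \<in> carrier A" "z \<in> carrier A"
  have "(mod_p x \<oplus>\<^bsub>A\<^esub> mod_p y) \<otimes>\<^bsub>A\<^esub> mod_p z = mod_p x \<otimes>\<^bsub>A\<^esub> mod_p z \<oplus>\<^bsub>A\<^esub> mod_p y \<otimes>\<^bsub>A\<^esub> mod_p z"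
    unfolding mult_mod_p add_mod_p
    by (rule mod_p_cong) (simp add: convolve_def algebra_simps sum.distrib)
  then show "(x \<oplus>\<^bsub>A\<^esub> y) \<otimes>\<^bsub>A\<^esub> z = x \<otimes>\<^bsub>A\<^esub> z \<oplus>\<^bsub>A\<^esub> y \<otimes>\<^bsub>A\<^esub> z"
    using * by simp
  have "mod_p z \<otimes>\<^bsub>A\<^esub> (mod_p x \<oplus>\<^bsub>A\<^esub> mod_p y) = mod_p z \<otimes>\<^bsub>A\<^esub> mod_p x \<oplus>\<^bsub>A\<^esub> mod_p z \<otimes>\<^bsub>A\<^esub> mod_p y"
    unfolding mult_mod_p add_mod_p
    by (rule mod_p_cong) (simp add: convolve_def algebra_simps sum.distrib)
  then show "z \<otimes>\<^bsub>A\<^esub> (x \<oplus>\<^bsub>A\<^esub> y) = z \<otimes>\<^bsub>A\<^esub> x \<oplus>\<^bsub>A\<^esub> z \<otimes>\<^bsub>A\<^esub> y"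
    using * by simp
qed

sublocale A: ring A
  by (rule ring_A)

definition \<delta> :: "'a \<Rightarrow> 'a \<Rightarrow> int" where
  "\<delta> k = mod_p (\<lambda>g. of_bool (g = k))"

lemma delta_closed [simp]: "\<delta> k \<in> carrier A"
  by (simp add: \<delta>_def)

lemma convolve_delta_mod_p:
  assumes "k \<in> carrier G" "g \<in> carrier G"
  shows "convolve (\<delta> k) x g mod int p = x (inv k \<otimes> g) mod int p"
proof -
  have "convolve (\<delta> k) x g = (\<Sum>h\<in>carrier G. if h = k then x (inv k \<otimes> g) else 0)"
    unfolding convolve_def using p_gt_1 by (intro sum.cong) (auto simp: \<delta>_def mod_p_apply)
  then show ?thesis using assms finite_G by simp
qed

lemma delta_one: "\<delta> \<one> = \<one>\<^bsub>A\<^esub>"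
  by (simp add: \<delta>_def one_A)

lemma delta_mult_left: "k \<in> carrier G \<Longrightarrow> x \<in> carrier A \<Longrightarrow> \<delta> k \<otimes>\<^bsub>A\<^esub> x = mod_p (\<lambda>g. x (inv k \<otimes> g))"
  unfolding mult_A by (rule mod_p_cong) (simp add: convolve_delta_mod_p)

lemma delta_mult: 
  assumes "h \<in> carrier G" "k \<in> carrier G"
  shows "\<delta> h \<otimes>\<^bsub>A\<^esub> \<delta> k = \<delta> (h \<otimes> k)"
proof -
  have *: "inv h \<otimes> g = k \<longleftrightarrow> g = h \<otimes> k" if "g \<in> carrier G" for g
    using inv_solve_left[of k h g] that assms by auto
  have "convolve (\<lambda>g. of_bool (g = h)) (\<lambda>g. of_bool (g = k)) g = of_bool (g = h \<otimes> k)"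
    if "g \<in> carrier G" for g
    unfolding convolve_delta_left[OF assms(1) that] by (simp add: * that)
  then show ?thesis
    unfolding \<delta>_def mult_mod_p by (intro mod_p_cong) simp
qed

text \<open>
  The prime field is additively generated by 1, so the group elements generate the group algebra as
  an additive monoid. The induction is on the sum of the coefficients, taken as integers in
  \<open>{0..p - 1}\<close>.
\<close>

lemma A_induct [consumes 1, case_names zero delta add]:
  assumes "x \<in> carrier A"
    and zero: "P \<zero>\<^bsub>A\<^esub>"
    and delta: "\<And>g. g \<in> carrier G \<Longrightarrow> P (\<delta> g)"
    and add: "\<And>x y. x \<in> carrier A \<Longrightarrow> y \<in> carrier A \<Longrightarrow> P x \<Longrightarrow> P y \<Longrightarrow> P (x \<oplus>\<^bsub>A\<^esub> y)"
  shows "P x"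
  using assms(1)
proof (induction "nat (\<Sum>g\<in>carrier G. x g)" arbitrary: x rule: less_induct)
  case less
  have x: "x \<in> carrier G \<rightarrow>\<^sub>E {0..int p - 1}"
    using less.prems by (simp add: carrier_A)
  show ?case
  proof (cases "\<forall>g\<in>carrier G. x g = 0")
    case True
    then have "mod_p x = \<zero>\<^bsub>A\<^esub>"
      unfolding zero_A by (intro mod_p_cong) auto
    then show ?thesis using zero less.prems by simp
  next
    case False
    then obtain g where g: "g \<in> carrier G" "x g \<noteq> 0" by blast
    then have xg: "x g > 0" using x by (auto dest!: PiE_mem[of x _ _ g])
    define y where "y = x(g := x g - 1)"
    have y: "y \<in> carrier A"
      using x g xg unfolding carrier_A y_def by (auto simp: PiE_iff extensional_def)
    have "(\<Sum>h\<in>carrier G. y h) = (\<Sum>h\<in>carrier G. x h) - 1"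
      using g finite_G by (simp add: y_def sum.remove[of _ g])
    moreover have "(\<Sum>h\<in>carrier G. y h) \<ge> 0"
      using y by (intro sum_nonneg) (auto simp: carrier_A)
    ultimately have "P y"
      by (intro less.hyps y) auto
    moreover have "x = y \<oplus>\<^bsub>A\<^esub> \<delta> g"
    proof -
      have "mod_p x = mod_p y \<oplus>\<^bsub>A\<^esub> \<delta> g"
        unfolding \<delta>_def add_mod_p by (rule mod_p_cong) (simp add: y_def)
      then show ?thesis using y less.prems by simp
    qed
    ultimately show ?thesis using add[OF y delta_closed] delta g by simp
  qed
qed

definition augmentation :: "('a \<Rightarrow> int) \<Rightarrow> int" where
  "augmentation x = (\<Sum>g\<in>carrier G. x g) mod int p"

lemma aug_mod_p: "augmentation (mod_p f) = (\<Sum>g\<in>carrier G. f g) mod int p"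
  unfolding augmentation_def by (subst (1 2) mod_sum_eq[symmetric]) (simp add: mod_p_apply)

lemma aug_zero [simp]: "augmentation \<zero>\<^bsub>A\<^esub> = 0"
  by (simp add: zero_A aug_mod_p)

lemma aug_delta [simp]: "g \<in> carrier G \<Longrightarrow> augmentation (\<delta> g) = 1"
  unfolding \<delta>_def aug_mod_p using finite_G p_gt_1 by (simp add: of_bool_def)

lemma aug_one [simp]: "augmentation \<one>\<^bsub>A\<^esub> = 1"
  using aug_delta[of \<one>] by (simp add: delta_one)

lemma aug_add: "augmentation (x \<oplus>\<^bsub>A\<^esub> y) = (augmentation x + augmentation y) mod int p"
  unfolding add_A aug_mod_p by (simp add: augmentation_def sum.distrib mod_add_eq)

lemma aug_mult: "augmentation (x \<otimes>\<^bsub>A\<^esub> y) = (augmentation x * augmentation y) mod int p"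
proof -
  have "(\<Sum>g\<in>carrier G. convolve x y g) = (\<Sum>h\<in>carrier G. x h * (\<Sum>g\<in>carrier G. y (inv h \<otimes> g)))"
    unfolding convolve_def by (subst sum.swap) (simp add: sum_distrib_left)
  also have "\<dots> = (\<Sum>h\<in>carrier G. x h) * (\<Sum>g\<in>carrier G. y g)"
    by (simp add: sum_translate sum_distrib_right)
  finally show ?thesis
    unfolding mult_A aug_mod_p by (simp add: augmentation_def mod_mult_eq)
qed

lemma aug_range: "0 \<le> augmentation x" "augmentation x < int p"
  using p_gt_1 by (simp_all add: augmentation_def)

lemma aug_minus: 
  assumes "x \<in> carrier A" "y \<in> carrier A"
  shows "augmentation (x \<ominus>\<^bsub>A\<^esub> y) = (augmentation x - augmentation y) mod int p"
proof -
  have "x = (x \<ominus>\<^bsub>A\<^esub> y) \<oplus>\<^bsub>A\<^esub> y"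
    using assms by (simp add: A.minus_eq A.a_assoc A.l_neg)
  then have "augmentation x = (augmentation (x \<ominus>\<^bsub>A\<^esub> y) + augmentation y) mod int p"
    by (metis aug_add)
  then show ?thesis
    using aug_range[of "x \<ominus>\<^bsub>A\<^esub> y"] by (simp add: mod_diff_left_eq)
qed

definition augmentation_ideal :: "('a \<Rightarrow> int) set" where
  "augmentation_ideal = {x \<in> carrier A. augmentation x = 0}"

lemma augI_iff: "x \<in> augmentation_ideal \<longleftrightarrow> x \<in> carrier A \<and> augmentation x = 0"
  by (simp add: augmentation_ideal_def)

lemma augI_ideal: "ideal augmentation_ideal A"
proof (rule idealI[OF ring_A])
  show "subgroup augmentation_ideal (add_monoid A)"
  proof (rule group.subgroupI[OF A.a_group])
    show "augmentation_ideal \<subseteq> carrier (add_monoid A)" by (auto simp: augmentation_ideal_def)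
    show "augmentation_ideal \<noteq> {}" using aug_zero A.zero_closed unfolding augmentation_ideal_def by blast
    fix x y assume x: "x \<in> augmentation_ideal" and y: "y \<in> augmentation_ideal"
    then show "x \<otimes>\<^bsub>add_monoid A\<^esub> y \<in> augmentation_ideal"
      by (simp add: augI_iff aug_add)
    have "augmentation (\<zero>\<^bsub>A\<^esub> \<ominus>\<^bsub>A\<^esub> x) = 0"
      using x by (subst aug_minus) (auto simp: augI_iff)
    then have "augmentation (\<ominus>\<^bsub>A\<^esub> x) = 0"
      using x by (simp add: augI_iff A.minus_eq)
    then show "inv\<^bsub>add_monoid A\<^esub> x \<in> augmentation_ideal"
      using x A.a_inv_closed[of x] unfolding a_inv_def augI_iff by blast
  qed
qed (simp_all add: augI_iff aug_mult)

lemma delta_minus_one_augI: "g \<in> carrier G \<Longrightarrow> \<delta> g \<ominus>\<^bsub>A\<^esub> \<one>\<^bsub>A\<^esub> \<in> augmentation_ideal"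
  using p_gt_1 by (simp add: augI_iff aug_minus)

text \<open>
  The augmentation ideal is additively generated by the elements \<open>g - 1\<close>: every \<open>x\<close> is a sum of
  such elements plus its augmentation, regarded as a multiple of the identity.
\<close>

lemma augI_induct [consumes 1, case_names zero gen add]:
  assumes "x \<in> augmentation_ideal"
    and zero: "P \<zero>\<^bsub>A\<^esub>"
    and gen: "\<And>g. g \<in> carrier G \<Longrightarrow> P (\<delta> g \<ominus>\<^bsub>A\<^esub> \<one>\<^bsub>A\<^esub>)"
    and add: "\<And>x y. x \<in> augmentation_ideal \<Longrightarrow> y \<in> augmentation_ideal \<Longrightarrow> P x \<Longrightarrow> P y \<Longrightarrow> P (x \<oplus>\<^bsub>A\<^esub> y)"
  shows "P x"
proof -
  interpret augmentation_ideal: ideal augmentation_ideal A by (rule augI_ideal)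
  \<comment> \<open>\<open>e c\<close> is the scalar \<open>c\<close> in the group algebra.\<close>
  define e where "e c = mod_p (\<lambda>g. c * of_bool (g = \<one>))" for c :: int
  have e_add: "e c \<oplus>\<^bsub>A\<^esub> e d = e ((c + d) mod int p)" for c d
    unfolding e_def add_mod_p by (rule mod_p_cong) simp
  have e_0: "e 0 = \<zero>\<^bsub>A\<^esub>" and e_1: "e 1 = \<one>\<^bsub>A\<^esub>"
    by (simp_all add: e_def zero_A one_A)
  have e_closed: "e c \<in> carrier A" for c
    by (simp add: e_def)
  have *: "\<exists>i\<in>augmentation_ideal. P i \<and> x = i \<oplus>\<^bsub>A\<^esub> e (augmentation x)" if "x \<in> carrier A" for x
    using that
  proof (induction rule: A_induct)
    case zero
    show ?case using assms(2) by (intro bexI[of _ "\<zero>\<^bsub>A\<^esub>"]) (simp_all add: e_0)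
  next
    case (delta g)
    have "\<delta> g = \<delta> g \<ominus>\<^bsub>A\<^esub> \<one>\<^bsub>A\<^esub> \<oplus>\<^bsub>A\<^esub> e (augmentation (\<delta> g))"
      using delta by (simp add: e_1 A.minus_eq A.a_assoc A.l_neg)
    then show ?case using gen[OF delta] delta_minus_one_augI[OF delta] by blast
  next
    case (add x y)
    then obtain i j where ij: "i \<in> augmentation_ideal" "j \<in> augmentation_ideal" "P i" "P j"
      "x = i \<oplus>\<^bsub>A\<^esub> e (augmentation x)" "y = j \<oplus>\<^bsub>A\<^esub> e (augmentation y)"
      by blast
    have "x \<oplus>\<^bsub>A\<^esub> y = (i \<oplus>\<^bsub>A\<^esub> e (augmentation x)) \<oplus>\<^bsub>A\<^esub> (j \<oplus>\<^bsub>A\<^esub> e (augmentation y))"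
      using ij by simp
    also have "\<dots> = (i \<oplus>\<^bsub>A\<^esub> j) \<oplus>\<^bsub>A\<^esub> (e (augmentation x) \<oplus>\<^bsub>A\<^esub> e (augmentation y))"
      using ij(1,2) by (simp add: A.a_ac e_closed)
    also have "e (augmentation x) \<oplus>\<^bsub>A\<^esub> e (augmentation y) = e (augmentation (x \<oplus>\<^bsub>A\<^esub> y))"
      by (simp add: e_add aug_add)
    finally show ?case
      using assms(4)[OF ij(1-4)] augmentation_ideal.a_closed[OF ij(1,2)] by blast
  qed
  from *[of x] show ?thesis
    using assms(1) by (auto simp: augI_iff e_0)
qed

end

section \<open>Nilpotency of the augmentation ideal\<close>

context modular_group_algebra
begin

abbreviation \<Delta> :: "'a \<Rightarrow> 'a \<Rightarrow> int" where
  "\<Delta> g \<equiv> \<delta> g \<ominus>\<^bsub>A\<^esub> \<one>\<^bsub>A\<^esub>"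

lemma Delta_one: "\<Delta> \<one> = \<zero>\<^bsub>A\<^esub>"
  by (simp add: delta_one A.minus_eq A.r_neg)

lemma delta_eq_Delta: "\<delta> g = \<Delta> g \<oplus>\<^bsub>A\<^esub> \<one>\<^bsub>A\<^esub>"
  by (simp add: A.minus_eq A.a_assoc A.l_neg)

lemma Delta_mult:
  assumes "g \<in> carrier G" "h \<in> carrier G"
  shows "\<Delta> (g \<otimes> h) = \<delta> g \<otimes>\<^bsub>A\<^esub> \<Delta> h \<oplus>\<^bsub>A\<^esub> \<Delta> g"
proof -
  have "\<delta> g \<otimes>\<^bsub>A\<^esub> \<Delta> h = \<delta> (g \<otimes> h) \<ominus>\<^bsub>A\<^esub> \<delta> g"
    using assms by (simp add: A.minus_eq A.r_distr A.r_minus delta_mult)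
  then show ?thesis
    by (simp add: A.minus_eq A.a_assoc[symmetric]) (simp add: A.a_assoc A.l_neg)
qed

lemma minus_mod_p: "mod_p x \<ominus>\<^bsub>A\<^esub> mod_p y = mod_p (\<lambda>g. x g - y g)"
proof -
  have "mod_p (\<lambda>g. - y g) \<oplus>\<^bsub>A\<^esub> mod_p y = \<zero>\<^bsub>A\<^esub>"
    unfolding add_mod_p zero_A by simp
  then have "\<ominus>\<^bsub>A\<^esub> mod_p y = mod_p (\<lambda>g. - y g)"
    using A.minus_equality mod_p_closed by blast
  then show ?thesis
    by (simp add: A.minus_eq add_mod_p)
qed

text \<open>
  Multiplying by \<open>g - 1\<close> subtracts the coefficients from their translates by \<open>g\<close>, so the step from
  \<open>k\<close> to \<open>k + 1\<close> is Pascal's rule.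
\<close>

lemma Delta_pow_coefficients:
  assumes g: "g \<in> carrier G"
  shows "\<Delta> g [^]\<^bsub>A\<^esub> (k::nat)
    = mod_p (\<lambda>h. \<Sum>j\<le>k. (- 1) ^ (k + j) * int (k choose j) * of_bool (h = g [^] j))"
proof (induction k)
  case 0
  show ?case by (simp add: one_A)
next
  case (Suc k)
  \<comment> \<open>The exponent \<open>k + j\<close> has the parity of \<open>k - j\<close> and avoids truncated subtraction.\<close>
  define f where "f = (\<lambda>h. \<Sum>j\<le>k. (- 1) ^ (k + j) * int (k choose j) * of_bool (h = g [^] j))"
  have pascal: "(\<Sum>j\<le>Suc k. (- 1) ^ (Suc k + j) * int (Suc k choose j) * e j)
      = (\<Sum>j\<le>k. (- 1) ^ (k + j) * int (k choose j) * e (Suc j))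
        - (\<Sum>j\<le>k. (- 1) ^ (k + j) * int (k choose j) * e j)" for e :: "nat \<Rightarrow> int"
  proof -
    have "(\<Sum>j\<le>Suc k. (- 1) ^ (Suc k + j) * int (Suc k choose j) * e j)
        = (- 1) ^ Suc k * e 0 + ((\<Sum>j\<le>k. (- 1) ^ (k + j) * int (k choose j) * e (Suc j))
          + (\<Sum>j\<le>k. (- 1) ^ (k + j) * int (k choose Suc j) * e (Suc j)))"
      by (subst sum.atMost_Suc_shift) (simp add: sum.distrib[symmetric] algebra_simps)
    moreover have "(\<Sum>j\<le>Suc k. (- 1) ^ (k + j) * int (k choose j) * e j)
        = (- 1) ^ k * e 0 - (\<Sum>j\<le>k. (- 1) ^ (k + j) * int (k choose Suc j) * e (Suc j))"
      by (subst sum.atMost_Suc_shift) (simp add: sum_negf)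
    moreover have "(\<Sum>j\<le>Suc k. (- 1) ^ (k + j) * int (k choose j) * e j)
        = (\<Sum>j\<le>k. (- 1) ^ (k + j) * int (k choose j) * e j)"
      by simp
    ultimately show ?thesis by simp
  qed
  have "\<Delta> g [^]\<^bsub>A\<^esub> Suc k = \<Delta> g \<otimes>\<^bsub>A\<^esub> mod_p f"
    using Suc A.nat_pow_Suc2[of "\<Delta> g" k] by (simp add: f_def)
  also have "\<dots> = \<delta> g \<otimes>\<^bsub>A\<^esub> mod_p f \<ominus>\<^bsub>A\<^esub> mod_p f"
    by (simp add: A.minus_eq A.l_distr A.l_minus)
  also have "\<dots> = mod_p (\<lambda>h. mod_p f (inv g \<otimes> h) - f h)"
    unfolding delta_mult_left[OF g mod_p_closed] minus_mod_p ..
  also have "\<dots> = mod_p (\<lambda>h. f (inv g \<otimes> h) - f h)"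
    using g by (intro mod_p_cong) (simp add: mod_p_apply mod_diff_left_eq)
  also have "\<dots> = mod_p (\<lambda>h. \<Sum>j\<le>Suc k. (- 1) ^ (Suc k + j) * int (Suc k choose j)
      * of_bool (h = g [^] j))"
  proof (rule mod_p_cong)
    fix h assume h: "h \<in> carrier G"
    have "inv g \<otimes> h = g [^] j \<longleftrightarrow> h = g [^] Suc j" for j :: nat
      using g h inv_solve_left[of "g [^] j" g h] nat_pow_Suc2[OF g, of j] by auto
    then have "f (inv g \<otimes> h) = (\<Sum>j\<le>k. (- 1) ^ (k + j) * int (k choose j)
        * of_bool (h = g [^] Suc j))"
      by (simp add: f_def)
    then show "(f (inv g \<otimes> h) - f h) mod int p
        = (\<Sum>j\<le>Suc k. (- 1) ^ (Suc k + j) * int (Suc k choose j) * of_bool (h = g [^] j)) mod int p"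
      unfolding pascal by (simp add: f_def)
  qed
  finally show ?case .
qed

text \<open>
  The inner binomial coefficients vanish modulo \<open>p\<close>. The constant term \<open>(-1)\<^sup>p\<close> equals \<open>-1\<close> also
  for \<open>p = 2\<close>, where the sign disappears modulo 2.
\<close>

lemma Delta_pow_p:
  assumes g: "g \<in> carrier G"
  shows "\<Delta> g [^]\<^bsub>A\<^esub> p = \<Delta> (g [^] p)"
proof -
  have "[(\<Sum>j\<le>p. (- 1) ^ (p + j) * int (p choose j) * of_bool (h = g [^] j))
      = of_bool (h = g [^] p) - of_bool (h = \<one>)] (mod int p)" for h
  proof -
    let ?t = "\<lambda>j. (- 1) ^ (p + j) * int (p choose j) * of_bool (h = g [^] j)"
    have "(\<Sum>j\<le>p. ?t j) = (\<Sum>j\<in>{0, p} \<union> {1..<p}. ?t j)"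
      using p_gt_1 by (intro sum.cong) auto
    also have "\<dots> = ?t 0 + ?t p + (\<Sum>j\<in>{1..<p}. ?t j)"
      using p_gt_1 by (subst sum.union_disjoint) auto
    finally have eq: "(\<Sum>j\<le>p. ?t j) = ?t 0 + ?t p + (\<Sum>j\<in>{1..<p}. ?t j)" .
    have "int p dvd ?t j" if "j \<in> {1..<p}" for j
      using dvd_choose_prime[of j p] that prime_p by (auto intro!: dvd_mult dvd_mult2)
    then have "[(\<Sum>j\<in>{1..<p}. ?t j) = 0] (mod int p)"
      unfolding cong_0_iff by (intro dvd_sum)
    moreover have "[(- 1) ^ p = (- 1 :: int)] (mod int p)"
    proof (cases "p = 2")
      case True
      then show ?thesis by (simp add: cong_def)
    next
      case False
      then show ?thesis using prime_odd_nat[OF prime_p] p_gt_1 by simp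
    qed
    then have "[?t 0 = - of_bool (h = \<one>)] (mod int p)"
      by (auto simp: of_bool_def)
    moreover have "?t p = of_bool (h = g [^] p)"
      by (simp add: power_add[symmetric] mult_2[symmetric])
    ultimately show ?thesis
      unfolding eq
      by (metis (no_types, lifting) add.commute cong_add cong_refl add.right_neutral uminus_add_conv_diff)
  qed
  then have "mod_p (\<lambda>h. \<Sum>j\<le>p. (- 1) ^ (p + j) * int (p choose j) * of_bool (h = g [^] j))
      = mod_p (\<lambda>h. of_bool (h = g [^] p) - of_bool (h = \<one>))"
    by (intro mod_p_cong) (simp add: cong_def)
  then show ?thesis
    unfolding Delta_pow_coefficients[OF g] by (simp only: \<delta>_def one_A minus_mod_p)
qed

lemma Delta_pow_prime_power:
  assumes g: "g \<in> carrier G"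
  shows "\<Delta> g [^]\<^bsub>A\<^esub> (p ^ m) = \<Delta> (g [^] (p ^ m))"
proof (induction m)
  case (Suc m)
  have "\<Delta> g [^]\<^bsub>A\<^esub> (p ^ Suc m) = (\<Delta> g [^]\<^bsub>A\<^esub> (p ^ m)) [^]\<^bsub>A\<^esub> p"
    by (simp add: A.nat_pow_pow mult.commute)
  also have "\<dots> = \<Delta> ((g [^] (p ^ m)) [^] p)"
    unfolding Suc by (rule Delta_pow_p) (use g in simp)
  finally show ?case using g by (simp add: nat_pow_pow mult.commute)
qed (use g in simp)

text \<open>
  The cofactor is \<open>u = 1 + a + \<dots> + a\<^sup>r\<^sup>-\<^sup>1\<close>, whose augmentation is \<open>r\<close>.
\<close>

lemma Delta_pow_left_multiple:
  assumes a: "a \<in> carrier G"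
  shows "\<exists>u\<in>carrier A. \<Delta> (a [^] r) = u \<otimes>\<^bsub>A\<^esub> \<Delta> a \<and> augmentation u = int r mod int p"
proof (induction r)
  case 0
  show ?case by (intro bexI[of _ "\<zero>\<^bsub>A\<^esub>"]) (simp_all add: Delta_one)
next
  case (Suc r)
  then obtain u where u: "u \<in> carrier A" "\<Delta> (a [^] r) = u \<otimes>\<^bsub>A\<^esub> \<Delta> a" "augmentation u = int r mod int p"
    by blast
  have "\<Delta> (a [^] Suc r) = (\<delta> (a [^] r) \<oplus>\<^bsub>A\<^esub> u) \<otimes>\<^bsub>A\<^esub> \<Delta> a"
    using a u by (simp add: Delta_mult A.l_distr)
  moreover have "augmentation (\<delta> (a [^] r) \<oplus>\<^bsub>A\<^esub> u) = int (Suc r) mod int p"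
    using a u by (simp add: aug_add mod_add_right_eq)
  ultimately show ?case using u by (metis A.add.m_closed delta_closed)
qed

text \<open>
  Since \<open>gh - 1 = g(h - 1) + (g - 1)\<close>, the elements \<open>g\<close> for which \<open>g - 1\<close> lies in the left ideal
  generated by \<open>a - 1\<close>, \<open>b - 1\<close> and \<open>c - 1\<close> form a subgroup.
\<close>

lemma augI_left_generated:
  assumes abc: "a \<in> carrier G" "b \<in> carrier G" "c \<in> carrier G"
    and gen: "\<And>H. subgroup H G \<Longrightarrow> {a, b, c} \<subseteq> H \<Longrightarrow> H = carrier G"
    and i: "i \<in> augmentation_ideal"
  shows "\<exists>u\<in>carrier A. \<exists>v\<in>carrier A. \<exists>w\<in>carrier A.
    i = u \<otimes>\<^bsub>A\<^esub> \<Delta> a \<oplus>\<^bsub>A\<^esub> v \<otimes>\<^bsub>A\<^esub> \<Delta> b \<oplus>\<^bsub>A\<^esub> w \<otimes>\<^bsub>A\<^esub> \<Delta> c"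
proof -
  define f where "f u v w = u \<otimes>\<^bsub>A\<^esub> \<Delta> a \<oplus>\<^bsub>A\<^esub> v \<otimes>\<^bsub>A\<^esub> \<Delta> b \<oplus>\<^bsub>A\<^esub> w \<otimes>\<^bsub>A\<^esub> \<Delta> c" for u v w
  define L where "L = {i. \<exists>u\<in>carrier A. \<exists>v\<in>carrier A. \<exists>w\<in>carrier A. i = f u v w}"
  have LI: "f u v w \<in> L" if "u \<in> carrier A" "v \<in> carrier A" "w \<in> carrier A" for u v w
    using that unfolding L_def by blast
  have LE: "\<exists>u\<in>carrier A. \<exists>v\<in>carrier A. \<exists>w\<in>carrier A. i = f u v w" if "i \<in> L" for i
    using that unfolding L_def by simp
  have L_add: "i \<oplus>\<^bsub>A\<^esub> j \<in> L" if ij: "i \<in> L" "j \<in> L" for i j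
  proof -
    from LE[OF ij(1)] obtain u v w
      where c: "u \<in> carrier A" "v \<in> carrier A" "w \<in> carrier A" "i = f u v w" by blast
    from LE[OF ij(2)] obtain u' v' w'
      where c': "u' \<in> carrier A" "v' \<in> carrier A" "w' \<in> carrier A" "j = f u' v' w'" by blast
    have "i \<oplus>\<^bsub>A\<^esub> j = f (u \<oplus>\<^bsub>A\<^esub> u') (v \<oplus>\<^bsub>A\<^esub> v') (w \<oplus>\<^bsub>A\<^esub> w')"
      unfolding c(4) c'(4) f_def using c c' by (simp add: A.l_distr A.a_ac)
    then show ?thesis using LI c c' by simp
  qed
  have L_mult: "r \<otimes>\<^bsub>A\<^esub> i \<in> L" if r: "r \<in> carrier A" and i: "i \<in> L" for r i
  proof -
    from LE[OF i] obtain u v w where c: "u \<in> carrier A" "v \<in> carrier A" "w \<in> carrier A"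
      "i = f u v w" by blast
    have "r \<otimes>\<^bsub>A\<^esub> i = f (r \<otimes>\<^bsub>A\<^esub> u) (r \<otimes>\<^bsub>A\<^esub> v) (r \<otimes>\<^bsub>A\<^esub> w)"
      unfolding c(4) f_def using c r by (simp add: A.r_distr A.m_assoc)
    then show ?thesis using LI c r by simp
  qed
  have L_zero: "\<zero>\<^bsub>A\<^esub> \<in> L" using LI[of "\<zero>\<^bsub>A\<^esub>" "\<zero>\<^bsub>A\<^esub>" "\<zero>\<^bsub>A\<^esub>"] by (simp add: f_def)
  have L_gen: "\<Delta> a \<in> L" "\<Delta> b \<in> L" "\<Delta> c \<in> L"
    using LI[of "\<one>\<^bsub>A\<^esub>" "\<zero>\<^bsub>A\<^esub>" "\<zero>\<^bsub>A\<^esub>"] LI[of "\<zero>\<^bsub>A\<^esub>" "\<one>\<^bsub>A\<^esub>" "\<zero>\<^bsub>A\<^esub>"] LI[of "\<zero>\<^bsub>A\<^esub>" "\<zero>\<^bsub>A\<^esub>" "\<one>\<^bsub>A\<^esub>"]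
    by (simp_all add: f_def)
  let ?H = "{g \<in> carrier G. \<Delta> g \<in> L}"
  have H_mult: "g \<otimes> h \<in> ?H" if "g \<in> ?H" "h \<in> ?H" for g h
    using that L_add L_mult by (simp add: Delta_mult)
  have H_pow: "g [^] (k::nat) \<in> ?H" if "g \<in> ?H" for g k
    using that by (induction k) (use H_mult L_zero in \<open>auto simp: Delta_one\<close>)
  have "subgroup ?H G"
  proof (rule subgroupI)
    show "?H \<noteq> {}" using abc L_gen by blast
    fix g assume g: "g \<in> ?H"
    have "g [^] (order G - 1) \<otimes> g = \<one>"
      using g pow_order_eq_1[of g] finite_G order_gt_0_iff_finite
      by (metis (no_types, lifting) Suc_diff_1 mem_Collect_eq nat_pow_Suc)
    then have "inv g = g [^] (order G - 1)"
      using g by (intro inv_equality) auto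
    then show "inv g \<in> ?H" using H_pow[OF g] by simp
  qed (use H_mult in auto)
  then have H: "?H = carrier G"
    using gen abc L_gen by blast
  have "i \<in> L"
    using i by (induction rule: augI_induct) (use L_zero L_add H in blast)+
  then show ?thesis using LE unfolding f_def by blast
qed

text \<open>
  From \<open>ag = ga\<^sup>r\<close> and \<open>a\<^sup>r - 1 = u(a - 1)\<close> follows \<open>(a - 1)(g - 1) = (gu - 1)(a - 1)\<close>. The
  augmentation of \<open>gu - 1\<close> is \<open>r - 1\<close>, so \<open>r \<equiv> 1\<close> modulo \<open>p\<close> is exactly what keeps the cofactor
  inside the augmentation ideal.
\<close>

lemma Delta_normalizes_augI:
  assumes a: "a \<in> carrier G"
    and conj: "\<And>g. g \<in> carrier G \<Longrightarrow> \<exists>r::nat. r mod p = 1 \<and> a \<otimes> g = g \<otimes> a [^] r"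
    and i: "i \<in> augmentation_ideal"
  shows "\<exists>j\<in>augmentation_ideal. \<Delta> a \<otimes>\<^bsub>A\<^esub> i = j \<otimes>\<^bsub>A\<^esub> \<Delta> a"
  using i
proof (induction rule: augI_induct)
  case zero
  show ?case
    by (intro bexI[of _ "\<zero>\<^bsub>A\<^esub>"]) (simp_all add: augI_iff)
next
  case (gen g)
  obtain r where r: "r mod p = 1" "a \<otimes> g = g \<otimes> a [^] r" using conj[OF gen] by blast
  obtain u where u: "u \<in> carrier A" "\<Delta> (a [^] r) = u \<otimes>\<^bsub>A\<^esub> \<Delta> a" "augmentation u = int r mod int p"
    using Delta_pow_left_multiple[OF a] by blast
  have "augmentation u = 1"
    using r(1) by (metis of_nat_1 of_nat_mod u(3))
  have "\<Delta> a \<otimes>\<^bsub>A\<^esub> \<delta> g = \<delta> (a \<otimes> g) \<ominus>\<^bsub>A\<^esub> \<delta> g"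
    using a gen by (simp add: A.minus_eq A.l_distr A.l_minus delta_mult)
  also have "\<dots> = \<delta> g \<otimes>\<^bsub>A\<^esub> \<Delta> (a [^] r)"
    unfolding r(2) using a gen by (simp add: A.minus_eq A.r_distr A.r_minus delta_mult)
  finally have "\<Delta> a \<otimes>\<^bsub>A\<^esub> \<delta> g = (\<delta> g \<otimes>\<^bsub>A\<^esub> u) \<otimes>\<^bsub>A\<^esub> \<Delta> a"
    using u by (simp add: A.m_assoc)
  moreover have "X \<otimes>\<^bsub>A\<^esub> (Y \<ominus>\<^bsub>A\<^esub> \<one>\<^bsub>A\<^esub>) = X \<otimes>\<^bsub>A\<^esub> Y \<ominus>\<^bsub>A\<^esub> X"
      "(Y \<ominus>\<^bsub>A\<^esub> \<one>\<^bsub>A\<^esub>) \<otimes>\<^bsub>A\<^esub> X = Y \<otimes>\<^bsub>A\<^esub> X \<ominus>\<^bsub>A\<^esub> X"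
    if "X \<in> carrier A" "Y \<in> carrier A" for X Y
    using that by (simp_all add: A.minus_eq A.r_distr A.l_distr A.r_minus A.l_minus)
  ultimately have "\<Delta> a \<otimes>\<^bsub>A\<^esub> \<Delta> g = (\<delta> g \<otimes>\<^bsub>A\<^esub> u \<ominus>\<^bsub>A\<^esub> \<one>\<^bsub>A\<^esub>) \<otimes>\<^bsub>A\<^esub> \<Delta> a"
    using u by (metis A.m_closed A.minus_closed A.one_closed delta_closed)
  moreover have "\<delta> g \<otimes>\<^bsub>A\<^esub> u \<ominus>\<^bsub>A\<^esub> \<one>\<^bsub>A\<^esub> \<in> augmentation_ideal"
    using u gen \<open>augmentation u = 1\<close> p_gt_1 by (simp add: augI_iff aug_minus aug_mult)
  ultimately show ?case by blast
next
  case (add x y)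
  then obtain u v where uv: "u \<in> augmentation_ideal" "v \<in> augmentation_ideal" "\<Delta> a \<otimes>\<^bsub>A\<^esub> x = u \<otimes>\<^bsub>A\<^esub> \<Delta> a"
    "\<Delta> a \<otimes>\<^bsub>A\<^esub> y = v \<otimes>\<^bsub>A\<^esub> \<Delta> a" by blast
  have "\<Delta> a \<otimes>\<^bsub>A\<^esub> (x \<oplus>\<^bsub>A\<^esub> y) = (u \<oplus>\<^bsub>A\<^esub> v) \<otimes>\<^bsub>A\<^esub> \<Delta> a"
    using uv add.hyps by (simp add: A.l_distr A.r_distr augI_iff)
  moreover have "u \<oplus>\<^bsub>A\<^esub> v \<in> augmentation_ideal"
    using uv by (simp add: augI_iff aug_add)
  ultimately show ?case by blast
qed

text \<open>
  The weight count for \<open>x = a - 1\<close>, \<open>y = b - 1\<close>, \<open>z = c - 1\<close>. With \<open>c = 1\<close> and \<open>e = 1\<close> it covers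
  groups generated by \<open>a\<close> and \<open>b\<close>; weight \<open>s = 2\<close> is for the case that \<open>b\<close> and \<open>c\<close> commute only up
  to a power of \<open>a\<close>, as in the Heisenberg group.
\<close>

theorem augI_nilpotent:
  assumes abc: "a \<in> carrier G" "b \<in> carrier G" "c \<in> carrier G"
    and gen: "\<And>H. subgroup H G \<Longrightarrow> {a, b, c} \<subseteq> H \<Longrightarrow> H = carrier G"
    and conj: "\<And>g. g \<in> carrier G \<Longrightarrow> \<exists>r::nat. r mod p = 1 \<and> a \<otimes> g = g \<otimes> a [^] r"
    and a_pow: "a [^] (p ^ m) = \<one>"
    and s: "1 \<le> s" "s \<le> 2"
    and comm: "c \<otimes> b = b \<otimes> c \<otimes> a [^] (l::nat)" "s = 1 \<Longrightarrow> l = 0"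
    and b_pow: "b [^] p = (a [^] (k::nat)) [^] p"
    and c_pow: "c [^] e = \<one>" "e = 1 \<or> e = p"
  shows "A.ideal_power augmentation_ideal (p + e - 1 + s * (p ^ m - 1)) = {\<zero>\<^bsub>A\<^esub>}"
proof (rule A.ideal_power_eq_zero[OF augI_ideal, where x = "\<Delta> a"])
  have D: "\<Delta> g \<in> augmentation_ideal" if "g \<in> carrier G" for g
    using that by (rule delta_minus_one_augI)
  have P: "A.ideal_power augmentation_ideal t = I \<Longrightarrow> \<zero>\<^bsub>A\<^esub> \<in> I" for t I
    using A.ideal_power_ideal[OF augI_ideal] additive_subgroup.zero_closed ideal.axioms(1) by blast
  show "s \<le> p + e - 1" using s p_gt_1 c_pow by auto
  show "\<Delta> a [^]\<^bsub>A\<^esub> (p ^ m) = \<zero>\<^bsub>A\<^esub>"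
    using abc a_pow by (simp add: Delta_pow_prime_power Delta_one)
  show "p ^ m \<ge> 1" using p_gt_1 by simp
  fix w assume w: "w \<in> A.ideal_power augmentation_ideal (p + e - 1)"
  show "\<exists>v\<in>A.ideal_power augmentation_ideal (p + e - 1 - s). w = v \<otimes>\<^bsub>A\<^esub> \<Delta> a"
  proof (rule A.ideal_power_right_factor[OF augI_ideal D D D s _ _ _ _ _ w])
    fix i assume i: "i \<in> augmentation_ideal"
    show "\<exists>u\<in>carrier A. \<exists>v\<in>carrier A. \<exists>w\<in>carrier A.
        i = u \<otimes>\<^bsub>A\<^esub> \<Delta> a \<oplus>\<^bsub>A\<^esub> v \<otimes>\<^bsub>A\<^esub> \<Delta> b \<oplus>\<^bsub>A\<^esub> w \<otimes>\<^bsub>A\<^esub> \<Delta> c"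
      by (rule augI_left_generated[OF abc gen i])
    show "\<exists>j\<in>augmentation_ideal. \<Delta> a \<otimes>\<^bsub>A\<^esub> i = j \<otimes>\<^bsub>A\<^esub> \<Delta> a"
      by (rule Delta_normalizes_augI[OF abc(1) conj i])
  next
    obtain u where u: "u \<in> carrier A" "\<Delta> (a [^] l) = u \<otimes>\<^bsub>A\<^esub> \<Delta> a"
      using Delta_pow_left_multiple[OF abc(1)] by blast
    define t where "t = (if s = 1 then \<zero>\<^bsub>A\<^esub> else \<delta> (b \<otimes> c) \<otimes>\<^bsub>A\<^esub> u)"
    have t: "t \<in> A.ideal_power augmentation_ideal (2 - s)"
    proof (cases "s = 1")
      case True
      then show ?thesis unfolding t_def using P[OF refl] by presburger
    next
      case False
      then have "s = 2" using s by simp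
      then show ?thesis using u by (simp add: t_def)
    qed
    have "\<delta> (c \<otimes> b) = \<delta> (b \<otimes> c) \<oplus>\<^bsub>A\<^esub> t \<otimes>\<^bsub>A\<^esub> \<Delta> a"
    proof (cases "s = 1")
      case True
      then show ?thesis using abc comm by (simp add: t_def)
    next
      case False
      have "\<delta> (c \<otimes> b) = \<delta> (b \<otimes> c) \<otimes>\<^bsub>A\<^esub> \<delta> (a [^] l)"
        using abc by (simp add: comm(1) delta_mult)
      also have "\<dots> = \<delta> (b \<otimes> c) \<oplus>\<^bsub>A\<^esub> \<delta> (b \<otimes> c) \<otimes>\<^bsub>A\<^esub> \<Delta> (a [^] l)"
        by (subst delta_eq_Delta[of "a [^] l"]) (simp add: A.r_distr A.a_comm)
      finally show ?thesis using False u by (simp add: t_def A.m_assoc)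
    qed
    then have "\<Delta> c \<otimes>\<^bsub>A\<^esub> \<Delta> b = \<Delta> b \<otimes>\<^bsub>A\<^esub> \<Delta> c \<oplus>\<^bsub>A\<^esub> t \<otimes>\<^bsub>A\<^esub> \<Delta> a"
      using abc A.ideal_power_closed[OF augI_ideal t]
      by (simp add: A.minus_eq A.l_distr A.r_distr A.l_minus A.r_minus A.minus_add delta_mult A.a_ac)
    then show "\<exists>u\<in>A.ideal_power augmentation_ideal (2 - s).
        \<Delta> c \<otimes>\<^bsub>A\<^esub> \<Delta> b = \<Delta> b \<otimes>\<^bsub>A\<^esub> \<Delta> c \<oplus>\<^bsub>A\<^esub> u \<otimes>\<^bsub>A\<^esub> \<Delta> a"
      using t by blast
  next
    obtain u where u: "u \<in> carrier A" "\<Delta> (a [^] k) = u \<otimes>\<^bsub>A\<^esub> \<Delta> a"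
      using Delta_pow_left_multiple[OF abc(1)] by blast
    have ak: "\<Delta> (a [^] k) \<in> augmentation_ideal" using D abc by simp
    have "\<Delta> b [^]\<^bsub>A\<^esub> p = \<Delta> (a [^] k) [^]\<^bsub>A\<^esub> Suc (p - 1)"
      using abc p_gt_1 by (simp add: Delta_pow_p b_pow del: A.nat_pow_Suc)
    also have "\<dots> = (\<Delta> (a [^] k) [^]\<^bsub>A\<^esub> (p - 1) \<otimes>\<^bsub>A\<^esub> u) \<otimes>\<^bsub>A\<^esub> \<Delta> a"
      using u by (simp add: A.m_assoc)
    finally have "\<Delta> b [^]\<^bsub>A\<^esub> p = (\<Delta> (a [^] k) [^]\<^bsub>A\<^esub> (p - 1) \<otimes>\<^bsub>A\<^esub> u) \<otimes>\<^bsub>A\<^esub> \<Delta> a" .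
    moreover have "\<Delta> (a [^] k) [^]\<^bsub>A\<^esub> (p - 1) \<otimes>\<^bsub>A\<^esub> u \<in> A.ideal_power augmentation_ideal (p - s)"
      using u s by (intro A.ideal_power_mult[OF augI_ideal A.ideal_power_nat_pow[OF augI_ideal ak],
          of _ 0]) auto
    ultimately show "\<exists>v\<in>A.ideal_power augmentation_ideal (p - s). \<Delta> b [^]\<^bsub>A\<^esub> p = v \<otimes>\<^bsub>A\<^esub> \<Delta> a"
      by blast
  next
    have "\<Delta> c [^]\<^bsub>A\<^esub> e = \<zero>\<^bsub>A\<^esub>"
      using c_pow abc by (auto simp: Delta_pow_p Delta_one)
    then show "\<exists>v\<in>A.ideal_power augmentation_ideal (e - s). \<Delta> c [^]\<^bsub>A\<^esub> e = v \<otimes>\<^bsub>A\<^esub> \<Delta> a"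
      using P[OF refl] by (intro bexI[of _ "\<zero>\<^bsub>A\<^esub>"]) simp_all
  qed (use abc in auto)
qed simp

end

section \<open>Davenport constants and the Loewy length\<close>

lemma list_product_simps [simp]:
  "list_product G [] = \<one>\<^bsub>G\<^esub>"
  "list_product G (x # xs) = x \<otimes>\<^bsub>G\<^esub> list_product G xs"
  by (simp_all add: list_product_def)

lemma (in monoid) list_product_closed [simp]:
  "set xs \<subseteq> carrier G \<Longrightarrow> list_product G xs \<in> carrier G"
  by (induction xs) auto

lemma (in monoid) list_product_append:
  "set xs \<subseteq> carrier G \<Longrightarrow> set ys \<subseteq> carrier G \<Longrightarrow>
    list_product G (xs @ ys) = list_product G xs \<otimes> list_product G ys"
  by (induction xs) (auto simp: m_assoc)

lemma (in monoid) list_product_replicate: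
  "x \<in> carrier G \<Longrightarrow> list_product G (replicate n x) = x [^] n"
  by (induction n) (simp_all add: nat_pow_Suc2[symmetric] del: nat_pow_Suc)

text \<open>
  The inequality \<open>d(G) + 1 \<le> k\<close> phrased for lists, which can be split and concatenated directly.
\<close>

definition unordered_davenport_le :: "('a, 'b) monoid_scheme \<Rightarrow> nat \<Rightarrow> bool" where
  "unordered_davenport_le G k \<longleftrightarrow> (\<forall>xs. set xs \<subseteq> carrier G \<and> k \<le> length xs \<longrightarrow>
     (\<exists>ys. ys \<noteq> [] \<and> mset ys \<subseteq># mset xs \<and> list_product G ys = \<one>\<^bsub>G\<^esub>))"

lemma small_davenport_le:
  assumes "unordered_davenport_le G k"
  shows "small_davenport G + 1 \<le> enat k"
proof -
  have size: "size S < k" if S: "set_mset S \<subseteq> carrier G" "\<one>\<^bsub>G\<^esub> \<notin> subseq_products G S" for S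
  proof (rule ccontr)
    assume "\<not> size S < k"
    obtain xs where xs: "mset xs = S" using ex_mset by blast
    obtain ys where ys: "ys \<noteq> []" "mset ys \<subseteq># S" "list_product G ys = \<one>\<^bsub>G\<^esub>"
      using assms S \<open>\<not> size S < k\<close> xs unfolding unordered_davenport_le_def
      by (metis linorder_not_less set_mset_mset size_mset)
    have "size (mset ys) \<ge> 1" using ys by (cases ys) auto
    moreover have "\<one>\<^bsub>G\<^esub> \<in> perm_products G (mset ys)"
      unfolding perm_products_def using ys
      by (intro image_eqI[of _ _ ys]) (auto simp: permutations_of_multisetI)
    ultimately show False using S(2) ys unfolding subseq_products_def by blast
  qed
  have "small_davenport G \<le> enat (k - 1)"
    unfolding small_davenport_def
  proof (rule SUP_least)
    fix S assume "S \<in> {S. set_mset S \<subseteq> carrier G \<and> \<one>\<^bsub>G\<^esub> \<notin> subseq_products G S}"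
    then show "enat (size S) \<le> enat (k - 1)" using size[of S] by auto
  qed
  moreover have "k > 0"
  proof -
    have "subseq_products G {#} = {}" by (auto simp: subseq_products_def)
    then show ?thesis using size[of "{#}"] by auto
  qed
  ultimately have "small_davenport G + 1 \<le> enat (k - 1) + 1" by (intro add_right_mono)
  then show ?thesis using \<open>k > 0\<close> by (simp add: one_enat_def)
qed

definition ordered_davenport_le :: "('a, 'b) monoid_scheme \<Rightarrow> nat \<Rightarrow> bool" where
  "ordered_davenport_le G k \<longleftrightarrow>
     (\<forall>xs. set xs \<subseteq> carrier G \<and> length xs \<ge> k \<longrightarrow> \<one>\<^bsub>G\<^esub> \<in> ordered_products G xs)"

lemma subseq_imp_subset_mset: "subseq ys xs \<Longrightarrow> mset ys \<subseteq># mset xs"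
  by (induction rule: list_emb.induct)
    (auto simp: subset_mset.add_increasing intro: subset_mset.order_trans)

lemma ordered_davenport_le_mono:
  "ordered_davenport_le G k \<Longrightarrow> k \<le> l \<Longrightarrow> ordered_davenport_le G l"
  unfolding ordered_davenport_le_def by (meson order_trans)

lemma ordered_imp_unordered_davenport_le:
  assumes "ordered_davenport_le G k"
  shows "unordered_davenport_le G k"
  unfolding unordered_davenport_le_def
proof (intro allI impI)
  fix xs assume "set xs \<subseteq> carrier G \<and> k \<le> length xs"
  then have "\<one>\<^bsub>G\<^esub> \<in> ordered_products G xs" using assms by (simp add: ordered_davenport_le_def)
  then obtain ys where ys: "subseq ys xs" "length ys \<ge> 1" "list_product G ys = \<one>\<^bsub>G\<^esub>"
    unfolding ordered_products_def by auto
  have "mset ys \<subseteq># mset xs"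
    by (rule subseq_imp_subset_mset[OF ys(1)])
  then show "\<exists>ys. ys \<noteq> [] \<and> mset ys \<subseteq># mset xs \<and> list_product G ys = \<one>\<^bsub>G\<^esub>"
    using ys by (intro exI[of _ ys]) auto
qed

lemma small_davenport_le_ordered: "small_davenport G + 1 \<le> ordered_davenport G"
  unfolding ordered_davenport_def
  by (rule INF_greatest)
    (auto simp: ordered_davenport_le_def intro!: small_davenport_le ordered_imp_unordered_davenport_le)

context modular_group_algebra
begin

lemma ordered_products_Cons:
  "ordered_products G ys \<subseteq> ordered_products G (y # ys)"
  "(\<lambda>g. y \<otimes> g) ` ordered_products G ys \<subseteq> ordered_products G (y # ys)"
  "y \<in> carrier G \<Longrightarrow> y \<in> ordered_products G (y # ys)"
proof -
  show "ordered_products G ys \<subseteq> ordered_products G (y # ys)"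
    unfolding ordered_products_def by auto
  show "(\<lambda>g. y \<otimes> g) ` ordered_products G ys \<subseteq> ordered_products G (y # ys)"
  proof clarify
    fix g assume "g \<in> ordered_products G ys"
    then obtain zs where "subseq zs ys" "g = list_product G zs"
      unfolding ordered_products_def by auto
    then show "y \<otimes> g \<in> ordered_products G (y # ys)"
      unfolding ordered_products_def by (intro image_eqI[of _ _ "y # zs"]) auto
  qed
  assume "y \<in> carrier G"
  then show "y \<in> ordered_products G (y # ys)"
    unfolding ordered_products_def by (intro image_eqI[of _ _ "[y]"]) auto
qed

text \<open>
  In the expansion of \<open>(y\<^sub>1 - 1) \<cdots> (y\<^sub>l - 1)\<close> the nonempty choices of factors contribute ordered
  subproducts, and the empty choice contributes \<open>\<plusminus>1\<close> at the identity.
\<close>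

lemma Delta_product_coefficient:
  assumes "set xs \<subseteq> carrier G" "g \<in> carrier G" "g \<notin> ordered_products G xs"
  shows "[foldr (\<lambda>y w. \<Delta> y \<otimes>\<^bsub>A\<^esub> w) xs \<one>\<^bsub>A\<^esub> g = (- 1) ^ length xs * of_bool (g = \<one>)] (mod int p)"
    and "foldr (\<lambda>y w. \<Delta> y \<otimes>\<^bsub>A\<^esub> w) xs \<one>\<^bsub>A\<^esub> \<in> A.ideal_power augmentation_ideal (length xs)"
proof -
  let ?W = "\<lambda>xs. foldr (\<lambda>y w. \<Delta> y \<otimes>\<^bsub>A\<^esub> w) xs \<one>\<^bsub>A\<^esub>"
  have pow: "?W xs \<in> A.ideal_power augmentation_ideal (length xs)" if "set xs \<subseteq> carrier G" for xs
    using that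
  proof (induction xs)
    case (Cons y ys)
    then show ?case
      using ideal_prod.prod[OF delta_minus_one_augI, of y "?W ys"] 
        A.ideal_power_Suc2[OF augI_ideal, of "length ys"] by auto
  qed simp
  then show "?W xs \<in> A.ideal_power augmentation_ideal (length xs)" using assms by blast
  show "[?W xs g = (- 1) ^ length xs * of_bool (g = \<one>)] (mod int p)"
    using assms
  proof (induction xs arbitrary: g)
    case Nil
    then show ?case by (simp add: one_A mod_p_apply cong_def)
  next
    case (Cons y ys)
    have y: "y \<in> carrier G" "set ys \<subseteq> carrier G" using Cons.prems by auto
    have W: "?W ys \<in> carrier A"
      by (rule A.ideal_power_closed[OF augI_ideal pow[OF y(2)]])
    have *: "inv y \<otimes> g \<notin> ordered_products G ys" "g \<notin> ordered_products G ys" "g \<noteq> y"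
    proof -
      show "inv y \<otimes> g \<notin> ordered_products G ys"
      proof
        assume "inv y \<otimes> g \<in> ordered_products G ys"
        then have "y \<otimes> (inv y \<otimes> g) \<in> ordered_products G (y # ys)"
          using ordered_products_Cons(2)[of y ys] by blast
        then show False using Cons.prems y by (simp add: m_assoc[symmetric])
      qed
      show "g \<notin> ordered_products G ys" "g \<noteq> y"
        using Cons.prems y ordered_products_Cons(1,3)[of ] by blast+
    qed
    have "\<Delta> y \<otimes>\<^bsub>A\<^esub> ?W ys = \<delta> y \<otimes>\<^bsub>A\<^esub> ?W ys \<ominus>\<^bsub>A\<^esub> ?W ys"
      using W by (simp add: A.minus_eq A.l_distr A.l_minus)
    also have "\<dots> = mod_p (\<lambda>g. ?W ys (inv y \<otimes> g)) \<ominus>\<^bsub>A\<^esub> mod_p (?W ys)"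
      using W y by (simp add: delta_mult_left)
    also have "\<dots> = mod_p (\<lambda>g. ?W ys (inv y \<otimes> g) - ?W ys g)"
      by (rule minus_mod_p)
    finally have "[?W (y # ys) g = ?W ys (inv y \<otimes> g) - ?W ys g] (mod int p)"
      using Cons.prems by (simp add: mod_p_apply cong_def)
    also have "[?W ys (inv y \<otimes> g) - ?W ys g = 0 - (- 1) ^ length ys * of_bool (g = \<one>)] (mod int p)"
    proof (rule cong_diff)
      have "inv y \<otimes> g \<noteq> \<one>"
        using *(3) y Cons.prems inv_solve_left[of \<one> y g] by auto
      then show "[?W ys (inv y \<otimes> g) = 0] (mod int p)"
        using Cons.IH[of "inv y \<otimes> g"] y Cons.prems *(1) by simp
      show "[?W ys g = (- 1) ^ length ys * of_bool (g = \<one>)] (mod int p)"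
        using Cons.IH[of g] y Cons.prems *(2) by simp
    qed
    finally show ?case by simp
  qed
qed

lemma ordered_davenport_le_nilpotency_index:
  assumes "A.ideal_power augmentation_ideal m = {\<zero>\<^bsub>A\<^esub>}"
  shows "ordered_davenport_le G m"
  unfolding ordered_davenport_le_def
proof (intro allI impI, rule ccontr)
  fix xs assume xs: "set xs \<subseteq> carrier G \<and> m \<le> length xs" and *: "\<one> \<notin> ordered_products G xs"
  let ?w = "foldr (\<lambda>y w. \<Delta> y \<otimes>\<^bsub>A\<^esub> w) xs \<one>\<^bsub>A\<^esub>"
  have "?w \<in> A.ideal_power augmentation_ideal m"
    using Delta_product_coefficient(2)[of xs \<one>] xs * A.ideal_power_antimono[OF augI_ideal] by blast
  then have "?w = \<zero>\<^bsub>A\<^esub>" using assms by simp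
  then have "?w \<one> = 0" by (simp add: zero_A mod_p_apply)
  then have "[0 = (- 1 :: int) ^ length xs] (mod int p)"
    using Delta_product_coefficient(1)[of xs \<one>] xs * by simp
  then have "int p dvd (- 1) ^ length xs"
    using cong_0_iff cong_sym by blast
  then have "int p dvd 1"
    by (metis dvd_minus_iff minus_one_power_iff)
  then show False using p_gt_1 by simp
qed

text \<open>
  An element of augmentation \<open>c \<noteq> 0\<close> can be scaled to augmentation 1, and then differs from the
  identity by an element of the augmentation ideal.
\<close>

lemma augI_maximal: "maximal_left_ideal augmentation_ideal A"
  unfolding maximal_left_ideal_def
proof (intro conjI allI impI)
  interpret I: ideal augmentation_ideal A by (rule augI_ideal)
  show "left_ideal augmentation_ideal A"
    unfolding left_ideal_def using I.additive_subgroup_axioms I.I_l_closed by blast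
  have "\<one>\<^bsub>A\<^esub> \<notin> augmentation_ideal" by (simp add: augI_iff)
  then show "augmentation_ideal \<noteq> carrier A" using A.one_closed by blast
  fix J assume J: "left_ideal J A \<and> augmentation_ideal \<subseteq> J"
  then interpret J: additive_subgroup J A by (simp add: left_ideal_def)
  show "J = augmentation_ideal \<or> J = carrier A"
  proof (rule disjCI)
    assume "J \<noteq> carrier A"
    show "J = augmentation_ideal"
    proof (rule ccontr)
      assume "J \<noteq> augmentation_ideal"
      then obtain f where f: "f \<in> J" "f \<notin> augmentation_ideal" using J by blast
      have fA: "f \<in> carrier A" using f(1) by (rule J.a_Hcarr)
      then have "augmentation f \<noteq> 0" using f by (simp add: augI_iff)
      then have "\<not> int p dvd augmentation f"
        using aug_range[of f] zdvd_not_zless[of "augmentation f" "int p"] by auto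
      then have "coprime (augmentation f) (int p)"
        using prime_p by (metis coprime_commute prime_imp_coprime prime_nat_int_transfer)
      then obtain c where c: "[augmentation f * c = 1] (mod int p)"
        using cong_solve_coprime_int by blast
      define h where "h = mod_p (\<lambda>g. c * of_bool (g = \<one>)) \<otimes>\<^bsub>A\<^esub> f"
      have hJ: "h \<in> J" using f J unfolding h_def left_ideal_def by simp
      have "augmentation (mod_p (\<lambda>g. c * of_bool (g = \<one>))) = c mod int p"
        unfolding aug_mod_p using finite_G by (simp add: of_bool_def if_distrib cong: if_cong)
      then have "augmentation h = 1"
        using c p_gt_1
        by (simp add: h_def aug_mult cong_def mod_mult_left_eq mod_mult_right_eq mult.commute)
      then have "h \<ominus>\<^bsub>A\<^esub> \<one>\<^bsub>A\<^esub> \<in> J"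
        using J hJ p_gt_1 by (auto simp: augI_iff aug_minus)
      then have "h \<ominus>\<^bsub>A\<^esub> (h \<ominus>\<^bsub>A\<^esub> \<one>\<^bsub>A\<^esub>) \<in> J"
        using hJ J.a_closed J.a_inv_closed by (simp add: A.minus_eq)
      moreover have "h \<ominus>\<^bsub>A\<^esub> (h \<ominus>\<^bsub>A\<^esub> \<one>\<^bsub>A\<^esub>) = \<one>\<^bsub>A\<^esub>"
        using hJ by (simp add: A.minus_eq A.minus_add A.a_assoc[symmetric] A.r_neg)
      ultimately have "\<one>\<^bsub>A\<^esub> \<in> J" by simp
      then have "J = carrier A"
        using J J.a_subset unfolding left_ideal_def by (metis A.r_one subsetI subset_antisym)
      then show False using \<open>J \<noteq> carrier A\<close> by blast
    qed
  qed
qed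

text \<open>
  Otherwise \<open>1 = u + i\<close> with \<open>u\<close> in the maximal left ideal \<open>M\<close> and \<open>i\<close> nilpotent. As
  \<open>i\<^sup>k - i\<^sup>k\<^sup>+\<^sup>1 = i\<^sup>k u\<close> lies in \<open>M\<close>, so does every \<open>1 - i\<^sup>k\<close>, and finally the identity.
\<close>

lemma augI_subset_maximal_left_ideal:
  assumes nil: "A.ideal_power augmentation_ideal m = {\<zero>\<^bsub>A\<^esub>}" and M: "maximal_left_ideal M A"
  shows "augmentation_ideal \<subseteq> M"
proof (rule ccontr)
  assume not: "\<not> augmentation_ideal \<subseteq> M"
  interpret I: ideal augmentation_ideal A by (rule augI_ideal)
  from M interpret M: additive_subgroup M A by (simp add: maximal_left_ideal_def left_ideal_def)
  have M_mult: "x \<otimes>\<^bsub>A\<^esub> y \<in> M" if "x \<in> carrier A" "y \<in> M" for x y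
    using M that by (simp add: maximal_left_ideal_def left_ideal_def)
  have sub: "additive_subgroup (M <+>\<^bsub>A\<^esub> augmentation_ideal) A"
    by (rule A.add_additive_subgroups[OF M.additive_subgroup_axioms I.additive_subgroup_axioms])
  have "left_ideal (M <+>\<^bsub>A\<^esub> augmentation_ideal) A"
    unfolding left_ideal_def
  proof (intro conjI sub ballI)
    fix x a assume x: "x \<in> carrier A" and "a \<in> M <+>\<^bsub>A\<^esub> augmentation_ideal"
    then obtain u v where uv: "u \<in> M" "v \<in> augmentation_ideal" "a = u \<oplus>\<^bsub>A\<^esub> v"
      unfolding set_add_def' by auto
    then have "x \<otimes>\<^bsub>A\<^esub> a = x \<otimes>\<^bsub>A\<^esub> u \<oplus>\<^bsub>A\<^esub> x \<otimes>\<^bsub>A\<^esub> v"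
      using x by (simp add: A.r_distr)
    then show "x \<otimes>\<^bsub>A\<^esub> a \<in> M <+>\<^bsub>A\<^esub> augmentation_ideal"
      using M_mult[OF x uv(1)] I.I_l_closed[OF uv(2) x] unfolding set_add_def' by auto
  qed
  moreover have "M \<subseteq> M <+>\<^bsub>A\<^esub> augmentation_ideal"
  proof
    fix u assume "u \<in> M"
    then have "u \<oplus>\<^bsub>A\<^esub> \<zero>\<^bsub>A\<^esub> \<in> M <+>\<^bsub>A\<^esub> augmentation_ideal"
      using I.zero_closed unfolding set_add_def' by blast
    then show "u \<in> M <+>\<^bsub>A\<^esub> augmentation_ideal"
      using \<open>u \<in> M\<close> by simp
  qed
  moreover have "M <+>\<^bsub>A\<^esub> augmentation_ideal \<noteq> M"
  proof
    assume eq: "M <+>\<^bsub>A\<^esub> augmentation_ideal = M"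
    have "v \<in> M" if "v \<in> augmentation_ideal" for v
    proof -
      have "\<zero>\<^bsub>A\<^esub> \<oplus>\<^bsub>A\<^esub> v \<in> M <+>\<^bsub>A\<^esub> augmentation_ideal"
        using that M.zero_closed unfolding set_add_def' by blast
      then show ?thesis using eq that by simp
    qed
    then show False using not by blast
  qed
  ultimately have "M <+>\<^bsub>A\<^esub> augmentation_ideal = carrier A"
    using M unfolding maximal_left_ideal_def by blast
  then have "\<one>\<^bsub>A\<^esub> \<in> M <+>\<^bsub>A\<^esub> augmentation_ideal" by simp
  then obtain u i where ui: "u \<in> M" "i \<in> augmentation_ideal" "\<one>\<^bsub>A\<^esub> = u \<oplus>\<^bsub>A\<^esub> i"
    unfolding set_add_def' by blast
  have u: "u = \<one>\<^bsub>A\<^esub> \<ominus>\<^bsub>A\<^esub> i"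
    unfolding ui(3) using ui by (simp add: A.minus_eq A.a_assoc A.r_neg)
  have "\<one>\<^bsub>A\<^esub> \<ominus>\<^bsub>A\<^esub> i [^]\<^bsub>A\<^esub> k \<in> M" for k :: nat
  proof (induction k)
    case 0
    show ?case by (simp add: A.minus_eq A.r_neg)
  next
    case (Suc k)
    have "i [^]\<^bsub>A\<^esub> k \<otimes>\<^bsub>A\<^esub> u \<in> M" using ui by (intro M_mult) simp_all
    then have "(\<one>\<^bsub>A\<^esub> \<ominus>\<^bsub>A\<^esub> i [^]\<^bsub>A\<^esub> k) \<oplus>\<^bsub>A\<^esub> i [^]\<^bsub>A\<^esub> k \<otimes>\<^bsub>A\<^esub> u \<in> M"
      using Suc by simp
    moreover have "(\<one>\<^bsub>A\<^esub> \<ominus>\<^bsub>A\<^esub> i [^]\<^bsub>A\<^esub> k) \<oplus>\<^bsub>A\<^esub> i [^]\<^bsub>A\<^esub> k \<otimes>\<^bsub>A\<^esub> u = \<one>\<^bsub>A\<^esub> \<ominus>\<^bsub>A\<^esub> i [^]\<^bsub>A\<^esub> Suc k"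
    proof -
      have i: "i [^]\<^bsub>A\<^esub> k \<in> carrier A" "i \<in> carrier A" using ui by simp_all
      then have "i [^]\<^bsub>A\<^esub> k \<otimes>\<^bsub>A\<^esub> u = i [^]\<^bsub>A\<^esub> k \<ominus>\<^bsub>A\<^esub> i [^]\<^bsub>A\<^esub> Suc k"
        unfolding u by (simp add: A.minus_eq A.r_distr A.r_minus)
      then show ?thesis
        using i by (simp add: A.minus_eq A.a_assoc) (simp add: A.a_assoc[symmetric] A.l_neg)
    qed
    ultimately show ?case by simp
  qed
  moreover have "i [^]\<^bsub>A\<^esub> m = \<zero>\<^bsub>A\<^esub>"
    using A.ideal_power_nat_pow[OF augI_ideal ui(2), of m] nil by simp
  ultimately have "\<one>\<^bsub>A\<^esub> \<in> M"
    by (metis A.minus_eq A.minus_zero A.one_closed A.r_zero)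
  then have "M = carrier A"
    using M_mult M.a_subset by (metis A.r_one subsetI subset_antisym)
  then show False using M by (simp add: maximal_left_ideal_def)
qed

lemma jacobson_radical_eq_augI:
  assumes "A.ideal_power augmentation_ideal m = {\<zero>\<^bsub>A\<^esub>}"
  shows "jacobson_radical A = augmentation_ideal"
  unfolding jacobson_radical_def
  using augI_maximal augI_subset_maximal_left_ideal[OF assms] augI_iff by blast

lemma loewy_length_bounds:
  assumes m: "A.ideal_power augmentation_ideal m = {\<zero>\<^bsub>A\<^esub>}" "m \<ge> 1"
  shows "loewy_length p G \<le> enat m" "ordered_davenport G \<le> loewy_length p G"
proof -
  have L: "loewy_length p G =
      (INF n \<in> {n::nat. n \<ge> 1 \<and> A.ideal_power augmentation_ideal n = {\<zero>\<^bsub>A\<^esub>}}. enat n)"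
    unfolding loewy_length_def Let_def jacobson_radical_eq_augI[OF m(1)] ..
  show "loewy_length p G \<le> enat m"
    unfolding L using m by (intro INF_lower) simp
  show "ordered_davenport G \<le> loewy_length p G"
    unfolding L
  proof (rule INF_greatest)
    fix n assume "n \<in> {n. 1 \<le> n \<and> A.ideal_power augmentation_ideal n = {\<zero>\<^bsub>A\<^esub>}}"
    then have "ordered_davenport_le G n"
      using ordered_davenport_le_nilpotency_index by blast
    then show "ordered_davenport G \<le> enat n"
      unfolding ordered_davenport_def ordered_davenport_le_def by (intro INF_lower) simp
  qed
qed

end

section \<open>Product-one subsequences from subgroups and quotients\<close>

lemma unordered_davenport_le_mono:
  "unordered_davenport_le G k \<Longrightarrow> k \<le> l \<Longrightarrow> unordered_davenport_le G l"
  unfolding unordered_davenport_le_def by (meson order_trans)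

lemma list_product_carrier_update [simp]: "list_product (G\<lparr>carrier := N\<rparr>) xs = list_product G xs"
  by (simp add: list_product_def)

lemma sub_mset_map_lift:
  assumes "mset zs \<subseteq># mset (map f xs)"
  shows "\<exists>ys. mset ys \<subseteq># mset xs \<and> map f ys = zs"
  using assms
proof (induction zs arbitrary: xs)
  case Nil
  then show ?case by (intro exI[of _ "[]"]) simp
next
  case (Cons z zs)
  from Cons.prems have "z \<in># mset (map f xs)"
    by (auto dest: mset_subset_eqD)
  then obtain x where x: "x \<in> set xs" "f x = z" by auto
  obtain M where "mset xs = add_mset x M"
    using x(1) multi_member_split[of x "mset xs"] by auto
  moreover obtain ws where "mset ws = M" using ex_mset by blast
  ultimately have eq: "mset xs = add_mset x (mset ws)" by simp
  then have "image_mset f (mset xs) = image_mset f (add_mset x (mset ws))"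
    by (rule arg_cong)
  then have "mset (map f xs) = add_mset z (mset (map f ws))"
    unfolding mset_map image_mset_add_mset x(2) .
  then have "mset zs \<subseteq># mset (map f ws)"
    using Cons.prems by (metis mset.simps(2) mset_subset_eq_add_mset_cancel)
  then obtain ys where "mset ys \<subseteq># mset ws" "map f ys = zs"
    using Cons.IH by blast
  then show ?case
    using x eq by (intro exI[of _ "x # ys"]) simp
qed

lemma mset_concat_mono:
  assumes "mset yss \<subseteq># mset xss"
  shows "mset (concat yss) \<subseteq># mset (concat xss)"
proof -
  obtain M where "mset xss = mset yss + M" using assms by (metis mset_subset_eq_exists_conv)
  then have "mset (concat xss) = mset (concat yss) + \<Sum>\<^sub># (image_mset mset M)"
    by (simp add: mset_concat flip: sum_mset_sum_list)
  then show ?thesis by simp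
qed

context group
begin

lemma list_product_concat:
  "\<forall>ys\<in>set yss. set ys \<subseteq> carrier G \<Longrightarrow>
    list_product G (concat yss) = list_product G (map (list_product G) yss)"
proof (induction yss)
  case (Cons ys yss)
  have "set (concat yss) \<subseteq> carrier G" using Cons.prems by auto
  then show ?case using Cons by (simp add: list_product_append)
qed simp

text \<open>
  Pigeonhole on the products of the prefixes: two equal ones enclose a block with product one.
\<close>

lemma unordered_davenport_le_order:
  assumes fin: "finite (carrier G)"
  shows "unordered_davenport_le G (order G)"
  unfolding unordered_davenport_le_def
proof (intro allI impI)
  fix xs assume xs: "set xs \<subseteq> carrier G \<and> order G \<le> length xs"
  have sub: "set (take i xs) \<subseteq> carrier G" "set (drop i xs) \<subseteq> carrier G" for i
    using xs set_take_subset[of i xs] set_drop_subset[of i xs] by auto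
  let ?f = "\<lambda>i. list_product G (take i xs)"
  have img: "?f ` {..length xs} \<subseteq> carrier G" using sub by auto
  have "\<not> inj_on ?f {..length xs}"
  proof
    assume "inj_on ?f {..length xs}"
    then have "card {..length xs} \<le> order G"
      unfolding order_def by (rule card_inj_on_le[OF _ img fin])
    then show False using xs by simp
  qed
  then obtain i j where ij: "i < j" "j \<le> length xs" "?f i = ?f j"
    unfolding inj_on_def by (metis atMost_iff linorder_neqE_nat)
  let ?ys = "drop i (take j xs)"
  have split: "take j xs = take i xs @ ?ys"
    using ij by (metis append_take_drop_id min.absorb3 take_take)
  have ys: "set ?ys \<subseteq> carrier G" using sub(1)[of j] set_drop_subset[of i "take j xs"] by blast
  have "?f j = ?f i \<otimes> list_product G ?ys"
    by (subst split) (rule list_product_append[OF sub(1) ys])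
  then have "list_product G ?ys = \<one>"
    using ij(3) l_cancel_one sub(1) ys by (metis list_product_closed)
  moreover have "?ys \<noteq> []" using ij by simp
  moreover have "mset ?ys \<subseteq># mset xs"
  proof -
    have "mset xs = mset (take i xs) + mset ?ys + mset (drop j xs)"
      by (metis append_take_drop_id mset_append split)
    then show ?thesis by simp
  qed
  ultimately show "\<exists>ys. ys \<noteq> [] \<and> mset ys \<subseteq># mset xs \<and> list_product G ys = \<one>" by blast
qed

text \<open>
  Disjoint pieces of length at most \<open>m\<close> with product in \<open>N\<close> are removed one after the other, which
  is possible as long as \<open>e\<close> terms are left, so \<open>m(d - 1) + e\<close> terms yield \<open>d\<close> pieces. Some of their
  products multiply to the identity in a suitable order, and the pieces are concatenated in that
  order.
\<close>

lemma unordered_davenport_extension: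
  assumes N: "N \<subseteq> carrier G"
    and short: "\<And>xs. set xs \<subseteq> carrier G \<Longrightarrow> length xs = e \<Longrightarrow>
      \<exists>ys. ys \<noteq> [] \<and> mset ys \<subseteq># mset xs \<and> length ys \<le> m \<and> list_product G ys \<in> N"
    and me: "m \<le> e" and d: "unordered_davenport_le (G\<lparr>carrier := N\<rparr>) d"
  shows "unordered_davenport_le G (m * d + (e - m))"
  unfolding unordered_davenport_le_def
proof (intro allI impI)
  have blocks: "\<exists>yss. length yss = j \<and> (\<forall>ys\<in>set yss. ys \<noteq> [] \<and> list_product G ys \<in> N)
      \<and> mset (concat yss) \<subseteq># mset xs"
    if "set xs \<subseteq> carrier G" "m * j + (e - m) \<le> length xs" for j xs
    using that
  proof (induction j arbitrary: xs)
    case 0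
    then show ?case by (intro exI[of _ "[]"]) simp
  next
    case (Suc j)
    have len: "length (take e xs) = e" using Suc.prems me by simp
    have "set (take e xs) \<subseteq> carrier G" using Suc.prems set_take_subset[of e xs] by blast
    then obtain ys where ys: "ys \<noteq> []" "mset ys \<subseteq># mset (take e xs)" "length ys \<le> m"
      "list_product G ys \<in> N" using short len by blast
    have "mset (take e xs) \<subseteq># mset xs"
      by (metis append_take_drop_id mset_append mset_subset_eq_add_left)
    then have yx: "mset ys \<subseteq># mset xs" using ys(2) by (rule subset_mset.order_trans[rotated])
    obtain zs where zs: "mset zs = mset xs - mset ys" using ex_mset by blast
    have eq: "mset xs = mset ys + mset zs" using yx zs by simp
    then have "length xs = length ys + length zs" by (metis size_mset size_union)
    then have "m * j + (e - m) \<le> length zs" using Suc.prems ys(3) by simp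
    moreover have "set zs \<subseteq> carrier G"
      using eq Suc.prems by (metis UnCI set_mset_mset set_mset_union subset_iff)
    ultimately obtain yss where yss: "length yss = j"
      "\<forall>ys\<in>set yss. ys \<noteq> [] \<and> list_product G ys \<in> N" "mset (concat yss) \<subseteq># mset zs"
      using Suc.IH by blast
    then show ?case
      using ys eq by (intro exI[of _ "ys # yss"]) simp
  qed
  fix xs assume xs: "set xs \<subseteq> carrier G \<and> m * d + (e - m) \<le> length xs"
  then obtain yss where yss: "length yss = d"
    "\<forall>ys\<in>set yss. ys \<noteq> [] \<and> list_product G ys \<in> N" "mset (concat yss) \<subseteq># mset xs"
    using blocks by blast
  from d have d': "\<exists>zs. zs \<noteq> [] \<and> mset zs \<subseteq># mset xs \<and> list_product G zs = \<one>"
    if "set xs \<subseteq> N" "d \<le> length xs" for xs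
    using that by (simp add: unordered_davenport_le_def)
  obtain zs where zs: "zs \<noteq> []" "mset zs \<subseteq># mset (map (list_product G) yss)"
    "list_product G zs = \<one>"
    using d'[of "map (list_product G) yss"] yss by auto
  then obtain tss where tss: "mset tss \<subseteq># mset yss" "map (list_product G) tss = zs"
    using sub_mset_map_lift by blast
  have sub: "mset (concat tss) \<subseteq># mset xs"
    using mset_concat_mono[OF tss(1)] yss(3) by (rule subset_mset.order_trans)
  then have "set (concat tss) \<subseteq> carrier G"
    using xs by (metis mset_subset_eqD set_mset_mset subset_iff)
  then have "list_product G (concat tss) = \<one>"
    using list_product_concat[of tss] tss zs by auto
  moreover have "concat tss \<noteq> []"
  proof -
    obtain ts where "ts \<in> set tss" using tss(2) zs(1) by (cases tss) auto
    then have "ts \<in> set yss" using tss(1) by (metis mset_subset_eqD set_mset_mset)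
    then show ?thesis using yss(2) \<open>ts \<in> set tss\<close> by auto
  qed
  ultimately show "\<exists>ys. ys \<noteq> [] \<and> mset ys \<subseteq># mset xs \<and> list_product G ys = \<one>"
    using sub by blast
qed

lemma list_product_cosets:
  assumes "N \<lhd> G" "set ys \<subseteq> carrier G"
  shows "list_product (G Mod N) (map (\<lambda>g. N #> g) ys) = N #> list_product G ys"
proof -
  interpret normal N G by fact
  show ?thesis using assms(2)
    by (induction ys) (simp_all add: rcos_sum subset)
qed

lemma quotient_davenport_extension:
  assumes N: "N \<lhd> G" and m: "ordered_davenport_le (G Mod N) m"
    and d: "unordered_davenport_le (G\<lparr>carrier := N\<rparr>) d"
  shows "unordered_davenport_le G (m * d)"
proof -
  interpret normal N G by fact
  have "\<exists>ys. ys \<noteq> [] \<and> mset ys \<subseteq># mset xs \<and> length ys \<le> m \<and> list_product G ys \<in> N"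
    if xs: "set xs \<subseteq> carrier G" "length xs = m" for xs
  proof -
    let ?f = "\<lambda>g. N #> g"
    have "set (map ?f xs) \<subseteq> carrier (G Mod N)" using xs by (auto simp: carrier_FactGroup)
    then have "\<one>\<^bsub>G Mod N\<^esub> \<in> ordered_products (G Mod N) (map ?f xs)"
      using m xs unfolding ordered_davenport_le_def by simp
    then obtain zs where zs: "subseq zs (map ?f xs)" "length zs \<ge> 1" "list_product (G Mod N) zs = N"
      unfolding ordered_products_def by auto
    then obtain I where "zs = nths (map ?f xs) I" by (metis subseq_conv_nths)
    then have z: "zs = map ?f (nths xs I)" by (simp add: nths_map)
    define ys where "ys = nths xs I"
    have sub: "subseq ys xs" unfolding ys_def subseq_conv_nths by blast
    have ysc: "set ys \<subseteq> carrier G" using xs set_nths_subset[of xs I] by (auto simp: ys_def)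
    have "mset ys \<subseteq># mset xs"
      by (rule subseq_imp_subset_mset[OF sub])
    moreover have "N #> list_product G ys = N"
      using zs(3) z list_product_cosets[OF N ysc] by (simp add: ys_def)
    then have "list_product G ys \<in> N"
      using coset_join1[OF _ _ subgroup_axioms] ysc by simp
    ultimately show ?thesis
      using zs(2) z list_emb_length[OF sub] xs by (intro exI[of _ ys]) (auto simp: ys_def)
  qed
  from unordered_davenport_extension[OF subset this order_refl d] show ?thesis by simp
qed

end

section \<open>Maximal subgroups of finite p-groups\<close>

text \<open>
  Orbits of a group of prime power order other than fixed points have length divisible by \<open>p\<close>, so
  the number of fixed points is divisible by \<open>p\<close> as well and cannot be one.
\<close>

lemma prime_power_action_second_fixed_point:
  assumes "group_action G E \<phi>" and fin: "finite E" and "prime p" and order: "order G = p ^ k"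
    and dvd: "p dvd card E" and x: "x \<in> E" and fix_x: "\<And>g. g \<in> carrier G \<Longrightarrow> \<phi> g x = x"
  shows "\<exists>y\<in>E. y \<noteq> x \<and> (\<forall>g\<in>carrier G. \<phi> g y = y)"
proof (rule ccontr)
  assume no: "\<not> ?thesis"
  interpret group_action G E \<phi> by fact
  have grp: "group G" by (rule group_hom.axioms(1)[OF group_hom])
  have orb_x: "orbit G \<phi> x = {x}"
    unfolding orbit_def using fix_x monoid.one_closed[OF group.is_monoid[OF grp]]
    by (auto intro!: exI[of _ "\<one>\<^bsub>G\<^esub>"])
  have fin_orbs: "finite (orbits G E \<phi>)"
    unfolding orbits_def using fin by simp
  have x_orb: "{x} \<in> orbits G E \<phi>"
    unfolding orbits_def using x orb_x by blast
  have "p dvd card B" if B: "B \<in> orbits G E \<phi> - {{x}}" for B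
  proof -
    obtain y where y: "y \<in> E" "B = orbit G \<phi> y" using B unfolding orbits_def by blast
    have "card B dvd p ^ k"
      using orbit_stabilizer_theorem[OF y(1)] y(2) order by (metis dvd_triv_left)
    then obtain i where i: "card B = p ^ i"
      using divides_primepow_nat \<open>prime p\<close> by blast
    have yO: "y \<in> B" using orbit_refl y by blast
    have "i \<noteq> 0"
    proof
      assume "i = 0"
      then have "B = {y}" using i yO card_1_singletonE by (metis One_nat_def power_0 singletonD)
      then have "\<forall>g\<in>carrier G. \<phi> g y = y" using y(2) unfolding orbit_def by blast
      then have "y = x" using no y by blast
      then show False using B \<open>B = {y}\<close> by blast
    qed
    then show ?thesis using i by simp
  qed
  then have "p dvd (\<Sum>B\<in>orbits G E \<phi> - {{x}}. card B)"
    by (rule dvd_sum)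
  moreover have "card E = 1 + (\<Sum>B\<in>orbits G E \<phi> - {{x}}. card B)"
  proof -
    have "card E = (\<Sum>B\<in>orbits G E \<phi>. card B)"
      unfolding card_eq_sum by (rule disjoint_sum[OF fin, symmetric])
    then show ?thesis using sum.remove[OF fin_orbs x_orb, of card] by simp
  qed
  ultimately have "p dvd 1" using dvd by (metis dvd_add_left_iff)
  then show False using \<open>prime p\<close> not_prime_unit by blast
qed

locale finite_p_group = modular_group_algebra +
  fixes n :: nat
  assumes order_eq: "order G = p ^ n"
begin

lemma card_subgroup:
  assumes "subgroup H G"
  obtains k where "k \<le> n" "card H = p ^ k"
proof -
  have "card H dvd p ^ n" using lagrange[OF assms] order_eq by (metis dvd_triv_right)
  then show ?thesis using that divides_primepow_nat prime_p by blast
qed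

lemma subgroup_finite: "subgroup H G \<Longrightarrow> finite H"
  by (rule finite_subset[OF subgroup.subset finite_G])

lemma card_subgroup_strict:
  assumes "subgroup H G" "subgroup K G" "H \<subset> K"
  shows "p * card H \<le> card K"
proof -
  obtain k where k: "card H = p ^ k" by (rule card_subgroup[OF assms(1)])
  obtain l where l: "card K = p ^ l" by (rule card_subgroup[OF assms(2)])
  have "card H < card K" by (rule psubset_card_mono[OF subgroup_finite[OF assms(2)] assms(3)])
  then have "k < l" unfolding k l using p_gt_1 by (rule power_less_imp_less_exp[rotated])
  then have "p ^ Suc k \<le> p ^ l" using p_gt_1 by (intro power_increasing) auto
  then show ?thesis using k l by simp
qed

lemma subgroup_card_eq_order:
  assumes "subgroup H G" "card H = order G"
  shows "H = carrier G"
  using card_subset_eq[OF finite_G subgroup.subset[OF assms(1)]] assms(2) by (simp add: order_def)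

text \<open>
  The subgroup \<open>H\<close> acts on its right cosets by right translation and fixes the coset \<open>H\<close>. The
  number of cosets is divisible by \<open>p\<close>, so it fixes another coset \<open>Hg\<close>, which says that \<open>g\<close>
  normalizes \<open>H\<close>.
\<close>

lemma normalizer_grows:
  assumes H: "subgroup H G" and ne: "H \<noteq> carrier G"
  shows "\<exists>g\<in>carrier G - H. \<forall>h\<in>H. g \<otimes> h \<otimes> inv g \<in> H"
proof -
  interpret H: subgroup H G by fact
  let ?E = "rcosets H"
  let ?GH = "G\<lparr>carrier := H\<rparr>"
  define \<phi> where "\<phi> h = (\<lambda>C\<in>?E. C #> inv h)" for h
  have GH: "group ?GH" by (rule subgroup_imp_group[OF H])
  have coset: "C #> g \<in> ?E" if "C \<in> ?E" "g \<in> carrier G" for C g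
    using that by (auto simp: RCOSETS_def coset_mult_assoc H.subset)
  have cancel: "(C #> g) #> inv g = C" "(C #> inv g) #> g = C" if "C \<in> ?E" "g \<in> carrier G" for C g
    using that H.rcosets_carrier[OF group_axioms that(1)] by (simp_all add: coset_mult_assoc)
  have bij: "\<phi> h \<in> Bij ?E" if "h \<in> H" for h
  proof -
    have h: "h \<in> carrier G" using that by simp
    have "bij_betw (\<phi> h) ?E ?E"
      by (rule bij_betw_byWitness[where f' = "\<lambda>C. C #> h"])
        (use h coset cancel in \<open>auto simp: \<phi>_def\<close>)
    then show ?thesis by (simp add: Bij_def \<phi>_def)
  qed
  have action: "group_action ?GH ?E \<phi>"
    unfolding group_action_def
  proof (rule group_hom.intro[OF GH group_BijGroup], unfold group_hom_axioms_def, rule homI)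
    show "\<phi> h \<in> carrier (BijGroup ?E)" if "h \<in> carrier ?GH" for h
      using that bij by (simp add: BijGroup_def)
    fix g h assume "g \<in> carrier ?GH" "h \<in> carrier ?GH"
    then have gh: "g \<in> H" "h \<in> H" "g \<in> carrier G" "h \<in> carrier G" by simp_all
    have "\<phi> (g \<otimes> h) = compose ?E (\<phi> g) (\<phi> h)"
      using gh coset H.rcosets_carrier[OF group_axioms]
      by (auto simp: compose_def \<phi>_def inv_mult_group coset_mult_assoc intro!: restrict_ext)
    then show "\<phi> (g \<otimes>\<^bsub>?GH\<^esub> h) = \<phi> g \<otimes>\<^bsub>BijGroup ?E\<^esub> \<phi> h"
      using gh bij by (simp add: BijGroup_def)
  qed
  obtain k where k: "k \<le> n" "card H = p ^ k" using card_subgroup[OF H] .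
  have "k \<noteq> n" using ne subgroup_card_eq_order[OF H] k order_eq by auto
  then have "k < n" using k by simp
  have "card ?E * p ^ k = p ^ (n - k) * p ^ k"
    using lagrange[OF H] k order_eq by (simp add: power_add[symmetric])
  then have "card ?E = p ^ (n - k)" using p_gt_1 by simp
  then have dvd: "p dvd card ?E" using \<open>k < n\<close> by simp
  have HE: "H \<in> ?E" by (rule H.subgroup_in_rcosets[OF group_axioms])
  have fixH: "\<phi> h H = H" if "h \<in> carrier ?GH" for h
    using that HE by (simp add: \<phi>_def coset_join2 H)
  have "finite ?E" using \<open>card ?E = p ^ (n - k)\<close> p_gt_1 by (intro card_ge_0_finite) simp
  from prime_power_action_second_fixed_point[OF action this prime_p _ dvd HE fixH, of k]
  obtain C where C: "C \<in> ?E" "C \<noteq> H" "\<And>h. h \<in> H \<Longrightarrow> \<phi> h C = C"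
    using k by (auto simp: order_def)
  obtain g where g: "g \<in> carrier G" "C = H #> g" using C(1) by (auto simp: RCOSETS_def)
  have "g \<notin> H" using C(2) g coset_join2[OF _ H] by blast
  moreover have "g \<otimes> h \<otimes> inv g \<in> H" if h: "h \<in> H" for h
  proof -
    have h': "inv h \<in> H" "inv (inv h) = h" using h by simp_all
    have "C #> inv (inv h) = C" using C(3)[OF h'(1)] C(1) by (simp add: \<phi>_def)
    then have "H #> (g \<otimes> h) = H #> g"
      using g h H.mem_carrier by (simp add: coset_mult_assoc H.subset)
    then have "g \<otimes> h \<in> H #> g"
      using rcos_self[OF _ H, of "g \<otimes> h"] g h by simp
    then show ?thesis
      using g h H.rcos_module_imp[OF group_axioms] by (metis H.mem_carrier)
  qed
  ultimately show ?thesis using g by blast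
qed

text \<open>
  A maximal proper subgroup \<open>M\<close> above \<open>H\<close> is normal because its normalizer is strictly larger. By
  Sylow the quotient has a subgroup of order \<open>p\<close>; its preimage is strictly larger than \<open>M\<close>, hence
  everything.
\<close>

lemma maximal_subgroup:
  assumes H: "subgroup H G" and ne: "H \<noteq> carrier G"
  obtains M where "H \<subseteq> M" "M \<lhd> G" "card M * p = order G"
proof -
  let ?S = "{M. subgroup M G \<and> H \<subseteq> M \<and> M \<noteq> carrier G}"
  have "finite ?S" using finite_G by (rule_tac finite_subset[of _ "Pow (carrier G)"])
      (auto dest: subgroup.subset)
  moreover have "?S \<noteq> {}" using H ne by blast
  ultimately obtain M where M: "M \<in> ?S" "\<forall>K\<in>?S. M \<subseteq> K \<longrightarrow> M = K"
    using finite_has_maximal[of ?S] by meson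
  have max: "K = carrier G" if "subgroup K G" "M \<subset> K" for K
    using M that by blast
  interpret M: subgroup M G using M by blast
  define K where "K = {g \<in> carrier G. (\<forall>h\<in>M. g \<otimes> h \<otimes> inv g \<in> M)}"
  have K_mult: "x \<otimes> y \<in> K" if "x \<in> K" "y \<in> K" for x y
  proof -
    have "x \<otimes> y \<otimes> h \<otimes> inv (x \<otimes> y) = x \<otimes> (y \<otimes> h \<otimes> inv y) \<otimes> inv x" if "h \<in> M" for h
      using that \<open>x \<in> K\<close> \<open>y \<in> K\<close> by (simp add: K_def inv_mult_group m_assoc)
    then show ?thesis using that by (simp add: K_def)
  qed
  have K_pow: "x [^] (i::nat) \<in> K" if "x \<in> K" for x i
  proof (induction i)
    case 0
    show ?case by (auto simp: K_def)
  next
    case (Suc i)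
    then show ?case using K_mult that by simp
  qed
  have "subgroup K G"
  proof (rule subgroupI)
    show "K \<noteq> {}" using K_pow[of "\<one>" 0] by (auto simp: K_def)
    fix x assume x: "x \<in> K"
    then have xc: "x \<in> carrier G" by (simp add: K_def)
    have "Suc (order G - 1) = order G"
      using order_eq p_gt_1 by simp
    then have "x [^] (order G - 1) \<otimes> x = \<one>"
      using pow_order_eq_1[OF xc] by (metis nat_pow_Suc)
    \<comment> \<open>The inverse is a positive power, so closure of \<open>K\<close> under products is enough.\<close>
    then have "inv x = x [^] (order G - 1)"
      using xc by (intro inv_equality) auto
    then show "inv x \<in> K" using K_pow[OF x] by simp
  qed (use K_mult in \<open>auto simp: K_def\<close>)
  moreover have "M \<subset> K"
  proof -
    have "M \<subseteq> K" by (auto simp: K_def)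
    moreover obtain g where "g \<in> carrier G - M" "\<forall>h\<in>M. g \<otimes> h \<otimes> inv g \<in> M"
      using normalizer_grows[OF M.subgroup_axioms] M by blast
    then have "g \<in> K" "g \<notin> M" by (auto simp: K_def)
    ultimately show ?thesis by blast
  qed
  ultimately have "K = carrier G" using max by blast
  then have normal: "M \<lhd> G"
    using M.subgroup_axioms by (intro normal_invI) (auto simp: K_def)
  interpret M: normal M G by fact
  interpret Q: group "G Mod M" by (rule M.factorgroup_is_group)
  have oQ: "order (G Mod M) = card (rcosets M)" by (simp add: order_def FactGroup_def)
  obtain k where k: "k \<le> n" "card M = p ^ k" using card_subgroup[OF M.subgroup_axioms] .
  have "k \<noteq> n" using M subgroup_card_eq_order[OF M.subgroup_axioms] k order_eq by auto
  then have "k < n" using k by simp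
  have "card (rcosets M) * p ^ k = (p ^ 1 * p ^ (n - k - 1)) * p ^ k"
    using lagrange[OF M.subgroup_axioms] k order_eq \<open>k < n\<close>
    by (simp add: power_add[symmetric] power_Suc[symmetric] del: power_Suc)
  then have cQ: "card (rcosets M) = p ^ 1 * p ^ (n - k - 1)" using p_gt_1 by simp
  have "finite (carrier (G Mod M))"
    using finite_G by (simp add: carrier_FactGroup)
  then obtain L where L: "subgroup L (G Mod M)" "card L = p ^ 1"
    using sylow_thm[OF prime_p Q.group_axioms] cQ oQ by metis
  interpret L: subgroup L "G Mod M" by fact
  define P where "P = {g \<in> carrier G. M #> g \<in> L}"
  have P: "subgroup P G"
  proof (rule subgroupI)
    show "P \<noteq> {}"
      using L.one_closed by (auto simp: P_def M.subset intro!: exI[of _ \<one>])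
    fix x assume x: "x \<in> P"
    then have "M #> inv x = inv\<^bsub>G Mod M\<^esub> (M #> x)"
      by (simp add: P_def M.inv_FactGroup M.rcos_inv carrier_FactGroup)
    then show "inv x \<in> P" using x L.m_inv_closed by (simp add: P_def)
  next
    fix x y assume xy: "x \<in> P" "y \<in> P"
    then have "M #> (x \<otimes> y) = (M #> x) \<otimes>\<^bsub>G Mod M\<^esub> (M #> y)"
      by (simp add: P_def M.rcos_sum)
    then show "x \<otimes> y \<in> P" using xy L.m_closed by (simp add: P_def)
  qed (auto simp: P_def)
  have "L \<noteq> {M}" using L(2) p_gt_1 by auto
  then obtain X where X: "X \<in> L" "X \<noteq> M" using L.one_closed by auto
  then obtain g where g: "g \<in> carrier G" "X = M #> g"
    using L.subset by (auto simp: carrier_FactGroup)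
  have "M \<subseteq> P"
    using L.one_closed coset_join2[OF _ M.subgroup_axioms] by (auto simp: P_def)
  moreover have "g \<in> P" "g \<notin> M" using X g coset_join2[OF _ M.subgroup_axioms] by (auto simp: P_def)
  ultimately have "P = carrier G" using max[OF P] by blast
  then have "carrier (G Mod M) \<subseteq> L" by (auto simp: P_def carrier_FactGroup)
  then have "carrier (G Mod M) = L" using L.subset by blast
  then have "card (rcosets M) = p" using L(2) oQ by (simp add: order_def)
  then have "card M * p = order G" using lagrange[OF M.subgroup_axioms] by (simp add: mult.commute)
  then show ?thesis using that normal M by blast
qed

end

lemma (in group) subgroup_nat_pow: "subgroup H G \<Longrightarrow> x \<in> H \<Longrightarrow> x [^] (k::nat) \<in> H"
  by (induction k) (auto simp: subgroup.one_closed subgroup.m_closed)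

context finite_p_group
begin

text \<open>
  The quotient has prime order and is therefore generated by each of its nontrivial elements.
\<close>

lemma normal_index_p:
  assumes M: "M \<lhd> G" and card_M: "card M * p = order G"
  shows "g \<in> carrier G \<Longrightarrow> g [^] p \<in> M"
    and "x \<in> carrier G \<Longrightarrow> y \<in> carrier G \<Longrightarrow> x \<notin> M \<Longrightarrow> \<exists>i<p. \<exists>m\<in>M. y = m \<otimes> x [^] i"
    and "x \<in> carrier G \<Longrightarrow> y \<in> carrier G \<Longrightarrow> inv (y \<otimes> x) \<otimes> (x \<otimes> y) \<in> M"
proof -
  interpret M: normal M G by fact
  interpret Q: group "G Mod M" by (rule M.factorgroup_is_group)
  have "card M \<noteq> 0" using card_M order_eq p_gt_1 by (auto intro: ccontr)
  moreover have "card (rcosets M) * card M = p * card M"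
    using lagrange[OF M.subgroup_axioms] card_M by (simp add: mult.commute)
  ultimately have oQ: "order (G Mod M) = p"
    by (simp add: order_def FactGroup_def)
  have finQ: "finite (carrier (G Mod M))"
    using finite_G by (simp add: carrier_FactGroup)
  have inM: "x \<in> M" if "x \<in> carrier G" "M #> x = M" for x
    using coset_join1[OF that(2,1)] M.subgroup_axioms by blast
  have mem: "M #> g \<in> carrier (G Mod M)" if "g \<in> carrier G" for g
    using that by (simp add: carrier_FactGroup)
  show "g [^] p \<in> M" if "g \<in> carrier G" for g
    using Q.pow_order_eq_1[OF mem[OF that]] that oQ by (intro inM) (simp_all add: M.FactGroup_pow)
  have power: "\<exists>i<p. M #> y = M #> (x [^] i)"
    if x: "x \<in> carrier G" and y: "y \<in> carrier G" and nx: "x \<notin> M" for x y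
  proof -
    have "Q.ord (M #> x) dvd p" using Q.ord_dvd_group_order[OF mem[OF x]] oQ by simp
    moreover have "Q.ord (M #> x) \<noteq> 1"
      using Q.ord_eq_1[OF mem[OF x]] inM x nx by auto
    ultimately have ord: "Q.ord (M #> x) = p"
      using prime_p prime_nat_iff by blast
    have "card (generate (G Mod M) {M #> x}) = card (carrier (G Mod M))"
      using Q.generate_pow_card[OF mem[OF x]] ord oQ by (simp add: order_def)
    then have "generate (G Mod M) {M #> x} = carrier (G Mod M)"
      using Q.generate_incl[of "{M #> x}"] mem[OF x] finQ by (simp add: card_subset_eq)
    then have "M #> y \<in> {(M #> x) [^]\<^bsub>G Mod M\<^esub> k | k. k \<in> (UNIV :: nat set)}"
      using Q.generate_pow_on_finite_carrier[OF finQ mem[OF x]] mem[OF y] by simp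
    then obtain i where "i \<in> {0..p - 1}" "M #> y = (M #> x) [^]\<^bsub>G Mod M\<^esub> i"
      unfolding Q.ord_elems[OF finQ mem[OF x]] ord by blast
    then show ?thesis
      using p_gt_1 x by (intro exI[of _ i]) (auto simp: M.FactGroup_pow)
  qed
  show "\<exists>i<p. \<exists>m\<in>M. y = m \<otimes> x [^] i"
    if x: "x \<in> carrier G" and y: "y \<in> carrier G" and nx: "x \<notin> M" for x y
  proof -
    obtain i where i: "i < p" "M #> y = M #> (x [^] i)" using power[OF x y nx] by blast
    have "y \<in> M #> (x [^] i)" using rcos_self[OF y M.subgroup_axioms] i by simp
    then show ?thesis using i(1) unfolding r_coset_def by blast
  qed
  show "inv (y \<otimes> x) \<otimes> (x \<otimes> y) \<in> M" if x: "x \<in> carrier G" and y: "y \<in> carrier G" for x y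
  proof -
    have "M #> (x \<otimes> y) = M #> (y \<otimes> x)"
    proof (cases "x \<in> M")
      case True
      then have "M #> x = M" using coset_join2[OF x M.subgroup_axioms] by blast
      then show ?thesis
        using x y M.rcos_sum[of x y] M.rcos_sum[of y x] mem[OF y]
          Q.l_one[OF mem[OF y]] Q.r_one[OF mem[OF y]]
        by simp
    next
      case False
      then obtain i :: nat where i: "M #> y = M #> (x [^] i)" using power[OF x y] by blast
      have "M #> (x \<otimes> y) = M #> (x \<otimes> x [^] i)" "M #> (y \<otimes> x) = M #> (x [^] i \<otimes> x)"
        using i x y M.rcos_sum[of x y] M.rcos_sum[of y x] M.rcos_sum[of x "x [^] i"]
          M.rcos_sum[of "x [^] i" x] by simp_all
      then show ?thesis using nat_pow_Suc2[OF x, of i] by simp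
    qed
    then have "x \<otimes> y \<in> M #> (y \<otimes> x)"
      using rcos_self[of "x \<otimes> y", OF _ M.subgroup_axioms] x y by simp
    then have "(x \<otimes> y) \<otimes> inv (y \<otimes> x) \<in> M"
      using M.rcos_module_imp[OF group_axioms, of "y \<otimes> x"] x y by simp
    from M.inv_op_closed1[OF _ this, of "y \<otimes> x"] show ?thesis
      using x y by (simp add: m_assoc)
  qed
qed

lemma generate_eq_carrier_imp_cyclic:
  assumes "g \<in> carrier G" "generate G {g} = carrier G"
  shows "cyclic_group G"
  using assms by (auto simp: cyclic_group_def subgroup_generated_def Int_absorb1 intro!: bexI[of _ g])

text \<open>
  The subgroup is the intersection of two maximal subgroups \<open>M\<^sub>1\<close> and \<open>M\<^sub>2\<close>. The second one
  contains an element \<open>g\<close> outside the first; it exists because the cyclic subgroup generated by \<open>g\<close>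
  is proper.
\<close>

lemma noncyclic_elementary_quotient:
  assumes "\<not> cyclic_group G"
  shows "\<exists>N. N \<lhd> G \<and> card N * p ^ 2 = order G \<and> (\<forall>g\<in>carrier G. g [^] p \<in> N) \<and>
    (\<forall>x\<in>carrier G. \<forall>y\<in>carrier G. inv (y \<otimes> x) \<otimes> (x \<otimes> y) \<in> N)"
proof -
  have "{\<one>} \<noteq> carrier G"
    using assms trivial_imp_cyclic_group[of G] group_axioms by (auto simp: trivial_group_def)
  then obtain M1 where M1: "M1 \<lhd> G" "card M1 * p = order G"
    using maximal_subgroup[OF triv_subgroup] by metis
  interpret M1: normal M1 G by fact
  have ne: "card M1 < order G"
  proof -
    have "order G > 0" using order_eq p_gt_1 by simp
    then have "card M1 > 0" using M1(2) by (cases "card M1") auto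
    then have "card M1 * 1 < card M1 * p" using p_gt_1 by (intro mult_strict_left_mono) auto
    then show ?thesis using M1(2) by simp
  qed
  then obtain g where g: "g \<in> carrier G" "g \<notin> M1"
    using M1.subset by (metis order_def subsetI subset_antisym nat_neq_iff)
  have "subgroup (generate G {g}) G" using g by (intro generate_is_subgroup) simp
  moreover have "generate G {g} \<noteq> carrier G"
    using generate_eq_carrier_imp_cyclic[OF g(1)] assms by blast
  ultimately obtain M2 where M2: "generate G {g} \<subseteq> M2" "M2 \<lhd> G" "card M2 * p = order G"
    by (rule maximal_subgroup)
  interpret M2: normal M2 G by fact
  have gM2: "g \<in> M2" using M2(1) generate.incl[of g "{g}" G] by blast
  have "card M1 = card M2" using M1(2) M2(3) p_gt_1 by (metis mult_cancel2 not_one_less_zero)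
  then have "\<not> M1 \<subseteq> M2"
    using g gM2 card_subset_eq[OF subgroup_finite[OF M2.subgroup_axioms]] by blast
  then obtain x where x: "x \<in> M1" "x \<notin> M2" by blast
  then have xc: "x \<in> carrier G" by simp
  let ?N = "M1 \<inter> M2"
  have N: "?N \<lhd> G" by (rule normal_subgroup_intersect[OF M1(1) M2(2)])
  interpret N: normal ?N G by fact
  have "M1 \<subseteq> (\<Union>i\<in>{..<p}. ?N #> (x [^] i))"
  proof
    fix y assume y: "y \<in> M1"
    then obtain i m where im: "i < p" "m \<in> M2" "y = m \<otimes> x [^] i"
      using normal_index_p(2)[OF M2(2,3) xc _ x(2), of y] by auto
    have xi: "x [^] i \<in> M1" using subgroup_nat_pow[OF M1.subgroup_axioms x(1)] .
    have "m = y \<otimes> inv (x [^] i)"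
      using im xc by (simp add: m_assoc)
    then have "m \<in> M1" using y xi by simp
    then show "y \<in> (\<Union>i\<in>{..<p}. ?N #> (x [^] i))"
      using im unfolding r_coset_def by blast
  qed
  then have "card M1 \<le> card (\<Union>i\<in>{..<p}. ?N #> (x [^] i))"
    using finite_G xc subgroup_finite[OF N.subgroup_axioms]
    by (intro card_mono) (auto simp: r_coset_def)
  also have "\<dots> \<le> (\<Sum>i\<in>{..<p}. card (?N #> (x [^] i)))"
    by (rule card_UN_le) simp
  also have "\<dots> \<le> (\<Sum>i\<in>{..<p}. card ?N)"
  proof (rule sum_mono)
    fix i
    have "?N #> (x [^] i) = (\<lambda>h. h \<otimes> x [^] i) ` ?N" by (auto simp: r_coset_def)
    then show "card (?N #> (x [^] i)) \<le> card ?N"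
      using card_image_le subgroup_finite[OF N.subgroup_axioms] by metis
  qed
  finally have "card M1 \<le> p * card ?N" by simp
  moreover have "p * card ?N \<le> card M1"
    using x by (intro card_subgroup_strict[OF N.subgroup_axioms M1.subgroup_axioms]) blast
  ultimately have "card ?N * p ^ 2 = order G"
    using M1(2) by (simp add: power2_eq_square mult.commute mult.left_commute)
  then show ?thesis
    using N normal_index_p(1,3)[OF M1] normal_index_p(1,3)[OF M2(2,3)]
    by (intro exI[of _ ?N]) simp
qed

text \<open>
  Conjugation by \<open>g\<close> raises \<open>a\<close> to the power \<open>r\<close>, and its \<open>p\<^sup>n\<close>-th iterate is trivial. Hence \<open>r\<close> to
  the power \<open>p\<^sup>n\<close> is 1 modulo the order of \<open>a\<close>, in particular modulo \<open>p\<close>, whereas by Fermat it is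
  congruent to \<open>r\<close>.
\<close>

lemma conj_exponent_cong_1:
  assumes a: "a \<in> carrier G" "a \<noteq> \<one>" and normal: "generate G {a} \<lhd> G" and g: "g \<in> carrier G"
  shows "\<exists>r::nat. r mod p = 1 \<and> a \<otimes> g = g \<otimes> a [^] r"
proof -
  interpret N: normal "generate G {a}" G by fact
  have "inv g \<otimes> a \<otimes> g \<in> generate G {a}"
    using g by (intro N.inv_op_closed1) (auto intro: generate.incl)
  then obtain r :: nat where r: "inv g \<otimes> a \<otimes> g = a [^] r"
    using generate_pow_on_finite_carrier[OF finite_G a(1)] by auto
  then have ag: "a \<otimes> g = g \<otimes> a [^] r"
    using a g by (metis inv_solve_left m_assoc m_closed inv_closed)
  have pow: "a [^] i \<otimes> g = g \<otimes> a [^] (r * i)" for i :: nat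
  proof (induction i)
    case 0 show ?case using g by simp
  next
    case (Suc i)
    have "a [^] Suc i \<otimes> g = a [^] i \<otimes> (g \<otimes> a [^] r)" using a g ag by (simp add: m_assoc)
    also have "\<dots> = (a [^] i \<otimes> g) \<otimes> a [^] r" using a g by (simp add: m_assoc)
    also have "\<dots> = g \<otimes> (a [^] (r * i) \<otimes> a [^] r)" unfolding Suc using a g by (simp add: m_assoc)
    finally show ?case using a by (simp add: nat_pow_mult add.commute)
  qed
  have iter: "a \<otimes> g [^] k = g [^] k \<otimes> a [^] (r ^ k)" for k :: nat
  proof (induction k)
    case 0 show ?case using a by simp
  next
    case (Suc k)
    have "a \<otimes> g [^] Suc k = (a \<otimes> g [^] k) \<otimes> g" using a g by (simp add: m_assoc)
    also have "\<dots> = g [^] k \<otimes> (a [^] (r ^ k) \<otimes> g)" unfolding Suc using a g by (simp add: m_assoc)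
    also have "\<dots> = g [^] Suc k \<otimes> a [^] (r ^ Suc k)" unfolding pow using a g by (simp add: m_assoc)
    finally show ?case .
  qed
  have "a = a [^] (r ^ (p ^ n))"
    using iter[of "p ^ n"] pow_order_eq_1[OF g] a order_eq by simp
  define t where "t = r ^ (p ^ n)"
  have t: "a [^] t = a" using \<open>a = a [^] (r ^ (p ^ n))\<close> t_def by simp
  have "t \<noteq> 0" using t a by (metis nat_pow_0)
  have "a [^] (t - 1) \<otimes> a = a" using t \<open>t \<noteq> 0\<close> by (metis Suc_diff_1 nat_pow_Suc neq0_conv)
  then have "a [^] (t - 1) = \<one>" using a by (metis l_cancel_one nat_pow_closed r_cancel_one)
  then have "ord a dvd t - 1" using a pow_eq_id by blast
  moreover have "p dvd ord a"
  proof -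
    have "ord a dvd p ^ n" using ord_dvd_group_order[OF a(1)] order_eq by simp
    then obtain i where i: "ord a = p ^ i" using divides_primepow_nat prime_p by blast
    have "ord a \<noteq> 1" using ord_eq_1 a by simp
    then show ?thesis using i by (cases i) auto
  qed
  ultimately have "p dvd t - 1" by (rule dvd_trans[rotated])
  then have t1: "[t = 1] (mod p)" using \<open>t \<noteq> 0\<close> by (simp add: cong_altdef_nat cong_sym_eq)
  have np: "\<not> p dvd r"
  proof
    assume "p dvd r"
    then have "p dvd t" unfolding t_def using p_gt_1
      by (simp add: dvd_power_le[of p r 1, simplified] dvd_trans)
    then have "[t = 0] (mod p)" by (simp add: cong_0_iff)
    then have "[1 = 0] (mod p)" using t1 cong_sym cong_trans by blast
    then show False using p_gt_1 by (simp add: cong_def)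
  qed
  have fermat: "[r ^ p = r] (mod p)"
  proof -
    have "[r ^ (p - 1) * r = 1 * r] (mod p)"
      by (rule cong_mult[OF fermat_theorem[OF prime_p np] cong_refl])
    then show ?thesis using p_gt_1
      by (metis Suc_diff_1 mult.commute mult_1 not_gr_zero not_one_less_zero power_Suc)
  qed
  have "[r ^ (p ^ i) = r] (mod p)" for i
  proof (induction i)
    case (Suc i)
    have "r ^ (p ^ Suc i) = (r ^ (p ^ i)) ^ p" by (simp add: power_mult[symmetric] mult.commute)
    then show ?case using cong_pow[OF Suc, of p] fermat cong_trans by metis
  qed simp
  then have "[r = 1] (mod p)" using t1 unfolding t_def using cong_sym cong_trans by blast
  then show ?thesis using ag p_gt_1 by (auto simp: cong_def)
qed

end

section \<open>Groups with a cyclic subgroup of index p\<close>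

context finite_p_group
begin

lemma generate_subgroup: "g \<in> carrier G \<Longrightarrow> subgroup (generate G {g}) G"
  by (intro generate_is_subgroup) simp

lemma generator_mem: "g \<in> generate G {g}"
  by (simp add: generate.incl)

lemma generate_subset: "subgroup H G \<Longrightarrow> g \<in> H \<Longrightarrow> generate G {g} \<subseteq> H"
  by (intro generate_subgroup_incl) auto

lemma generate_nat_pow: "g \<in> carrier G \<Longrightarrow> x \<in> generate G {g} \<Longrightarrow> \<exists>k::nat. x = g [^] k"
  using generate_pow_on_finite_carrier[OF finite_G] by auto

lemma pow_mem_generate: "g \<in> carrier G \<Longrightarrow> g [^] (k::nat) \<in> generate G {g}"
  using generate_pow_on_finite_carrier[OF finite_G] by auto

lemma cyclic_generate: "cyclic_group (G\<lparr>carrier := generate G {g}\<rparr>)" if "g \<in> carrier G"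
  using cyclic_group_generated[of g] that by (simp add: subgroup_generated_def Int_absorb1)

lemma cyclic_subgroup_generator:
  assumes H: "subgroup H G" and cyc: "cyclic_group (G\<lparr>carrier := H\<rparr>)"
  obtains a where "a \<in> carrier G" "H = generate G {a}"
proof -
  interpret H: subgroup H G by fact
  interpret GH: group "G\<lparr>carrier := H\<rparr>" by (rule subgroup_imp_group[OF H])
  obtain a where a: "a \<in> H" "H = range (\<lambda>k::int. a [^]\<^bsub>G\<lparr>carrier := H\<rparr>\<^esub> k)"
    using cyc GH.cyclic_group by auto
  then have "H = range (\<lambda>k::int. a [^] k)"
    using int_pow_consistent[OF H a(1)] by simp
  then have "H = generate G {a}"
    using generate_pow[of a] a(1) H.mem_carrier by auto
  then show ?thesis using that a(1) H.mem_carrier by blast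
qed

lemma generate_coprime_power:
  assumes a: "a \<in> carrier G" and j: "\<not> p dvd j"
  shows "generate G {a [^] j} = generate G {a}"
proof -
  have "ord a dvd p ^ n" using ord_dvd_group_order[OF a] order_eq by simp
  then obtain i where i: "ord a = p ^ i" using divides_primepow_nat prime_p by blast
  have "coprime j (ord a)"
    unfolding i using prime_p j by (metis coprime_commute coprime_power_left_iff prime_imp_coprime)
  then have "ord (a [^] j) = ord a" using pow_ord_eq_ord_iff[OF finite_G a] by blast
  then have "card (generate G {a [^] j}) = card (generate G {a})"
    using generate_pow_card a by simp
  moreover have "generate G {a [^] j} \<subseteq> generate G {a}"
    by (rule generate_subset[OF generate_subgroup[OF a] pow_mem_generate[OF a]])
  ultimately show ?thesis
    using subgroup_finite[OF generate_subgroup[OF a]] by (simp add: card_subset_eq)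
qed

lemma subgroup_eq_carrier:
  assumes "subgroup K G" "order G \<le> card K"
  shows "K = carrier G"
proof -
  have "card K \<le> order G"
    unfolding order_def by (rule card_mono[OF finite_G subgroup.subset[OF assms(1)]])
  then show ?thesis using subgroup_card_eq_order assms by simp
qed

lemma cyclic_index_p_generators:
  assumes H: "subgroup H G" and cyc: "cyclic_group (G\<lparr>carrier := H\<rparr>)"
    and index: "card (rcosets H) = p"
  obtains a b where "a \<in> carrier G" "b \<in> carrier G" "b \<notin> generate G {a}" "generate G {a} \<lhd> G"
    "ord a * p = order G" "\<And>K. subgroup K G \<Longrightarrow> {a, b} \<subseteq> K \<Longrightarrow> K = carrier G"
proof -
  have cH: "card H * p = order G" using lagrange[OF H] index by (simp add: mult.commute)
  have pos: "order G > 0" using order_eq p_gt_1 by simp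
  have "H \<noteq> carrier G"
  proof
    assume "H = carrier G"
    then have "order G * p = order G * 1" using cH by (simp add: order_def)
    then show False using pos p_gt_1 by (metis mult_cancel1 nat_neq_iff)
  qed
  then obtain M where M: "H \<subseteq> M" "M \<lhd> G" "card M * p = order G"
    using maximal_subgroup[OF H] by metis
  have "card M = card H" using cH M(3) p_gt_1 by (metis mult_cancel2 not_one_less_zero)
  then have "H = M"
    using M card_subset_eq[OF subgroup_finite[OF normal_imp_subgroup[OF M(2)]]] by metis
  then have normal: "H \<lhd> G" using M by simp
  obtain a where a: "a \<in> carrier G" "H = generate G {a}" by (rule cyclic_subgroup_generator[OF H cyc])
  obtain b where b: "b \<in> carrier G" "b \<notin> H"
    using \<open>H \<noteq> carrier G\<close> subgroup.subset[OF H] by blast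
  have "K = carrier G" if K: "subgroup K G" "{a, b} \<subseteq> K" for K
  proof -
    have "H \<subset> K" using generate_subset[OF K(1), of a] K a b by blast
    then have "p * card H \<le> card K" using card_subgroup_strict[OF H K(1)] by blast
    then show ?thesis using cH subgroup_eq_carrier[OF K(1)] by (simp add: mult.commute)
  qed
  then show ?thesis
    using that[of a b] a b normal cH generate_pow_card[OF a(1)] by simp
qed

text \<open>
  The weight count with \<open>x = a - 1\<close> and \<open>y = b - 1\<close>, both of weight 1. As \<open>G\<close> is not cyclic, \<open>b\<^sup>p\<close>
  does not generate the subgroup of \<open>a\<close>, so it is a \<open>p\<close>-th power \<open>(a\<^sup>k)\<^sup>p\<close> and
  \<open>y\<^sup>p = b\<^sup>p - 1 = (a\<^sup>k - 1)\<^sup>p\<close> lies in \<open>I\<^sup>p\<^sup>-\<^sup>1 x\<close>.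
\<close>

theorem augI_nilpotent_cyclic_index_p:
  assumes H: "subgroup H G" and cyc: "cyclic_group (G\<lparr>carrier := H\<rparr>)"
    and index: "card (rcosets H) = p" and nc: "\<not> cyclic_group G"
  shows "A.ideal_power augmentation_ideal (order G div p + p - 1) = {\<zero>\<^bsub>A\<^esub>}"
proof -
  obtain a b where ab: "a \<in> carrier G" "b \<in> carrier G" "b \<notin> generate G {a}" "generate G {a} \<lhd> G"
    "ord a * p = order G" "\<And>K. subgroup K G \<Longrightarrow> {a, b} \<subseteq> K \<Longrightarrow> K = carrier G"
    using cyclic_index_p_generators[OF H cyc index] by metis
  have a_in: "a \<notin> generate G {b}"
  proof
    assume "a \<in> generate G {b}"
    then have "generate G {b} = carrier G"
      using ab(6)[OF generate_subgroup[OF ab(2)]] generator_mem by blast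
    then show False using generate_eq_carrier_imp_cyclic nc ab(2) by blast
  qed
  have a1: "a \<noteq> \<one>" using a_in generate.one by metis
  have "b [^] p \<in> generate G {a}"
    using normal_index_p(1)[OF ab(4) _ ab(2)] ab(5) generate_pow_card[OF ab(1)] by simp
  then obtain j :: nat where j: "b [^] p = a [^] j" using generate_nat_pow[OF ab(1)] by blast
  have "p dvd j"
  proof (rule ccontr)
    assume "\<not> p dvd j"
    then have "a \<in> generate G {b [^] p}"
      using generate_coprime_power[OF ab(1)] j generator_mem by metis
    then show False
      using a_in generate_subset[OF generate_subgroup[OF ab(2)] pow_mem_generate[OF ab(2)]] by blast
  qed
  then obtain k where k: "j = k * p" by (metis dvd_div_mult_self)
  have bk: "b [^] p = (a [^] k) [^] p" using j k ab(1) by (simp add: nat_pow_pow)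
  have "ord a dvd p ^ n" using ord_dvd_group_order[OF ab(1)] order_eq by simp
  then obtain m where m: "ord a = p ^ m" using divides_primepow_nat prime_p by blast
  have am: "a [^] (p ^ m) = \<one>" using pow_ord_eq_1[OF ab(1)] m by simp
  have "A.ideal_power augmentation_ideal (p + 1 - 1 + 1 * (p ^ m - 1)) = {\<zero>\<^bsub>A\<^esub>}"
  proof (rule augI_nilpotent[OF ab(1,2) one_closed _ _ am _ _ _ _ bk])
    show "H = carrier G" if "subgroup H G" "{a, b, \<one>} \<subseteq> H" for H
      using ab(6) that by blast
    show "\<exists>r::nat. r mod p = 1 \<and> a \<otimes> g = g \<otimes> a [^] r" if "g \<in> carrier G" for g
      by (rule conj_exponent_cong_1[OF ab(1) a1 ab(4) that])
    show "\<one> \<otimes> b = b \<otimes> \<one> \<otimes> a [^] (0::nat)" using ab by simp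
    show "\<one> [^] (1::nat) = \<one>" by simp
  qed simp_all
  moreover have "order G div p = p ^ m" using ab(5) m p_gt_1
    by (metis div_mult_self_is_m gr_zeroI not_one_less_zero)
  moreover have "p + 1 - 1 + 1 * (p ^ m - 1) = p ^ m + p - 1"
    using p_gt_1 by simp
  ultimately show ?thesis by simp
qed

text \<open>
  Take \<open>ord a - 1\<close> copies of \<open>a\<close> and \<open>p - 1\<close> copies of \<open>b\<close>. A product involving \<open>j\<close> copies of \<open>b\<close>
  lies in the coset of \<open>b\<^sup>j\<close>, which contains the identity only for \<open>j = 0\<close>; what remains is a power
  \<open>a\<^sup>i\<close> with \<open>0 < i < ord a\<close>.
\<close>

theorem small_davenport_lower_bound:
  assumes H: "subgroup H G" and cyc: "cyclic_group (G\<lparr>carrier := H\<rparr>)"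
    and index: "card (rcosets H) = p"
  shows "enat (order G div p + p - 2) \<le> small_davenport G"
proof -
  obtain a b where ab: "a \<in> carrier G" "b \<in> carrier G" "b \<notin> generate G {a}" "generate G {a} \<lhd> G"
    "ord a * p = order G"
    using cyclic_index_p_generators[OF H cyc index] by metis
  let ?H = "generate G {a}"
  interpret H: normal ?H G by (rule ab(4))
  have pos: "ord a > 0" using ab(5) order_eq p_gt_1 by (cases "ord a") auto
  have bp: "b [^] p \<in> ?H"
    using normal_index_p(1)[OF ab(4) _ ab(2)] ab(5) generate_pow_card[OF ab(1)] by simp
  \<comment> \<open>\<open>b\<close> generates the quotient, which has order \<open>p\<close>: invert \<open>j\<close> modulo \<open>p\<close>.\<close>
  have b_pow: "j = 0" if "b [^] j \<in> ?H" "j < p" for j :: nat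
  proof (rule ccontr)
    assume "j \<noteq> 0"
    then have "coprime j p" using that(2) prime_p
      by (metis coprime_commute dvd_imp_le linorder_not_less neq0_conv prime_imp_coprime)
    then obtain x y where xy: "j * x = p * y + 1"
      using bezout_nat[OF \<open>j \<noteq> 0\<close>, of p] by auto
    have "(b [^] j) [^] x = (b [^] p) [^] y \<otimes> b"
      using ab(2) xy by (simp add: nat_pow_pow)
    then have "b = inv ((b [^] p) [^] y) \<otimes> (b [^] j) [^] x"
      using ab(2) by (simp add: m_assoc[symmetric])
    also have "\<dots> \<in> ?H"
      using subgroup_nat_pow[OF H.subgroup_axioms that(1)] subgroup_nat_pow[OF H.subgroup_axioms bp]
      by (intro H.m_closed H.m_inv_closed) blast+
    finally show False using ab(3) by blast
  qed
  define S where "S = replicate_mset (ord a - 1) a + replicate_mset (p - 1) b"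
  have size: "size S = order G div p + p - 2"
    using pos p_gt_1 ab(5)[symmetric] by (simp add: S_def)
  have ab_ne: "a \<noteq> b" using ab(3) generator_mem by blast
  have prod: "\<exists>h\<in>?H. list_product G ys = b [^] count_list ys b \<otimes> h" if "set ys \<subseteq> {a, b}" for ys
    using that
  proof (induction ys)
    case Nil
    then show ?case by (intro bexI[of _ "\<one>"]) simp_all
  next
    case (Cons y ys)
    then obtain h where h: "h \<in> ?H" "list_product G ys = b [^] count_list ys b \<otimes> h" by auto
    have hc: "h \<in> carrier G" using h by simp
    consider "y = b" | "y = a" using Cons.prems by auto
    then show ?case
    proof cases
      case 1
      then have "list_product G (y # ys) = b [^] count_list (y # ys) b \<otimes> h"
        using h hc ab(2) nat_pow_Suc2[OF ab(2)] by (simp add: m_assoc[symmetric])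
      then show ?thesis using h by blast
    next
      case 2
      let ?c = "b [^] count_list ys b"
      have "list_product G (y # ys) = ?c \<otimes> ((inv ?c \<otimes> a \<otimes> ?c) \<otimes> h)"
        using h hc ab 2 by (simp add: m_assoc[symmetric])
      moreover have "(inv ?c \<otimes> a \<otimes> ?c) \<otimes> h \<in> ?H"
        using h ab generator_mem by (intro H.m_closed H.inv_op_closed1) auto
      ultimately show ?thesis using 2 ab_ne by auto
    qed
  qed
  have "\<one> \<notin> subseq_products G S"
  proof
    assume "\<one> \<in> subseq_products G S"
    then obtain T ys where T: "T \<subseteq># S" "size T \<ge> 1" "mset ys = T" "list_product G ys = \<one>"
      unfolding subseq_products_def perm_products_def
      by (auto dest: permutations_of_multisetD)
    have "set ys \<subseteq> {a, b}"
    proof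
      fix y assume "y \<in> set ys"
      then have "y \<in># S" using T by (metis mset_subset_eqD set_mset_mset)
      then show "y \<in> {a, b}" by (auto simp: S_def split: if_splits)
    qed
    then obtain h where h: "h \<in> ?H" "\<one> = b [^] count_list ys b \<otimes> h" using prod T by metis
    have cnt: "count_list ys x \<le> count S x" for x
      using T by (metis count_mset mset_subset_eq_count)
    have "b [^] count_list ys b = inv h"
      using h ab(2) by (metis H.mem_carrier inv_equality inv_inv nat_pow_closed)
    then have "b [^] count_list ys b \<in> ?H" using h by simp
    moreover have "count_list ys b < p" using cnt[of b] ab_ne p_gt_1 by (simp add: S_def)
    ultimately have "count_list ys b = 0" using b_pow by blast
    then have "b \<notin> set ys" by (simp add: count_list_0_iff)
    then have rep: "ys = replicate (length ys) a"
      using \<open>set ys \<subseteq> {a, b}\<close> by (intro replicate_eqI) auto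
    have "count_list (replicate k a) a = k" for k by (induction k) simp_all
    then have "length ys = count_list ys a" by (metis rep)
    then have "length ys < ord a" using cnt[of a] ab_ne pos by (simp add: S_def)
    moreover have "a [^] length ys = \<one>"
      using T(4) list_product_replicate[OF ab(1), of "length ys"] rep by simp
    then have "ord a dvd length ys" using pow_eq_id[OF ab(1)] by blast
    moreover have "length ys > 0" using T by auto
    ultimately show False by (meson dvd_imp_le linorder_not_less)
  qed
  moreover have "set_mset S \<subseteq> carrier G" using ab by (auto simp: S_def split: if_splits)
  ultimately have "enat (size S) \<le> small_davenport G"
    unfolding small_davenport_def by (intro SUP_upper) simp
  then show ?thesis by (simp add: size)
qed

end

section \<open>Groups without a cyclic subgroup of index p\<close>

context finite_p_group
begin

lemma ordered_davenport_cyclic_index_p: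
  assumes "subgroup H G" "cyclic_group (G\<lparr>carrier := H\<rparr>)" "card (rcosets H) = p" "\<not> cyclic_group G"
  shows "ordered_davenport_le G (order G div p + p - 1)"
  by (rule ordered_davenport_le_nilpotency_index[OF augI_nilpotent_cyclic_index_p[OF assms]])

lemma cyclic_group_generator:
  assumes "cyclic_group G"
  obtains x where "x \<in> carrier G" "generate G {x} = carrier G"
proof -
  obtain x where x: "x \<in> carrier G" "subgroup_generated G {x} = G"
    using assms unfolding cyclic_group_def by blast
  then have "generate G {x} = carrier G"
    using carrier_subgroup_generated[of G "{x}"] by (simp add: Int_absorb1)
  then show ?thesis using that x by blast
qed

text \<open>
  The exponent rules out that the group is cyclic, and every subgroup of order \<open>p\<close> is a cyclic
  subgroup of index \<open>p\<close>; so the bound \<open>p\<^sup>2 / p + p - 1\<close> applies.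
\<close>

lemma ordered_davenport_p_squared:
  assumes n: "n = 2" and exponent: "\<And>g. g \<in> carrier G \<Longrightarrow> g [^] p = \<one>"
  shows "ordered_davenport_le G (2 * p - 1)"
proof -
  have ord: "ord g dvd p" if "g \<in> carrier G" for g
    using exponent[OF that] pow_eq_id[OF that] by blast
  have sq: "order G = p * p" using order_eq n by (simp add: power2_eq_square)
  have nc: "\<not> cyclic_group G"
  proof
    assume "cyclic_group G"
    then obtain x where x: "x \<in> carrier G" "generate G {x} = carrier G" by (rule cyclic_group_generator)
    then have "ord x = p * p" using generate_pow_card sq by (simp add: order_def)
    then have "p * p \<le> p" using ord[OF x(1)] p_gt_1 by (simp add: dvd_imp_le)
    then show False using p_gt_1 by simp
  qed
  then obtain x where x: "x \<in> carrier G" "x \<noteq> \<one>"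
    using trivial_imp_cyclic_group[of G] group_axioms one_closed unfolding trivial_group_def by blast
  have "ord x = p"
    using ord[OF x(1)] ord_eq_1[OF x(1)] x(2) prime_p prime_nat_iff by blast
  then have "card (rcosets (generate G {x})) * p = p * p"
    using lagrange[OF generate_subgroup[OF x(1)]] sq generate_pow_card[OF x(1)] by simp
  then have "card (rcosets (generate G {x})) = p" using p_gt_1 by simp
  from ordered_davenport_cyclic_index_p[OF generate_subgroup[OF x(1)] cyclic_generate[OF x(1)] this nc]
  show ?thesis using sq p_gt_1 by (simp add: mult_2)
qed

text \<open>
  Let \<open>M\<close> be a maximal subgroup containing \<open>a\<close>; then \<open>a\<close>, any \<open>b\<close> in \<open>M\<close> that is not a power of
  \<open>a\<close>, and any \<open>c\<close> outside \<open>M\<close> generate \<open>G\<close>. If \<open>p = 2\<close>, the group is abelian and weight 1 for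
  \<open>a - 1\<close> gives the bound 4. If \<open>p\<close> is odd, weight 2 gives \<open>(2p - 1) + 2(p - 1) = 4p - 3\<close>, which is
  at most \<open>p\<^sup>2\<close>.
\<close>

lemma ordered_davenport_p_cubed:
  assumes n: "n = 3" and exponent: "\<And>g. g \<in> carrier G \<Longrightarrow> g [^] p = \<one>"
    and a: "a \<in> carrier G" "a \<noteq> \<one>" "generate G {a} \<lhd> G"
    and comm: "\<And>x y. x \<in> carrier G \<Longrightarrow> y \<in> carrier G \<Longrightarrow> inv (y \<otimes> x) \<otimes> (x \<otimes> y) \<in> generate G {a}"
  shows "ordered_davenport_le G (p ^ 2)"
proof -
  have oG: "order G = p * (p * p)" using order_eq n by (simp add: power3_eq_cube)
  have "ord a = p"
    using exponent[OF a(1)] pow_eq_id[OF a(1)] ord_eq_1[OF a(1)] a(2) prime_p prime_nat_iff by blast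
  then have cN: "card (generate G {a}) = p" using generate_pow_card[OF a(1)] by simp
  have "p < p * (p * p)" using p_gt_1 less_1_mult[OF p_gt_1 p_gt_1] by simp
  then have "generate G {a} \<noteq> carrier G" using cN oG by (auto simp: order_def)
  then obtain M where M: "generate G {a} \<subseteq> M" "M \<lhd> G" "card M * p = order G"
    by (rule maximal_subgroup[OF generate_subgroup[OF a(1)]])
  interpret M: normal M G by fact
  have cM: "card M = p * p" using M(3) oG p_gt_1 by simp
  have "p < p * p" using p_gt_1 by simp
  then obtain b where b: "b \<in> M" "b \<notin> generate G {a}" using cN cM M(1)
    by (metis nat_neq_iff subsetI subset_antisym)
  have "p * p < p * (p * p)" using p_gt_1 by simp
  then obtain c where c: "c \<in> carrier G" "c \<notin> M" using cM oG M.subset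
    by (metis nat_neq_iff order_def subsetI subset_antisym)
  have bc: "b \<in> carrier G" using b by simp
  have gen: "K = carrier G" if K: "subgroup K G" "{a, b, c} \<subseteq> K" for K
  proof -
    have KM: "subgroup (K \<inter> M) G" using K(1) M.subgroup_axioms by (rule subgroups_Inter_pair)
    have "generate G {a} \<subset> K \<inter> M"
      using generate_subset[OF K(1), of a] M(1) K b by blast
    then have "p * p \<le> card (K \<inter> M)"
      using card_subgroup_strict[OF generate_subgroup[OF a(1)] KM] cN by simp
    then have "K \<inter> M = M"
      using cM subgroup_finite[OF M.subgroup_axioms]
      by (metis Int_lower2 card_seteq)
    then have "M \<subset> K" using c K by blast
    then have "order G \<le> card K"
      using card_subgroup_strict[OF M.subgroup_axioms K(1)] cM oG by simp
    then show ?thesis by (rule subgroup_eq_carrier[OF K(1)])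
  qed
  have conj: "\<exists>r::nat. r mod p = 1 \<and> a \<otimes> g = g \<otimes> a [^] r" if "g \<in> carrier G" for g
    by (rule conj_exponent_cong_1[OF a that])
  have a_pow: "a [^] (p ^ 1) = \<one>" using exponent a by simp
  have b_pow: "b [^] p = (a [^] (0::nat)) [^] p" using exponent[OF bc] by simp
  show ?thesis
  proof (cases "p = 2")
    case True
    have sq: "g \<otimes> g = \<one>" if "g \<in> carrier G" for g
      using exponent[OF that] True that by (simp add: numeral_2_eq_2)
    have inv: "inv g = g" if "g \<in> carrier G" for g
      using sq[OF that] that by (intro inv_equality)
    have "c \<otimes> b = b \<otimes> c \<otimes> a [^] (0::nat)"
      using inv[of "b \<otimes> c"] inv_mult_group[OF bc c(1)] inv[OF bc] inv[OF c(1)] bc c by simp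
    then have "A.ideal_power augmentation_ideal (p + p - 1 + 1 * (p ^ 1 - 1)) = {\<zero>\<^bsub>A\<^esub>}"
      using exponent[OF c(1)]
      by (intro augI_nilpotent[OF a(1) bc c(1) gen conj a_pow _ _ _ _ b_pow]) auto
    then have "ordered_davenport_le G (p + p - 1 + 1 * (p ^ 1 - 1))"
      by (rule ordered_davenport_le_nilpotency_index)
    then show ?thesis using True by simp
  next
    case False
    then have "p \<ge> 3" using p_gt_1 by simp
    have "inv (b \<otimes> c) \<otimes> (c \<otimes> b) \<in> generate G {a}" by (rule comm[OF c(1) bc])
    then obtain l :: nat where "inv (b \<otimes> c) \<otimes> (c \<otimes> b) = a [^] l"
      using generate_nat_pow[OF a(1)] by blast
    then have "c \<otimes> b = b \<otimes> c \<otimes> a [^] l"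
      using inv_solve_left[of "a [^] l" "b \<otimes> c" "c \<otimes> b"] a bc c by auto
    then have "A.ideal_power augmentation_ideal (p + p - 1 + 2 * (p ^ 1 - 1)) = {\<zero>\<^bsub>A\<^esub>}"
      using exponent[OF c(1)]
      by (intro augI_nilpotent[OF a(1) bc c(1) gen conj a_pow _ _ _ _ b_pow]) auto
    then have "ordered_davenport_le G (p + p - 1 + 2 * (p ^ 1 - 1))"
      by (rule ordered_davenport_le_nilpotency_index)
    moreover have "p + p - 1 + 2 * (p ^ 1 - 1) \<le> p ^ 2"
    proof -
      obtain q where "p = q + 3" using \<open>p \<ge> 3\<close> by (metis add.commute le_Suc_ex)
      then show ?thesis by (simp add: power2_eq_square algebra_simps)
    qed
    ultimately show ?thesis by (rule ordered_davenport_le_mono)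
  qed
qed

lemma quotient_p_group:
  assumes N: "N \<lhd> G" and card_N: "card N * p ^ k = order G"
  shows "finite_p_group (G Mod N) p k"
proof -
  interpret N: normal N G by fact
  interpret Q: group "G Mod N" by (rule N.factorgroup_is_group)
  have "card N \<noteq> 0" using card_N order_eq p_gt_1 by (auto intro: ccontr)
  moreover have "card (rcosets N) * card N = p ^ k * card N"
    using lagrange[OF N.subgroup_axioms] card_N by (simp add: mult.commute)
  ultimately have "order (G Mod N) = p ^ k"
    by (simp add: order_def FactGroup_def)
  moreover have "finite (carrier (G Mod N))"
    using finite_G by (simp add: carrier_FactGroup)
  ultimately show ?thesis using prime_p by unfold_locales
qed

lemma subgroup_p_group:
  assumes N: "subgroup N G" and card_N: "card N * p ^ k = order G"
  shows "finite_p_group (G\<lparr>carrier := N\<rparr>) p (n - k)" "k \<le> n"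
proof -
  interpret GN: group "G\<lparr>carrier := N\<rparr>" by (rule subgroup_imp_group[OF N])
  obtain l where l: "l \<le> n" "card N = p ^ l" by (rule card_subgroup[OF N])
  then have "p ^ (l + k) = p ^ n" using card_N order_eq by (simp add: power_add)
  then have "l + k = n" using p_gt_1 power_inject_exp by blast
  then show "k \<le> n" by simp
  show "finite_p_group (G\<lparr>carrier := N\<rparr>) p (n - k)"
    using prime_p subgroup_finite[OF N] l \<open>l + k = n\<close> by unfold_locales (auto simp: order_def)
qed

lemma subgroup_davenport_le_card:
  assumes N: "subgroup N G"
  shows "unordered_davenport_le (G\<lparr>carrier := N\<rparr>) (card N)"
  using group.unordered_davenport_le_order[OF subgroup_imp_group[OF N]] subgroup_finite[OF N]
  by (simp add: order_def)

lemma elementary_quotient_davenport: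
  assumes N: "N \<lhd> G" and card_N: "card N * p ^ 2 = order G"
    and exponent: "\<And>g. g \<in> carrier G \<Longrightarrow> g [^] p \<in> N"
  shows "ordered_davenport_le (G Mod N) (2 * p - 1)"
proof -
  interpret N: normal N G by fact
  interpret Q: finite_p_group "G Mod N" p 2 by (rule quotient_p_group[OF N card_N])
  have "X [^]\<^bsub>G Mod N\<^esub> p = \<one>\<^bsub>G Mod N\<^esub>" if X: "X \<in> carrier (G Mod N)" for X
  proof -
    obtain g where "g \<in> carrier G" "X = N #> g" using X by (auto simp: carrier_FactGroup)
    then show ?thesis
      using exponent coset_join2[OF _ N.subgroup_axioms] by (simp add: N.FactGroup_pow)
  qed
  then show ?thesis by (intro Q.ordered_davenport_p_squared) simp_all
qed

lemma noncyclic_davenport: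
  assumes "\<not> cyclic_group G"
  shows "n \<ge> 2" "unordered_davenport_le G ((2 * p - 1) * p ^ (n - 2))"
proof -
  obtain N where N: "N \<lhd> G" "card N * p ^ 2 = order G" "\<And>g. g \<in> carrier G \<Longrightarrow> g [^] p \<in> N"
    using noncyclic_elementary_quotient[OF assms] by auto
  note sub = normal_imp_subgroup[OF N(1)]
  interpret GN: finite_p_group "G\<lparr>carrier := N\<rparr>" p "n - 2" by (rule subgroup_p_group(1)[OF sub N(2)])
  show "n \<ge> 2" by (rule subgroup_p_group(2)[OF sub N(2)])
  have "card N = p ^ (n - 2)" using GN.order_eq by (simp add: order_def)
  then show "unordered_davenport_le G ((2 * p - 1) * p ^ (n - 2))"
    using quotient_davenport_extension[OF N(1) elementary_quotient_davenport[OF N]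
      subgroup_davenport_le_card[OF sub]] by simp
qed

text \<open>
  Outside \<open>N\<close> there are only three cosets, so four elements that avoid \<open>N\<close> include two, \<open>g\<close> and
  \<open>h\<close>, in the same coset, and \<open>gh\<close> lies in the coset of \<open>h\<^sup>2\<close>.
\<close>

lemma klein_quotient_short_product:
  assumes N: "N \<lhd> G" and card_N: "card N * 4 = order G"
    and squares: "\<And>g. g \<in> carrier G \<Longrightarrow> g \<otimes> g \<in> N"
    and xs: "set xs \<subseteq> carrier G" "length xs = 4"
  shows "\<exists>ys. ys \<noteq> [] \<and> mset ys \<subseteq># mset xs \<and> length ys \<le> 2 \<and> list_product G ys \<in> N"
proof (cases "\<exists>g\<in>set xs. g \<in> N")
  case True
  then obtain g where "g \<in> set xs" "g \<in> N" by blast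
  then show ?thesis
    using normal_imp_subgroup[OF N] by (intro exI[of _ "[g]"]) (simp add: subgroup.mem_carrier)
next
  case False
  interpret N: normal N G by fact
  let ?f = "\<lambda>i. N #> (xs ! i)"
  have xsc: "xs ! i \<in> carrier G" "xs ! i \<notin> N" if "i < 4" for i
    using that xs False nth_mem[of i xs] by auto
  have "?f ` {..<4} \<subseteq> rcosets N - {N}"
  proof
    fix X assume "X \<in> ?f ` {..<4}"
    then obtain i where i: "i < 4" "X = ?f i" by auto
    then show "X \<in> rcosets N - {N}"
      using xsc[OF i(1)] rcosetsI[OF N.subset] coset_join1[OF _ _ N.subgroup_axioms] by auto
  qed
  moreover have "finite (rcosets N)" using finite_G by (simp add: RCOSETS_def)
  ultimately have "card (?f ` {..<4}) \<le> card (rcosets N - {N})"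
    by (intro card_mono) auto
  also have "\<dots> = 3"
  proof -
    have "card N > 0" using card_N order_eq p_gt_1 by (cases "card N") auto
    then have "card (rcosets N) = 4"
      using lagrange[OF N.subgroup_axioms] card_N by (metis mult.commute mult_cancel2 nat_neq_iff)
    then show ?thesis using N.subgroup_in_rcosets[OF group_axioms] by simp
  qed
  finally have "\<not> inj_on ?f {..<4}" using card_image[of ?f "{..<4}"] by auto
  then obtain i j where ij: "i < j" "j < 4" "?f i = ?f j"
    unfolding inj_on_def by (metis lessThan_iff linorder_neqE_nat)
  then have ij4: "i < 4" "j < 4" by auto
  define g h where "g = xs ! i" and "h = xs ! j"
  have gh: "g \<in> carrier G" "h \<in> carrier G" using xsc ij4 by (auto simp: g_def h_def)
  have "N #> (g \<otimes> h) = N #> (h \<otimes> h)"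
    using gh ij(3) N.rcos_sum[of g h] N.rcos_sum[of h h] by (simp add: g_def h_def)
  also have "\<dots> = N" using squares[OF gh(2)] gh coset_join2[OF _ N.subgroup_axioms] by simp
  finally have "g \<otimes> h \<in> N" using coset_join1[OF _ _ N.subgroup_axioms] gh by simp
  moreover have "mset [g, h] \<subseteq># mset xs"
  proof -
    have "mset [g, h] = mset (nths xs {i, j})"
      using ij xs(2) unfolding g_def h_def
      by (auto simp: numeral_eq_Suc length_Suc_conv less_Suc_eq nths_Cons)
    moreover have "mset (nths xs {i, j}) \<subseteq># mset xs"
      by (rule subseq_imp_subset_mset) (auto simp: subseq_conv_nths)
    ultimately show ?thesis by simp
  qed
  ultimately show ?thesis using gh by (intro exI[of _ "[g, h]"]) simp
qed

text \<open>
  Let \<open>N\<close> be normal with elementary abelian quotient of order \<open>p\<^sup>2\<close>.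

  If \<open>N\<close> is not cyclic, the bounds \<open>(2p - 1)p\<^sup>n\<^sup>-\<^sup>4\<close> for \<open>N\<close> and \<open>2p - 1\<close> for the quotient multiply
  to at most \<open>p\<^sup>n\<^sup>-\<^sup>1\<close> when \<open>p\<close> is odd. When \<open>p = 2\<close> the product \<open>9 \<cdot> 2\<^sup>n\<^sup>-\<^sup>4\<close> is slightly too
  large, but any four elements contain one or two with product in \<open>N\<close>, which gives \<open>6 \<cdot> 2\<^sup>n\<^sup>-\<^sup>4 + 2\<close>
  instead.

  If \<open>N\<close> is generated by \<open>a\<close>, let \<open>K\<close> be generated by \<open>a\<^sup>p\<close>. A cyclic subgroup cannot strictly
  contain \<open>N\<close>, for it would be \<open>G\<close> or of index \<open>p\<close>; in particular \<open>N\<close> is not trivial. Every \<open>p\<close>-th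
  power \<open>g\<^sup>p\<close> lies in \<open>K\<close>: this is clear for \<open>g\<close> in \<open>N\<close>, and for any other \<open>g\<close> the power \<open>g\<^sup>p\<close> in
  \<open>N\<close> would otherwise generate \<open>N\<close>, so that \<open>g\<close> generates a strictly larger subgroup. So the
  quotient by \<open>K\<close> is of order \<open>p\<^sup>3\<close> and exponent \<open>p\<close>, and its bound \<open>p\<^sup>2\<close> is multiplied by the order
  \<open>p\<^sup>n\<^sup>-\<^sup>3\<close> of \<open>K\<close>.
\<close>

theorem davenport_no_cyclic_index_p:
  assumes nc: "\<not> cyclic_group G"
    and no_index_p: "\<And>H. subgroup H G \<Longrightarrow> cyclic_group (G\<lparr>carrier := H\<rparr>) \<Longrightarrow> card (rcosets H) \<noteq> p"
  shows "unordered_davenport_le G (p ^ (n - 1))"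
proof -
  obtain N where N: "N \<lhd> G" "card N * p ^ 2 = order G" "\<And>g. g \<in> carrier G \<Longrightarrow> g [^] p \<in> N"
    "\<And>x y. x \<in> carrier G \<Longrightarrow> y \<in> carrier G \<Longrightarrow> inv (y \<otimes> x) \<otimes> (x \<otimes> y) \<in> N"
    using noncyclic_elementary_quotient[OF nc] by auto
  note sub = normal_imp_subgroup[OF N(1)]
  interpret N: normal N G by (rule N(1))
  interpret GN: finite_p_group "G\<lparr>carrier := N\<rparr>" p "n - 2" by (rule subgroup_p_group(1)[OF sub N(2)])
  have n2: "n \<ge> 2" by (rule subgroup_p_group(2)[OF sub N(2)])
  have cN: "card N = p ^ (n - 2)" using GN.order_eq by (simp add: order_def)
  have no_index: False if g: "g \<in> carrier G" "card (generate G {g}) * p = order G" for g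
  proof -
    have "card (rcosets (generate G {g})) * card (generate G {g}) = p * card (generate G {g})"
      using lagrange[OF generate_subgroup[OF g(1)]] g(2) by (simp add: mult.commute)
    moreover have "card (generate G {g}) \<noteq> 0" using g(2) order_eq p_gt_1 by (auto intro: ccontr)
    ultimately have "card (rcosets (generate G {g})) = p" by simp
    then show False
      using no_index_p[OF generate_subgroup[OF g(1)] cyclic_generate[OF g(1)]] by blast
  qed
  have strict: False if g: "g \<in> carrier G" "N \<subset> generate G {g}" for g
  proof -
    have "p * card N \<le> card (generate G {g})"
      by (rule card_subgroup_strict[OF sub generate_subgroup[OF g(1)] g(2)])
    moreover obtain k where k: "k \<le> n" "card (generate G {g}) = p ^ k"
      by (rule card_subgroup[OF generate_subgroup[OF g(1)]])
    ultimately have "p ^ Suc (n - 2) \<le> p ^ k" using cN by simp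
    then have "Suc (n - 2) \<le> k" using p_gt_1 power_le_imp_le_exp by blast
    moreover have "k \<noteq> n"
    proof
      assume "k = n"
      then have "generate G {g} = carrier G"
        using k order_eq by (intro subgroup_eq_carrier generate_subgroup g) simp
      then show False using generate_eq_carrier_imp_cyclic[OF g(1)] nc by blast
    qed
    ultimately have "Suc k = n" using k n2 by simp
    then have "card (generate G {g}) * p = order G" using k order_eq by (metis mult.commute power_Suc)
    then show False by (rule no_index[OF g(1)])
  qed
  show ?thesis
  proof (cases "cyclic_group (G\<lparr>carrier := N\<rparr>)")
    case False
    have n4: "n - 2 \<ge> 2"
      and dN: "unordered_davenport_le (G\<lparr>carrier := N\<rparr>) ((2 * p - 1) * p ^ (n - 2 - 2))"
      using GN.noncyclic_davenport[OF False] by auto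
    define k where "k = n - 4"
    have n: "n = k + 4" using n4 by (simp add: k_def)
    have kk: "n - 2 - 2 = k" using n by simp
    show ?thesis
    proof (cases "p = 2")
      case True
      have short: "\<exists>ys. ys \<noteq> [] \<and> mset ys \<subseteq># mset xs \<and> length ys \<le> 2 \<and> list_product G ys \<in> N"
        if "set xs \<subseteq> carrier G" "length xs = 4" for xs
      proof (rule klein_quotient_short_product[OF N(1) _ _ that])
        show "card N * 4 = order G" using N(2) True by simp
        show "g \<otimes> g \<in> N" if "g \<in> carrier G" for g
          using N(3)[OF that] that True by (simp add: numeral_2_eq_2)
      qed
      have "unordered_davenport_le G (2 * ((2 * p - 1) * p ^ (n - 2 - 2)) + (4 - 2))"
        by (rule unordered_davenport_extension[OF N.subset short _ dN]) simp_all
      moreover have "2 * ((2 * p - 1) * p ^ (n - 2 - 2)) + (4 - 2) \<le> p ^ (n - 1)"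
        unfolding kk using one_le_power[of "2::nat" k] by (simp add: True n power_add)
      ultimately show ?thesis by (rule unordered_davenport_le_mono)
    next
      case False
      then have "p \<ge> 3" using p_gt_1 by simp
      have "unordered_davenport_le G ((2 * p - 1) * ((2 * p - 1) * p ^ (n - 2 - 2)))"
        by (rule quotient_davenport_extension[OF N(1) elementary_quotient_davenport[OF N(1-3)] dN])
      moreover have "(2 * p - 1) * ((2 * p - 1) * p ^ (n - 2 - 2)) \<le> p ^ (n - 1)"
      proof -
        obtain q where q: "p = q + 3" using \<open>p \<ge> 3\<close> by (metis add.commute le_Suc_ex)
        have "(2 * p - 1) * (2 * p - 1) \<le> p ^ 3"
          unfolding q by (simp add: power3_eq_cube algebra_simps)
        then have "(2 * p - 1) * (2 * p - 1) * p ^ k \<le> p ^ 3 * p ^ k" by (rule mult_right_mono) simp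
        moreover have "p ^ 3 * p ^ k = p ^ (n - 1)" unfolding n by (simp add: power_add[symmetric])
        ultimately show ?thesis unfolding kk by (simp add: mult.assoc)
      qed
      ultimately show ?thesis by (rule unordered_davenport_le_mono)
    qed
  next
    case True
    obtain a where a: "a \<in> carrier G" "N = generate G {a}" by (rule cyclic_subgroup_generator[OF sub True])
    have aN: "a \<in> N" using a generator_mem by blast
    have n3: "n \<noteq> 2"
    proof
      assume "n = 2"
      then have "card N = 1" using cN by simp
      then have "N = {\<one>}" using N.one_closed by (metis card_1_singletonE singletonD)
      obtain x where x: "x \<in> carrier G" "x \<noteq> \<one>"
        using nc trivial_imp_cyclic_group[of G] group_axioms one_closed
        unfolding trivial_group_def by blast
      have "N \<subseteq> generate G {x}" using \<open>N = {\<one>}\<close> generate.one by blast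
      then have "N \<subset> generate G {x}" using \<open>N = {\<one>}\<close> x generator_mem by blast
      then show False by (rule strict[OF x(1)])
    qed
    define m where "m = n - 3"
    have n: "n = m + 3" using n2 n3 by (simp add: m_def)
    have oa: "ord a = p ^ Suc m" using generate_pow_card[OF a(1)] a(2) cN n by simp
    define K where "K = generate G {a [^] p}"
    have ap: "a [^] p \<in> carrier G" using a by simp
    have K: "subgroup K G" unfolding K_def by (rule generate_subgroup[OF ap])
    have cK: "card K = p ^ m"
    proof -
      have "card K = ord (a [^] p)" using generate_pow_card[OF ap] by (simp add: K_def)
      also have "\<dots> = ord a div gcd (ord a) p" using ord_pow_gen[OF a(1), of p] p_gt_1 by simp
      also have "gcd (ord a) p = p" unfolding oa by (simp add: gcd_nat.absorb2)
      finally show ?thesis using oa p_gt_1 by simp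
    qed
    have pow_K: "x [^] p \<in> K" if xN: "x \<in> N" for x
    proof -
      obtain i :: nat where "x = a [^] i" using xN generate_nat_pow[OF a(1)] a(2) by blast
      then have "x [^] p = (a [^] p) [^] i" using a(1) by (simp add: nat_pow_pow mult.commute)
      then show ?thesis unfolding K_def using pow_mem_generate[OF ap] by simp
    qed
    have conj_pow: "g \<otimes> x [^] i \<otimes> inv g = (g \<otimes> x \<otimes> inv g) [^] i"
      if "g \<in> carrier G" "x \<in> carrier G" for g x and i :: nat
    proof (induction i)
      case 0 show ?case using that by simp
    next
      case (Suc i)
      have "g \<otimes> x [^] Suc i \<otimes> inv g = (g \<otimes> x [^] i \<otimes> inv g) \<otimes> (g \<otimes> x \<otimes> inv g)"
        using that by (simp add: m_assoc) (simp add: m_assoc[symmetric])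
      then show ?case using Suc by simp
    qed
    have K_normal: "K \<lhd> G"
    proof (rule normal_invI[OF K])
      fix g h assume g: "g \<in> carrier G" and "h \<in> K"
      then obtain i :: nat where i: "h = (a [^] p) [^] i"
        using generate_nat_pow[OF ap] unfolding K_def by blast
      then have h: "h = (a [^] i) [^] p" using a(1) by (simp add: nat_pow_pow mult.commute)
      have "g \<otimes> a [^] i \<otimes> inv g \<in> N"
        by (rule N.inv_op_closed2[OF g subgroup_nat_pow[OF sub aN]])
      then show "g \<otimes> h \<otimes> inv g \<in> K"
        unfolding h using conj_pow[OF g, of "a [^] i" p] a(1) pow_K by simp
    qed
    interpret K: normal K G by (rule K_normal)
    have card_K: "card K * p ^ 3 = order G" using cK n order_eq by (simp add: power_add)
    interpret Q: finite_p_group "G Mod K" p 3 by (rule quotient_p_group[OF K_normal card_K])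
    have exponent: "g [^] p \<in> K" if g: "g \<in> carrier G" for g
    proof (cases "g \<in> N")
      case True
      then show ?thesis by (rule pow_K)
    next
      case False
      obtain j :: nat where j: "g [^] p = a [^] j"
        using generate_nat_pow[OF a(1)] N(3)[OF g] a(2) by blast
      have "p dvd j"
      proof (rule ccontr)
        assume "\<not> p dvd j"
        then have "N = generate G {g [^] p}" using generate_coprime_power[OF a(1)] a(2) j by simp
        also have "\<dots> \<subseteq> generate G {g}"
          by (rule generate_subset[OF generate_subgroup[OF g] pow_mem_generate[OF g]])
        finally have "N \<subset> generate G {g}" using False generator_mem by blast
        then show False by (rule strict[OF g])
      qed
      then obtain i where "j = i * p" by (metis dvd_div_mult_self)
      then have "g [^] p = (a [^] i) [^] p" using j a(1) by (simp add: nat_pow_pow)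
      then show ?thesis using pow_K[OF subgroup_nat_pow[OF sub aN]] by simp
    qed
    let ?a = "K #> a"
    have aQ: "?a \<in> carrier (G Mod K)" using a(1) by (simp add: carrier_FactGroup)
    have N_Q: "K #> x \<in> generate (G Mod K) {?a}" if xN: "x \<in> N" for x
    proof -
      obtain i :: nat where "x = a [^] i" using xN generate_nat_pow[OF a(1)] a(2) by blast
      then have "K #> x = ?a [^]\<^bsub>G Mod K\<^esub> i" using a(1) by (simp add: K.FactGroup_pow)
      then show ?thesis using Q.pow_mem_generate[OF aQ] by simp
    qed
    have "ordered_davenport_le (G Mod K) (p ^ 2)"
    proof (rule Q.ordered_davenport_p_cubed[OF refl _ aQ])
      fix X assume "X \<in> carrier (G Mod K)"
      then obtain g where "g \<in> carrier G" "X = K #> g" by (auto simp: carrier_FactGroup)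
      then show "X [^]\<^bsub>G Mod K\<^esub> p = \<one>\<^bsub>G Mod K\<^esub>"
        using exponent coset_join2[OF _ K] by (simp add: K.FactGroup_pow)
    next
      have "a \<notin> K"
      proof
        assume "a \<in> K"
        then have "card N \<le> card K"
          using generate_subset[OF K] a(2) subgroup_finite[OF K] by (intro card_mono) auto
        then show False using cN cK n p_gt_1 by simp
      qed
      then show "?a \<noteq> \<one>\<^bsub>G Mod K\<^esub>" using coset_join1[OF _ a(1) K] by auto
      show "generate (G Mod K) {?a} \<lhd> G Mod K"
      proof (rule Q.normal_invI[OF Q.generate_subgroup[OF aQ]])
        fix X Y assume X: "X \<in> carrier (G Mod K)" and "Y \<in> generate (G Mod K) {?a}"
        then obtain i :: nat where i: "Y = ?a [^]\<^bsub>G Mod K\<^esub> i" using Q.generate_nat_pow[OF aQ] by blast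
        obtain g where g: "g \<in> carrier G" "X = K #> g" using X by (auto simp: carrier_FactGroup)
        have "X \<otimes>\<^bsub>G Mod K\<^esub> Y \<otimes>\<^bsub>G Mod K\<^esub> inv\<^bsub>G Mod K\<^esub> X = K #> (g \<otimes> a [^] i \<otimes> inv g)"
          using g a(1) X i by (simp add: K.FactGroup_pow K.inv_FactGroup K.rcos_inv K.rcos_sum)
        then show "X \<otimes>\<^bsub>G Mod K\<^esub> Y \<otimes>\<^bsub>G Mod K\<^esub> inv\<^bsub>G Mod K\<^esub> X \<in> generate (G Mod K) {?a}"
          using N_Q[OF N.inv_op_closed2[OF g(1) subgroup_nat_pow[OF sub aN]]] by simp
      qed
      fix X Y assume X: "X \<in> carrier (G Mod K)" and Y: "Y \<in> carrier (G Mod K)"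
      then obtain x y where xy: "x \<in> carrier G" "y \<in> carrier G" "X = K #> x" "Y = K #> y"
        by (auto simp: carrier_FactGroup)
      have "Y \<otimes>\<^bsub>G Mod K\<^esub> X = K #> (y \<otimes> x)" "X \<otimes>\<^bsub>G Mod K\<^esub> Y = K #> (x \<otimes> y)"
        using xy by (simp_all add: K.rcos_sum)
      moreover have "inv\<^bsub>G Mod K\<^esub> (K #> (y \<otimes> x)) = K #> inv (y \<otimes> x)"
        using xy by (simp add: K.inv_FactGroup K.rcos_inv carrier_FactGroup del: inv_mult_group)
      moreover have "(K #> inv (y \<otimes> x)) \<otimes>\<^bsub>G Mod K\<^esub> (K #> (x \<otimes> y))
          = K #> (inv (y \<otimes> x) \<otimes> (x \<otimes> y))"
        using xy by (simp add: K.rcos_sum)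
      ultimately show "inv\<^bsub>G Mod K\<^esub> (Y \<otimes>\<^bsub>G Mod K\<^esub> X) \<otimes>\<^bsub>G Mod K\<^esub> (X \<otimes>\<^bsub>G Mod K\<^esub> Y)
          \<in> generate (G Mod K) {?a}"
        using N_Q[OF N(4)[OF xy(1,2)]] by simp
    qed
    then have "unordered_davenport_le G (p ^ 2 * card K)"
      by (rule quotient_davenport_extension[OF K_normal _ subgroup_davenport_le_card[OF K]])
    moreover have "p ^ 2 * card K = p ^ (n - 1)"
      unfolding cK n by (simp add: power_add[symmetric])
    ultimately show ?thesis by simp
  qed
qed

end

section \<open>The characterization\<close>

theorem theorem1p7:
  fixes G (structure) and p n :: nat
  assumes "prime p"
    and "group G"
    and "finite (carrier G)"
    and "order G = p ^ n"
    and "\<not> cyclic_group G"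
  shows "(\<exists>H. subgroup H G \<and> cyclic_group (G\<lparr>carrier := H\<rparr>) \<and> card (rcosets H) = p) \<longleftrightarrow>
         small_davenport G + 1 = ordered_davenport G \<and>
         ordered_davenport G = loewy_length p G \<and>
         loewy_length p G = enat (order G div p + p - 1)"
proof -
  interpret group G by fact
  interpret finite_p_group G p n
    using assms by unfold_locales
  have n: "n \<ge> 2" by (rule noncyclic_davenport(1)[OF assms(5)])
  have div: "order G div p = p ^ (n - 1)"
  proof -
    have "order G = p ^ (n - 1) * p"
      using n order_eq by (cases n) (simp_all add: mult.commute)
    then show ?thesis using p_gt_1 by simp
  qed
  have pos: "order G div p > 0" using div p_gt_1 by simp
  let ?m = "order G div p + p - 1"
  show ?thesis
  proof
    assume "\<exists>H. subgroup H G \<and> cyclic_group (G\<lparr>carrier := H\<rparr>) \<and> card (rcosets H) = p"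
    then obtain H where H: "subgroup H G" "cyclic_group (G\<lparr>carrier := H\<rparr>)" "card (rcosets H) = p"
      by blast
    note nil = augI_nilpotent_cyclic_index_p[OF H assms(5)]
    have m: "?m \<ge> 1" "?m = (order G div p + p - 2) + 1" using pos p_gt_1 by auto
    have "enat ?m = enat (order G div p + p - 2) + 1" unfolding m(2) by (simp add: one_enat_def)
    also have "\<dots> \<le> small_davenport G + 1"
      by (rule add_right_mono[OF small_davenport_lower_bound[OF H]])
    finally have 1: "enat ?m \<le> small_davenport G + 1" .
    note 2 = small_davenport_le_ordered[of G]
    note 3 = loewy_length_bounds(2)[OF nil m(1)]
    note 4 = loewy_length_bounds(1)[OF nil m(1)]
    have "loewy_length p G = enat ?m"
      by (rule antisym[OF 4 order_trans[OF 1 order_trans[OF 2 3]]])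
    moreover have "ordered_davenport G = enat ?m"
      by (rule antisym[OF order_trans[OF 3 4] order_trans[OF 1 2]])
    moreover have "small_davenport G + 1 = enat ?m"
      by (rule antisym[OF order_trans[OF 2 order_trans[OF 3 4]] 1])
    ultimately show "small_davenport G + 1 = ordered_davenport G \<and>
        ordered_davenport G = loewy_length p G \<and> loewy_length p G = enat ?m"
      by simp
  next
    assume eq: "small_davenport G + 1 = ordered_davenport G \<and> ordered_davenport G = loewy_length p G \<and>
        loewy_length p G = enat ?m"
    show "\<exists>H. subgroup H G \<and> cyclic_group (G\<lparr>carrier := H\<rparr>) \<and> card (rcosets H) = p"
    proof (rule ccontr)
      assume "\<not> ?thesis"
      then have "unordered_davenport_le G (p ^ (n - 1))"
        by (intro davenport_no_cyclic_index_p[OF assms(5)]) blast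
      then have "small_davenport G + 1 \<le> enat (p ^ (n - 1))" by (rule small_davenport_le)
      then have "enat ?m \<le> enat (p ^ (n - 1))" using eq by simp
      then show False using div p_gt_1 by simp
    qed
  qed
qed

end
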